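(* Let $p\in[0,1)$ and $\beta=\frac{2}{1-p}$. There exists $\varepsilon_0>0$ such that the following holds for every constant $\varepsilon$ with $|\varepsilon|<\varepsilon_0$. Let $$a(x)=\begin{pmatrix}1+\frac{\varepsilon x_2^2}{|x|^2}&-\frac{\varepsilon x_1x_2}{|x|^2}\\[2pt]-\frac{\varepsilon x_1x_2}{|x|^2}&1+\frac{\varepsilon x_1^2}{|x|^2}\end{pmatrix},\qquad x=(x_1,x_2)\in\mathbb{R}^2\setminus\{0\},$$ and let $v\ge0$ be a strong solution of $\sum_{i,j}a_{ij}v_{ij}=v^p$ in $B_1\subset\mathbb{R}^2$. Assume that $0\in\partial\{v>0\}$ and that $v$ is non-degenerate at $0$. Then $$\int_{B_{1/2}}\left(\beta\,\frac{v(x)}{|x|^\beta}-\frac{\partial_r v(x)}{|x|^{\beta-1}}\right)^2\frac{dx}{|x|^2}\le\tilde C$$ for some $\tilde C>0$ depending on $\|v\|_{L^\infty(B_1)}$.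
   Context: $B_r$ is the open disc of radius $r$ centred at the origin, $v_{ij}=\partial^2_{ij}v$, and $\partial_r v(x)=\nabla v(x)\cdot\frac{x}{|x|}$ is the radial derivative. For $p=0$, $v^p$ denotes $\chi_{\{v>0\}}$. A strong solution is a function $v\in W^{2,2}_{loc}(B_1)$ (here $n=2$) satisfying the equation almost everywhere. For a sequence of positive numbers $r_k\to0$, the blow-up sequence of $v$ at $0$ is $v_{r_k}(x)=v(r_kx)/r_k^\beta$; a blow-up limit at $0$ is a function $v_0$ which is the limit in $C^1_{loc}(\mathbb{R}^2)$ of a subsequence of such a blow-up sequence. The function $v$ is non-degenerate at $0\in\partial\{v>0\}$ if there exists a sequence of positive numbers $r_k\to0$ such that the corresponding blow-up limit is not identically zero. *)

theory Defs
  imports "HOL-Analysis.Analysis" "HOL-Probability.Essential_Supremum"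
begin

section \<open>Weak derivatives and Sobolev spaces\<close>

definition partial :: "'n::finite \<Rightarrow> (real^'n \<Rightarrow> real) \<Rightarrow> real^'n \<Rightarrow> real" where
  "partial i f x = frechet_derivative f (at x) (axis i 1)"

text \<open>Classical $C^k(U)$; meaningful for open \<open>U\<close> only.\<close>

primrec C_class :: "nat \<Rightarrow> (real^'n::finite) set \<Rightarrow> (real^'n \<Rightarrow> real) \<Rightarrow> bool" where
  "C_class 0 U f \<longleftrightarrow> continuous_on U f"
| "C_class (Suc k) U f \<longleftrightarrow>
     (\<forall>x\<in>U. f differentiable (at x)) \<and> (\<forall>i. C_class k U (partial i f))"

definition test_functions :: "(real^'n::finite) set \<Rightarrow> (real^'n \<Rightarrow> real) set" where
  "test_functions \<Omega> =
     {\<phi>. (\<forall>k. C_class k UNIV \<phi>) \<and>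
         compact (closure {x. \<phi> x \<noteq> 0}) \<and> closure {x. \<phi> x \<noteq> 0} \<subseteq> \<Omega>}"

definition Lq_loc :: "real \<Rightarrow> (real^'n::finite) set \<Rightarrow> (real^'n \<Rightarrow> real) \<Rightarrow> bool" where
  "Lq_loc q \<Omega> f \<longleftrightarrow>
     (\<forall>K. compact K \<longrightarrow> K \<subseteq> \<Omega> \<longrightarrow>
        f \<in> borel_measurable (lebesgue_on K) \<and>
        integrable (lebesgue_on K) (\<lambda>x. \<bar>f x\<bar> powr q))"

definition has_weak_partial ::
    "(real^'n::finite) set \<Rightarrow> 'n \<Rightarrow> (real^'n \<Rightarrow> real) \<Rightarrow> (real^'n \<Rightarrow> real) \<Rightarrow> bool" where
  "has_weak_partial \<Omega> i f g \<longleftrightarrow>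
     Lq_loc 1 \<Omega> f \<and> Lq_loc 1 \<Omega> g \<and>
     (\<forall>\<phi>\<in>test_functions \<Omega>.
        (LINT x:\<Omega>|lebesgue. f x * partial i \<phi> x) = - (LINT x:\<Omega>|lebesgue. g x * \<phi> x))"

text \<open>Weak partial derivatives are unique up to null sets. \<open>weak_partial\<close> picks one representative;
  below it only occurs under integrals, in almost-everywhere statements, or inside notions that
  do not depend on the representative.\<close>

definition weak_partial ::
    "(real^'n::finite) set \<Rightarrow> 'n \<Rightarrow> (real^'n \<Rightarrow> real) \<Rightarrow> real^'n \<Rightarrow> real" where
  "weak_partial \<Omega> i f = (SOME g. has_weak_partial \<Omega> i f g)"

definition weak_gradient ::
    "(real^'n::finite) set \<Rightarrow> (real^'n \<Rightarrow> real) \<Rightarrow> real^'n \<Rightarrow> real^'n" where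
  "weak_gradient \<Omega> f x = (\<chi> i. weak_partial \<Omega> i f x)"

text \<open>\<open>W2_loc k \<Omega> f\<close> means $f \in W^{k,2}_{loc}(\Omega)$.\<close>

primrec W2_loc :: "nat \<Rightarrow> (real^'n::finite) set \<Rightarrow> (real^'n \<Rightarrow> real) \<Rightarrow> bool" where
  "W2_loc 0 \<Omega> f \<longleftrightarrow> Lq_loc 2 \<Omega> f"
| "W2_loc (Suc k) \<Omega> f \<longleftrightarrow>
     Lq_loc 2 \<Omega> f \<and>
     (\<forall>i. (\<exists>g. has_weak_partial \<Omega> i f g) \<and> W2_loc k \<Omega> (weak_partial \<Omega> i f))"

text \<open>The value is \<open>\<infinity>\<close> if \<open>f\<close> is not measurable on \<open>\<Omega>\<close>.\<close>

definition Linfty_norm :: "(real^'n::finite) set \<Rightarrow> (real^'n \<Rightarrow> real) \<Rightarrow> ennreal" where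
  "Linfty_norm \<Omega> f = esssup (lebesgue_on \<Omega>) (\<lambda>x. ennreal \<bar>f x\<bar>)"


section \<open>The equation\<close>

text \<open>Since \<open>0 powr p = 0\<close> for every \<open>p\<close>, including \<open>p = 0\<close>, the term \<open>v x powr p\<close> with \<open>v x \<ge> 0\<close>
  and \<open>p = 0\<close> is the characteristic function of \<open>{v > 0}\<close>.\<close>

definition strong_solution ::
    "(real^'n \<Rightarrow> real^'n^'n) \<Rightarrow> real \<Rightarrow> (real^'n::finite) set \<Rightarrow> (real^'n \<Rightarrow> real) \<Rightarrow> bool" where
  "strong_solution a p \<Omega> v \<longleftrightarrow>
     W2_loc 2 \<Omega> v \<and>
     (AE x in lebesgue_on \<Omega>.
        (\<Sum>i\<in>UNIV. \<Sum>j\<in>UNIV. a x $ i $ j * weak_partial \<Omega> j (weak_partial \<Omega> i v) x)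
          = v x powr p)"

definition coeff_matrix :: "real \<Rightarrow> real^2 \<Rightarrow> real^2^2" where
  "coeff_matrix \<epsilon> x = vector
     [vector [1 + \<epsilon> * (x$2)\<^sup>2 / (norm x)\<^sup>2, - (\<epsilon> * x$1 * x$2 / (norm x)\<^sup>2)],
      vector [- (\<epsilon> * x$1 * x$2 / (norm x)\<^sup>2), 1 + \<epsilon> * (x$1)\<^sup>2 / (norm x)\<^sup>2]]"

definition radial_deriv ::
    "(real^'n::finite) set \<Rightarrow> (real^'n \<Rightarrow> real) \<Rightarrow> real^'n \<Rightarrow> real" where
  "radial_deriv \<Omega> v x = weak_gradient \<Omega> v x \<bullet> (x /\<^sub>R norm x)"


section \<open>Blow-ups and non-degeneracy at the origin\<close>

definition blowup :: "real \<Rightarrow> (real^'n::finite \<Rightarrow> real) \<Rightarrow> real \<Rightarrow> real^'n \<Rightarrow> real" where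
  "blowup \<beta> v r x = v (r *\<^sub>R x) / r powr \<beta>"

text \<open>$C^1_{loc}$ convergence on the whole space. The functions \<open>f k\<close> are only required to be $C^1$
  on any given ball from some index on: a blow-up of a function on the unit ball is
  meaningful only on a ball of radius \<open>1 / r\<close>.\<close>

definition C1_loc_limit ::
    "(nat \<Rightarrow> real^'n::finite \<Rightarrow> real) \<Rightarrow> (real^'n \<Rightarrow> real) \<Rightarrow> bool" where
  "C1_loc_limit f g \<longleftrightarrow>
     C_class 1 UNIV g \<and>
     (\<forall>R>0.
        (\<forall>\<^sub>F k in sequentially. C_class 1 (ball 0 R) (f k)) \<and>
        uniform_limit (ball 0 R) f g sequentially \<and>
        (\<forall>i. uniform_limit (ball 0 R) (\<lambda>k. partial i (f k)) (partial i g) sequentially))"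

definition blowup_limit ::
    "real \<Rightarrow> (real^'n::finite \<Rightarrow> real) \<Rightarrow> (nat \<Rightarrow> real) \<Rightarrow> (real^'n \<Rightarrow> real) \<Rightarrow> bool" where
  "blowup_limit \<beta> v r v\<^sub>0 \<longleftrightarrow>
     (\<exists>s. strict_mono s \<and> C1_loc_limit (\<lambda>k. blowup \<beta> v (r (s k))) v\<^sub>0)"

definition nondegenerate_at_0 :: "real \<Rightarrow> (real^'n::finite \<Rightarrow> real) \<Rightarrow> bool" where
  "nondegenerate_at_0 \<beta> v \<longleftrightarrow>
     (\<exists>r v\<^sub>0. (\<forall>k. 0 < r k) \<and> r \<longlonglongrightarrow> 0 \<and> blowup_limit \<beta> v r v\<^sub>0 \<and> (\<exists>x. v\<^sub>0 x \<noteq> 0))"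

end

theory Submission
  imports Defs
begin

text \<open>In the variables \<open>s = ln r\<close> and \<open>\<theta>\<close>, the function \<open>W = v / r\<^sup>\<beta>\<close> satisfies the autonomous equation
  \<open>W\<^sub>s\<^sub>s + (2\<beta> + \<epsilon>) W\<^sub>s + \<beta>(\<beta> + \<epsilon>) W + (1 + \<epsilon>) W\<^sub>\<theta>\<^sub>\<theta> = W\<^sup>p\<close>, and the quantity to be bounded is the integral of
  \<open>W\<^sub>s\<^sup>2\<close>. Testing with \<open>\<phi>(s) W\<^sub>s\<close> expresses \<open>(2\<beta> + \<epsilon>) \<integral> \<phi> W\<^sub>s\<^sup>2\<close> through integrals that contain \<open>\<phi>'\<close>;
  testing with \<open>\<phi>' W\<close> removes the indefinite ones among them and leaves \<open>\<integral> \<phi>' W\<^sub>s\<^sup>2\<close>, a negative multiple of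
  \<open>\<integral> \<phi>' W\<^sup>p\<^sup>+\<^sup>1\<close>, and terms in \<open>W W\<^sub>s\<close>. Let \<open>\<phi>\<close> increase from \<open>0\<close> to \<open>1\<close> on a shell of radius \<open>r\<^sub>k\<close> and decrease
  again near the unit circle. The outer contribution is controlled by the supremum of \<open>v\<close>. On the inner shells \<open>W\<close> is
  bounded by non-degeneracy, which first shows that the integral is finite; hence \<open>W\<^sub>s\<close> tends to \<open>0\<close> in the
  mean on these shells, and the inner contribution disappears in the limit.\<close>

section \<open>Square-integrable functions\<close>

text \<open>The matrix is the identity plus \<epsilon> times the projection onto the angular
  direction, so off the origin the operator is
  \<open>v_rr + (1 + \<epsilon>) (v_r / r + v_\<theta>\<theta> / r^2)\<close>, and \<beta> - 2 =
  \<beta> p cancels every power of r; hence the autonomous equation. With |\<epsilon>| < 1 both 1 +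
  \<epsilon> > 0 and 2\<beta> + \<epsilon> >= 1 hold. The potential term has a sign because 1/(p+1)
  > 1/2. Regularity is the obstacle: v has two weak derivatives, W_s only one. Every integration by
  parts is proved for C^1 functions and carried to triples (function, derivative in ln r, derivative
  in \<theta>) that are strong L2 limits of such functions; mollification supplies the approximants.
  Polar coordinates never appear as a change of variables: the derivatives are x . grad and its
  rotation, the measure is dx / |x|^2. The bound of W on the inner shells depends on the solution
  and not just on its supremum, so it must not survive in the constant. Hence two estimates from one
  identity: one containing this bound, for finiteness, and one where it carries a factor
  \<delta>.\<close>

definition L2 :: "'a measure \<Rightarrow> ('a \<Rightarrow> real) \<Rightarrow> bool" where
  "L2 M f \<longleftrightarrow> f \<in> borel_measurable M \<and> integrable M (\<lambda>x. (f x)\<^sup>2)"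

lemma L2_measurable: "L2 M f \<Longrightarrow> f \<in> borel_measurable M"
  and L2_integrable_square: "L2 M f \<Longrightarrow> integrable M (\<lambda>x. (f x)\<^sup>2)"
  by (simp_all add: L2_def)

lemma L2_integrable_mult:
  assumes "L2 M f" "L2 M g"
  shows "integrable M (\<lambda>x. f x * g x)"
proof (rule Bochner_Integration.integrable_bound)
  show "integrable M (\<lambda>x. (f x)\<^sup>2 + (g x)\<^sup>2)"
    using assms by (simp add: L2_def)
  show "(\<lambda>x. f x * g x) \<in> borel_measurable M"
    using assms by (intro borel_measurable_times L2_measurable)
  have "\<bar>f x * g x\<bar> \<le> (f x)\<^sup>2 + (g x)\<^sup>2" for x
    using sum_squares_bound[of "\<bar>f x\<bar>" "\<bar>g x\<bar>"]
      abs_ge_zero[of "f x * g x"] unfolding abs_mult power2_abs by linarith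
  then show "AE x in M. norm (f x * g x) \<le> norm ((f x)\<^sup>2 + (g x)\<^sup>2)"
    by auto
qed

lemma L2_add:
  assumes "L2 M f" "L2 M g"
  shows "L2 M (\<lambda>x. f x + g x)"
  using assms L2_integrable_mult[OF assms]
  by (auto simp: L2_def power2_sum mult.assoc intro!: borel_measurable_add)

lemma L2_bounded_mult:
  assumes "L2 M f" "g \<in> borel_measurable M" "\<And>x. x \<in> space M \<Longrightarrow> \<bar>g x\<bar> \<le> B"
  shows "L2 M (\<lambda>x. g x * f x)"
proof -
  have "integrable M (\<lambda>x. (g x * f x)\<^sup>2)"
  proof (rule Bochner_Integration.integrable_bound)
    show "integrable M (\<lambda>x. B\<^sup>2 * (f x)\<^sup>2)"
      using assms by (simp add: L2_def)
    show "(\<lambda>x. (g x * f x)\<^sup>2) \<in> borel_measurable M"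
      using assms by (intro borel_measurable_power borel_measurable_times) (auto simp: L2_def)
    show "AE x in M. norm ((g x * f x)\<^sup>2) \<le> norm (B\<^sup>2 * (f x)\<^sup>2)"
    proof (rule AE_I2)
      fix x assume "x \<in> space M"
      then have "(g x)\<^sup>2 \<le> B\<^sup>2"
        using assms(3)[of x] by (metis abs_ge_zero power2_abs power_mono)
      then show "norm ((g x * f x)\<^sup>2) \<le> norm (B\<^sup>2 * (f x)\<^sup>2)"
        by (simp add: power_mult_distrib mult_right_mono)
    qed
  qed
  then show ?thesis using assms by (auto simp: L2_def intro!: borel_measurable_times)
qed

lemma L2_cmult: "L2 M f \<Longrightarrow> L2 M (\<lambda>x. c * f x)"
  by (rule L2_bounded_mult[where B="\<bar>c\<bar>"]) auto

lemma L2_diff: "L2 M f \<Longrightarrow> L2 M g \<Longrightarrow> L2 M (\<lambda>x. f x - g x)"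
  using L2_add[of M f "\<lambda>x. -1 * g x"] L2_cmult[of M g "-1"] by simp

text \<open>The quadratic form \<open>(s, t) \<mapsto> \<integral> (s f + t g)\<^sup>2\<close> is
  nonnegative. Its value at \<open>(C, -B)\<close> gives the inequality when \<open>C\<close> is
  nonzero.\<close>

lemma L2_Cauchy_Schwarz:
  assumes f: "L2 M f" and g: "L2 M g"
  shows "\<bar>\<integral>x. f x * g x \<partial>M\<bar> \<le> sqrt (\<integral>x. (f x)\<^sup>2 \<partial>M) * sqrt (\<integral>x. (g x)\<^sup>2 \<partial>M)"
proof -
  define A B C where "A = (\<integral>x. (f x)\<^sup>2 \<partial>M)" and "B = (\<integral>x. f x * g x \<partial>M)"
    and "C = (\<integral>x. (g x)\<^sup>2 \<partial>M)"
  note i = L2_integrable_square[OF f] L2_integrable_square[OF g] L2_integrable_mult[OF f g]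
  have AC: "A \<ge> 0" "C \<ge> 0" by (simp_all add: A_def C_def)
  have q: "0 \<le> s\<^sup>2 * A + 2 * s * t * B + t\<^sup>2 * C" for s t
  proof -
    have "0 \<le> (\<integral>x. (s * f x + t * g x)\<^sup>2 \<partial>M)" by simp
    also have "\<dots> = (\<integral>x. s\<^sup>2 * (f x)\<^sup>2 + (2 * s * t) * (f x * g x) + t\<^sup>2 * (g x)\<^sup>2 \<partial>M)"
      by (rule Bochner_Integration.integral_cong) (auto simp: power2_sum algebra_simps power2_eq_square)
    also have "\<dots> = s\<^sup>2 * A + (2 * s * t) * B + t\<^sup>2 * C"
      using i by (simp add: A_def B_def C_def)
    finally show ?thesis by simp
  qed
  have "B\<^sup>2 \<le> A * C"
  proof (cases "C = 0")
    case True
    \<comment> \<open>With \<open>C = 0\<close> the form is affine in \<open>t\<close> for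
      \<open>s = 1\<close>; this \<open>t\<close> is chosen to make its value -1.\<close>
    have "B = 0"
    proof (rule ccontr)
      assume "B \<noteq> 0"
      then have "2 * (- (A + 1) / (2 * B)) * B = - (A + 1)" by simp
      then show False using q[of 1 "- (A + 1) / (2 * B)"] AC True by simp
    qed
    then show ?thesis using True by simp
  next
    case False
    then have "0 \<le> C * (A * C - B\<^sup>2)"
      using q[of C "-B"] by (simp add: algebra_simps power2_eq_square)
    then show ?thesis using False AC by (simp add: zero_le_mult_iff)
  qed
  then have "sqrt (B\<^sup>2) \<le> sqrt (A * C)" by (rule real_sqrt_le_mono)
  then show ?thesis by (simp add: A_def B_def C_def real_sqrt_mult)
qed

text \<open>Membership of all terms and of the limit is part of the notion because the Bochner
  integral of a non-integrable function is 0 by default, so convergence of the integrals alone would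
  say nothing.\<close>

definition L2_tendsto :: "'a measure \<Rightarrow> (nat \<Rightarrow> 'a \<Rightarrow> real) \<Rightarrow> ('a \<Rightarrow> real) \<Rightarrow> bool" where
  "L2_tendsto M u f \<longleftrightarrow> (\<forall>n. L2 M (u n)) \<and> L2 M f \<and> (\<lambda>n. \<integral>x. (u n x - f x)\<^sup>2 \<partial>M) \<longlonglongrightarrow> 0"

lemma L2_tendstoD:
  "L2_tendsto M u f \<Longrightarrow> L2 M (u n)" "L2_tendsto M u f \<Longrightarrow> L2 M f"
  "L2_tendsto M u f \<Longrightarrow> (\<lambda>n. \<integral>x. (u n x - f x)\<^sup>2 \<partial>M) \<longlonglongrightarrow> 0"
  by (auto simp: L2_tendsto_def)

lemma integral_square_add_le:
  assumes "L2 M f" "L2 M g"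
  shows "(\<integral>x. (f x + g x)\<^sup>2 \<partial>M) \<le> 2 * (\<integral>x. (f x)\<^sup>2 \<partial>M) + 2 * (\<integral>x. (g x)\<^sup>2 \<partial>M)"
proof -
  have "(\<integral>x. (f x + g x)\<^sup>2 \<partial>M) \<le> (\<integral>x. 2 * (f x)\<^sup>2 + 2 * (g x)\<^sup>2 \<partial>M)"
  proof (rule integral_mono)
    show "integrable M (\<lambda>x. (f x + g x)\<^sup>2)"
      using L2_add[OF assms] by (simp add: L2_def)
    show "integrable M (\<lambda>x. 2 * (f x)\<^sup>2 + 2 * (g x)\<^sup>2)"
      using assms by (simp add: L2_def)
    fix x show "(f x + g x)\<^sup>2 \<le> 2 * (f x)\<^sup>2 + 2 * (g x)\<^sup>2"
      using sum_squares_bound[of "f x" "g x"] by (simp add: power2_sum)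
  qed
  also have "\<dots> = 2 * (\<integral>x. (f x)\<^sup>2 \<partial>M) + 2 * (\<integral>x. (g x)\<^sup>2 \<partial>M)"
    using assms by (simp add: L2_def)
  finally show ?thesis .
qed

lemma L2_tendsto_add:
  assumes u: "L2_tendsto M u f" and w: "L2_tendsto M w g"
  shows "L2_tendsto M (\<lambda>n x. u n x + w n x) (\<lambda>x. f x + g x)"
  unfolding L2_tendsto_def
proof (intro conjI allI)
  show "L2 M (\<lambda>x. u n x + w n x)" for n
    using L2_tendstoD(1)[OF u] L2_tendstoD(1)[OF w] by (rule L2_add)
  show "L2 M (\<lambda>x. f x + g x)"
    using L2_tendstoD(2)[OF u] L2_tendstoD(2)[OF w] by (rule L2_add)
  have lim: "(\<lambda>n. 2 * (\<integral>x. (u n x - f x)\<^sup>2 \<partial>M) + 2 * (\<integral>x. (w n x - g x)\<^sup>2 \<partial>M)) \<longlonglongrightarrow> 0"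
    using tendsto_add[OF tendsto_mult_left[OF L2_tendstoD(3)[OF u], of 2]
        tendsto_mult_left[OF L2_tendstoD(3)[OF w], of 2]] by simp
  show "(\<lambda>n. \<integral>x. (u n x + w n x - (f x + g x))\<^sup>2 \<partial>M) \<longlonglongrightarrow> 0"
  proof (rule tendsto_sandwich[OF _ _ tendsto_const lim])
    show "\<forall>\<^sub>F n in sequentially. (\<integral>x. (u n x + w n x - (f x + g x))\<^sup>2 \<partial>M)
        \<le> 2 * (\<integral>x. (u n x - f x)\<^sup>2 \<partial>M) + 2 * (\<integral>x. (w n x - g x)\<^sup>2 \<partial>M)"
    proof (rule always_eventually, rule allI)
      fix n
      show "(\<integral>x. (u n x + w n x - (f x + g x))\<^sup>2 \<partial>M)
        \<le> 2 * (\<integral>x. (u n x - f x)\<^sup>2 \<partial>M) + 2 * (\<integral>x. (w n x - g x)\<^sup>2 \<partial>M)"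
        using integral_square_add_le[OF L2_diff[OF L2_tendstoD(1)[OF u, of n] L2_tendstoD(2)[OF u]]
            L2_diff[OF L2_tendstoD(1)[OF w, of n] L2_tendstoD(2)[OF w]]]
        by (simp add: algebra_simps)
    qed
  qed simp
qed

lemma L2_tendsto_bounded_mult:
  assumes u: "L2_tendsto M u f" and g: "g \<in> borel_measurable M"
    and B: "\<And>x. x \<in> space M \<Longrightarrow> \<bar>g x\<bar> \<le> B"
  shows "L2_tendsto M (\<lambda>n x. g x * u n x) (\<lambda>x. g x * f x)"
  unfolding L2_tendsto_def
proof (intro conjI allI)
  show "L2 M (\<lambda>x. g x * u n x)" for n
    using L2_tendstoD(1)[OF u] g B by (rule L2_bounded_mult)
  show "L2 M (\<lambda>x. g x * f x)"
    using L2_tendstoD(2)[OF u] g B by (rule L2_bounded_mult)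
  have lim: "(\<lambda>n. B\<^sup>2 * (\<integral>x. (u n x - f x)\<^sup>2 \<partial>M)) \<longlonglongrightarrow> 0"
    using tendsto_mult_left[OF L2_tendstoD(3)[OF u], of "B\<^sup>2"] by simp
  show "(\<lambda>n. \<integral>x. (g x * u n x - g x * f x)\<^sup>2 \<partial>M) \<longlonglongrightarrow> 0"
  proof (rule tendsto_sandwich[OF _ _ tendsto_const lim])
    show "\<forall>\<^sub>F n in sequentially. (\<integral>x. (g x * u n x - g x * f x)\<^sup>2 \<partial>M)
        \<le> B\<^sup>2 * (\<integral>x. (u n x - f x)\<^sup>2 \<partial>M)"
    proof (rule always_eventually, rule allI)
      fix n
      note d = L2_diff[OF L2_tendstoD(1)[OF u, of n] L2_tendstoD(2)[OF u]]
      have "(\<integral>x. (g x * (u n x - f x))\<^sup>2 \<partial>M) \<le> (\<integral>x. B\<^sup>2 * (u n x - f x)\<^sup>2 \<partial>M)"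
      proof (rule integral_mono)
        show "integrable M (\<lambda>x. (g x * (u n x - f x))\<^sup>2)"
          using L2_bounded_mult[OF d g B] by (simp add: L2_def)
        show "integrable M (\<lambda>x. B\<^sup>2 * (u n x - f x)\<^sup>2)"
          using d by (simp add: L2_def)
        fix x assume "x \<in> space M"
        then have "(g x)\<^sup>2 \<le> B\<^sup>2"
          using B[of x] by (metis abs_ge_zero power2_abs power_mono)
        then show "(g x * (u n x - f x))\<^sup>2 \<le> B\<^sup>2 * (u n x - f x)\<^sup>2"
          by (simp add: power_mult_distrib mult_right_mono)
      qed
      then show "(\<integral>x. (g x * u n x - g x * f x)\<^sup>2 \<partial>M) \<le> B\<^sup>2 * (\<integral>x. (u n x - f x)\<^sup>2 \<partial>M)"
        by (simp add: right_diff_distrib)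
    qed
  qed simp
qed

text \<open>Strong convergence in both factors, via
  \<open>uw - fg = (u-f)(w-g) + f(w-g) + (u-f)g\<close> and Cauchy-Schwarz. This carries each
  integration by parts from the smooth approximants to their limits.\<close>

lemma L2_tendsto_integral_mult:
  assumes u: "L2_tendsto M u f" and w: "L2_tendsto M w g"
  shows "(\<lambda>n. \<integral>x. u n x * w n x \<partial>M) \<longlonglongrightarrow> (\<integral>x. f x * g x \<partial>M)"
proof -
  note uL = L2_tendstoD(1)[OF u] and fL = L2_tendstoD(2)[OF u]
    and wL = L2_tendstoD(1)[OF w] and gL = L2_tendstoD(2)[OF w]
  define a b where "a n = sqrt (\<integral>x. (u n x - f x)\<^sup>2 \<partial>M)" and
    "b n = sqrt (\<integral>x. (w n x - g x)\<^sup>2 \<partial>M)" for n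
  define F G where "F = sqrt (\<integral>x. (f x)\<^sup>2 \<partial>M)" and "G = sqrt (\<integral>x. (g x)\<^sup>2 \<partial>M)"
  have a0: "a \<longlonglongrightarrow> 0" and b0: "b \<longlonglongrightarrow> 0"
    using tendsto_real_sqrt[OF L2_tendstoD(3)[OF u]] tendsto_real_sqrt[OF L2_tendstoD(3)[OF w]]
    by (simp_all add: a_def[abs_def] b_def[abs_def])
  have "(\<lambda>n. a n * b n + F * b n + a n * G) \<longlonglongrightarrow> 0 * 0 + F * 0 + 0 * G"
    by (intro tendsto_intros a0 b0)
  then have lim: "(\<lambda>n. a n * b n + F * b n + a n * G) \<longlonglongrightarrow> 0" by simp
  have "(\<lambda>n. (\<integral>x. u n x * w n x \<partial>M) - (\<integral>x. f x * g x \<partial>M)) \<longlonglongrightarrow> 0"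
  proof (rule Lim_null_comparison[OF always_eventually lim], rule allI)
    fix n
    note du = L2_diff[OF uL[of n] fL] and dw = L2_diff[OF wL[of n] gL]
    have "(\<integral>x. u n x * w n x \<partial>M) - (\<integral>x. f x * g x \<partial>M)
        = (\<integral>x. u n x * w n x - f x * g x \<partial>M)"
      using L2_integrable_mult[OF uL[of n] wL[of n]] L2_integrable_mult[OF fL gL] by simp
    also have "\<dots> = (\<integral>x. (u n x - f x) * (w n x - g x) + f x * (w n x - g x)
        + (u n x - f x) * g x \<partial>M)"
      by (rule Bochner_Integration.integral_cong) (auto simp: algebra_simps)
    also have "\<dots> = (\<integral>x. (u n x - f x) * (w n x - g x) \<partial>M) + (\<integral>x. f x * (w n x - g x) \<partial>M)
        + (\<integral>x. (u n x - f x) * g x \<partial>M)"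
      using L2_integrable_mult[OF du dw] L2_integrable_mult[OF fL dw]
        L2_integrable_mult[OF du gL] by simp
    finally show "norm ((\<integral>x. u n x * w n x \<partial>M) - (\<integral>x. f x * g x \<partial>M))
        \<le> a n * b n + F * b n + a n * G"
      using L2_Cauchy_Schwarz[OF du dw] L2_Cauchy_Schwarz[OF fL dw] L2_Cauchy_Schwarz[OF du gL]
      unfolding a_def b_def F_def G_def real_norm_def by linarith
  qed
  then show ?thesis by (simp add: LIM_zero_iff)
qed

lemma L2_tendsto_unique:
  assumes u: "L2_tendsto M u f" and w: "L2_tendsto M u g"
  shows "AE x in M. f x = g x"
proof -
  note d = L2_diff[OF L2_tendstoD(2)[OF u] L2_tendstoD(2)[OF w]]
  have "(\<integral>x. (f x - g x)\<^sup>2 \<partial>M) \<le> 2 * (\<integral>x. (u n x - f x)\<^sup>2 \<partial>M) + 2 * (\<integral>x. (u n x - g x)\<^sup>2 \<partial>M)" for n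
    using integral_square_add_le[OF L2_diff[OF L2_tendstoD(2)[OF u] L2_tendstoD(1)[OF u, of n]]
        L2_diff[OF L2_tendstoD(1)[OF u, of n] L2_tendstoD(2)[OF w]]]
    by (simp add: power2_commute)
  moreover have "(\<lambda>n. 2 * (\<integral>x. (u n x - f x)\<^sup>2 \<partial>M) + 2 * (\<integral>x. (u n x - g x)\<^sup>2 \<partial>M)) \<longlonglongrightarrow> 0"
    using tendsto_add[OF tendsto_mult_left[OF L2_tendstoD(3)[OF u], of 2]
        tendsto_mult_left[OF L2_tendstoD(3)[OF w], of 2]] by simp
  ultimately have "(\<integral>x. (f x - g x)\<^sup>2 \<partial>M) \<le> 0"
    by (intro tendsto_lowerbound[of _ _ sequentially]) auto
  then have "(\<integral>x. (f x - g x)\<^sup>2 \<partial>M) = 0"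
    by (simp add: antisym)
  then have "AE x in M. (f x - g x)\<^sup>2 = 0"
    using integral_nonneg_eq_0_iff_AE[OF L2_integrable_square[OF d]] by simp
  then show ?thesis by eventually_elim simp
qed

section \<open>Polar derivatives in the plane\<close>

text \<open>A derivative along one coordinate line, without Frechet differentiability: translation
  arguments and differentiation under the integral need nothing beyond calculus in one
  variable.\<close>

definition pd :: "'n::finite \<Rightarrow> (real^'n \<Rightarrow> real) \<Rightarrow> real^'n \<Rightarrow> real \<Rightarrow> bool" where
  "pd i f x d \<longleftrightarrow> ((\<lambda>t. f (x + t *\<^sub>R axis i 1)) has_real_derivative d) (at 0)"

lemma pd_line:
  assumes "pd i f (x + s *\<^sub>R axis i 1) d"
  shows "((\<lambda>t. f (x + t *\<^sub>R axis i 1)) has_real_derivative d) (at s)"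
proof -
  have "((\<lambda>t. f (x + (t + s) *\<^sub>R axis i 1)) has_real_derivative d) (at 0)"
    using assms by (simp add: pd_def algebra_simps)
  then show ?thesis
    using DERIV_shift[of "\<lambda>t. f (x + t *\<^sub>R axis i 1)" d 0 s] by (simp add: add.commute)
qed

lemma pd_cong_open:
  assumes "open A" "x \<in> A" "\<And>y. y \<in> A \<Longrightarrow> f y = g y" "pd i f x d"
  shows "pd i g x d"
proof -
  have "isCont (\<lambda>t::real. x + t *\<^sub>R axis i 1) 0" by (intro continuous_intros)
  then have "((\<lambda>t::real. x + t *\<^sub>R axis i 1) \<longlongrightarrow> x) (at 0)"
    by (simp add: isCont_def)
  then have "\<forall>\<^sub>F t in at 0. x + t *\<^sub>R axis i 1 \<in> A"
    using assms(1,2) by (rule topological_tendstoD)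
  then have "\<forall>\<^sub>F t in nhds 0. x + t *\<^sub>R axis i 1 \<in> A"
    using assms(2) by (simp add: eventually_nhds_conv_at)
  then have "\<forall>\<^sub>F t in nhds 0. f (x + t *\<^sub>R axis i 1) = g (x + t *\<^sub>R axis i 1)"
    by eventually_elim (use assms(3) in auto)
  then show ?thesis
    using assms(4) DERIV_cong_ev[of 0 0 "\<lambda>t. f (x + t *\<^sub>R axis i 1)" "\<lambda>t. g (x + t *\<^sub>R axis i 1)" d d]
    by (simp add: pd_def)
qed

lemma pd_add: "pd i f x d \<Longrightarrow> pd i g x e \<Longrightarrow> pd i (\<lambda>x. f x + g x) x (d + e)"
  unfolding pd_def by (rule DERIV_add)

lemma pd_mult: "pd i f x d \<Longrightarrow> pd i g x e \<Longrightarrow> pd i (\<lambda>x. f x * g x) x (d * g x + e * f x)"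
  unfolding pd_def using DERIV_mult[of "\<lambda>t. f (x + t *\<^sub>R axis i 1)" d 0 UNIV "\<lambda>t. g (x + t *\<^sub>R axis i 1)" e]
  by simp

lemma pd_component: "pd i (\<lambda>x. x $ j) x (if i = j then 1 else 0)"
  unfolding pd_def by (auto intro!: derivative_eq_intros simp: axis_def)

lemma pd_chain:
  assumes "pd i f x d" "(g has_real_derivative e) (at (f x))"
  shows "pd i (\<lambda>x. g (f x)) x (e * d)"
  using assms unfolding pd_def
  using DERIV_chain2[of g e "\<lambda>t. f (x + t *\<^sub>R axis i 1)" 0 d UNIV] by simp

lemma pd_ln_norm:
  assumes "x \<noteq> 0"
  shows "pd i (\<lambda>x. ln (norm x)) x (x $ i / (norm x)\<^sup>2)"
proof -
  \<comment> \<open>Removing the square root leaves the logarithm of a quadratic polynomial along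
    each coordinate line. The case \<open>y = 0\<close> holds because
    \<open>ln 0 = 0\<close>.\<close>
  have eq: "ln (norm y) = ln (y \<bullet> y) / 2" for y :: "real^'a"
    by (cases "y = 0") (simp_all add: norm_eq_sqrt_inner ln_sqrt)
  have e: "axis i (1::real) \<bullet> axis i 1 = 1" "x \<bullet> axis i 1 = x $ i" "axis i 1 \<bullet> x = x $ i"
    by (simp_all add: inner_axis inner_axis' inner_axis_axis)
  have sq: "(x + t *\<^sub>R axis i 1) \<bullet> (x + t *\<^sub>R axis i 1) = x \<bullet> x + 2 * t * x $ i + t\<^sup>2" for t :: real
    by (simp add: inner_add_left inner_add_right e power2_eq_square algebra_simps)
  have "((\<lambda>t. ln (x \<bullet> x + 2 * t * x $ i + t\<^sup>2) / 2) has_real_derivative x $ i / (x \<bullet> x)) (at 0)"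
    using assms by (auto intro!: derivative_eq_intros simp: inner_gt_zero_iff field_simps)
  then show ?thesis
    unfolding pd_def eq by (simp add: sq power2_norm_eq_inner)
qed

section \<open>Vanishing integrals of partial derivatives of compactly supported functions\<close>

lemma integrable_continuous_compact_support:
  fixes f :: "'a::euclidean_space \<Rightarrow> real"
  assumes "continuous_on UNIV f" "compact K" "\<And>x. x \<notin> K \<Longrightarrow> f x = 0"
  shows "integrable lborel f"
proof -
  have "integrable lborel (\<lambda>x. indicator K x *\<^sub>R f x)"
    using assms by (intro borel_integrable_compact continuous_on_subset[OF assms(1)]) auto
  moreover have "(\<lambda>x. indicator K x *\<^sub>R f x) = f"
    using assms(3) by (intro ext) (auto simp: indicator_def)
  ultimately show ?thesis by simp
qed

lemma integral_lborel_translate: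
  fixes f :: "'a::euclidean_space \<Rightarrow> real"
  assumes "f \<in> borel_measurable borel"
  shows "(\<integral>x. f (x + c) \<partial>lborel) = (\<integral>x. f x \<partial>lborel)"
    and "integrable lborel (\<lambda>x. f (x + c)) \<longleftrightarrow> integrable lborel f"
proof -
  have "(\<integral>x. f x \<partial>lborel) = (\<integral>x. f x \<partial>distr lborel borel ((+) c))"
    by (simp add: lborel_distr_plus)
  also have "\<dots> = (\<integral>x. f (x + c) \<partial>lborel)"
    using assms by (subst integral_distr) (auto simp: add.commute)
  finally show "(\<integral>x. f (x + c) \<partial>lborel) = (\<integral>x. f x \<partial>lborel)" by simp
  have "integrable lborel f \<longleftrightarrow> integrable (distr lborel borel ((+) c)) f"
    by (simp add: lborel_distr_plus)
  also have "\<dots> \<longleftrightarrow> integrable lborel (\<lambda>x. f (x + c))"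
    using assms by (subst integrable_distr_eq) (auto simp: add.commute)
  finally show "integrable lborel (\<lambda>x. f (x + c)) \<longleftrightarrow> integrable lborel f" by simp
qed

lemma pd_difference_quotient_tendsto:
  assumes "pd i f x d"
  shows "(\<lambda>n. (f (x + inverse (real (Suc n)) *\<^sub>R axis i 1) - f x) * real (Suc n)) \<longlonglongrightarrow> d"
proof -
  have "((\<lambda>h. (f (x + h *\<^sub>R axis i 1) - f x) / h) \<longlongrightarrow> d) (at 0)"
    using assms by (simp add: pd_def DERIV_def)
  moreover have "filterlim (\<lambda>n. inverse (real (Suc n))) (at 0) sequentially"
    using LIMSEQ_inverse_real_of_nat by (auto simp: filterlim_at)
  ultimately have "(\<lambda>n. (f (x + inverse (real (Suc n)) *\<^sub>R axis i 1) - f x) / inverse (real (Suc n)))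
      \<longlonglongrightarrow> d"
    by (rule filterlim_compose[of "\<lambda>h. (f (x + h *\<^sub>R axis i 1) - f x) / h"])
  then show ?thesis by (simp add: divide_inverse)
qed

lemma pd_difference_quotient_bound:
  assumes "\<And>y. pd i f y (f' y)" "\<And>y. \<bar>f' y\<bar> \<le> B" "0 < h"
  shows "\<bar>f (x + h *\<^sub>R axis i 1) - f x\<bar> \<le> B * h"
proof -
  obtain z where "f (x + h *\<^sub>R axis i 1) - f (x + 0 *\<^sub>R axis i 1) = (h - 0) * f' (x + z *\<^sub>R axis i 1)"
    using MVT2[of 0 h "\<lambda>t. f (x + t *\<^sub>R axis i 1)" "\<lambda>t. f' (x + t *\<^sub>R axis i 1)"] pd_line[OF assms(1)] assms(3)
    by metis
  then show ?thesis using assms(2)[of "x + z *\<^sub>R axis i 1"] assms(3)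
    by (simp add: abs_mult mult.commute)
qed

lemma bounded_continuous_compact_support:
  fixes f :: "'a::topological_space \<Rightarrow> real"
  assumes "continuous_on UNIV f" "compact K" "\<And>x. x \<notin> K \<Longrightarrow> f x = 0"
  obtains B where "0 \<le> B" "\<And>x. \<bar>f x\<bar> \<le> B"
proof -
  have "bounded (f ` K)"
    using assms by (intro compact_imp_bounded compact_continuous_image continuous_on_subset[OF assms(1)]) auto
  then obtain B where "\<And>x. x \<in> K \<Longrightarrow> \<bar>f x\<bar> \<le> B"
    unfolding bounded_iff by auto
  then have "\<bar>f x\<bar> \<le> max B 0" for x
    using assms(3)[of x] by (cases "x \<in> K") (auto simp: le_max_iff_disj)
  then show thesis using that[of "max B 0"] by auto
qed

text \<open>Translation invariance makes the integral of every difference quotient vanish.\<close>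

lemma integral_pd_eq_0_global:
  assumes pd: "\<And>x. pd i h x (h' x)" and ch: "continuous_on UNIV h" and ch': "continuous_on UNIV h'"
    and K: "compact K" and z: "\<And>x. x \<notin> K \<Longrightarrow> h x = 0" "\<And>x. x \<notin> K \<Longrightarrow> h' x = 0"
  shows "(\<integral>x. h' x \<partial>lborel) = 0"
proof -
  obtain B where B: "0 \<le> B" "\<And>x. \<bar>h' x\<bar> \<le> B"
    using bounded_continuous_compact_support[OF ch' K z(2)] by auto
  obtain R where "\<forall>x\<in>K. norm x \<le> R"
    using compact_imp_bounded[OF K] by (auto simp: bounded_iff)
  then have R: "K \<subseteq> cball 0 R" by auto
  have hm: "h \<in> borel_measurable borel" "h' \<in> borel_measurable borel"
    using ch ch' by (auto intro: borel_measurable_continuous_onI)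
  define q where "q n x = (h (x + inverse (real (Suc n)) *\<^sub>R axis i 1) - h x) * real (Suc n)" for n x
  have hi: "integrable lborel h"
    by (rule integrable_continuous_compact_support[OF ch K z(1)])
  have q0: "(\<integral>x. q n x \<partial>lborel) = 0" for n
    unfolding q_def
    using hi integral_lborel_translate[OF hm(1), of "inverse (real (Suc n)) *\<^sub>R axis i 1"] by simp
  \<comment> \<open>The steps have length at most 1, so every difference quotient vanishes outside
    the ball of radius \<open>R + 1\<close>; the mean value theorem bounds it by \<open>B\<close>
    there.\<close>
  have "(\<lambda>n. \<integral>x. q n x \<partial>lborel) \<longlonglongrightarrow> (\<integral>x. h' x \<partial>lborel)"
  proof (rule integral_dominated_convergence[where w="\<lambda>x. B * indicator (cball 0 (R + 1)) x"])
    show "h' \<in> borel_measurable lborel" using hm by simp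
    show "q n \<in> borel_measurable lborel" for n
      unfolding q_def using hm by measurable
    show "integrable lborel (\<lambda>x::real^'a. B * indicator (cball 0 (R + 1)) x)"
      using emeasure_bounded_finite[OF bounded_cball, of 0 "R + 1"]
      by (intro integrable_mult_right integrable_real_indicator) (auto simp: less_top)
    show "AE x in lborel. (\<lambda>n. q n x) \<longlonglongrightarrow> h' x"
      unfolding q_def by (rule AE_I2) (rule pd_difference_quotient_tendsto[OF pd])
    show "AE x in lborel. norm (q n x) \<le> B * indicator (cball 0 (R + 1)) x" for n
    proof (rule AE_I2)
      fix x :: "real^'a"
      have le1: "inverse (real (Suc n)) \<le> 1" by (simp add: inverse_le_1_iff)
      show "norm (q n x) \<le> B * indicator (cball 0 (R + 1)) x"
      proof (cases "x \<in> cball 0 (R + 1)")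
        case True
        have "\<bar>q n x\<bar> = \<bar>h (x + inverse (real (Suc n)) *\<^sub>R axis i 1) - h x\<bar> * real (Suc n)"
          by (simp add: q_def abs_mult)
        also have "\<dots> \<le> (B * inverse (real (Suc n))) * real (Suc n)"
          by (intro mult_right_mono pd_difference_quotient_bound[OF pd B(2)]) auto
        also have "\<dots> = B" by (simp del: of_nat_Suc)
        finally show ?thesis using True by simp
      next
        case False
        then have "R + 1 < norm x" by simp
        moreover have "norm x \<le> norm (x + inverse (real (Suc n)) *\<^sub>R axis i 1) + inverse (real (Suc n))"
          using norm_triangle_ineq4[of "x + inverse (real (Suc n)) *\<^sub>R axis i 1" "inverse (real (Suc n)) *\<^sub>R axis i 1"]
          by simp
        ultimately have "x \<notin> K" "x + inverse (real (Suc n)) *\<^sub>R axis i 1 \<notin> K"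
          using R le1 by (auto simp: subset_iff)
        then show ?thesis using z(1) False by (simp add: q_def)
      qed
    qed
  qed
  then have "(\<lambda>n::nat. 0) \<longlonglongrightarrow> (\<integral>x. h' x \<partial>lborel)" using q0 by simp
  then show ?thesis using LIMSEQ_unique tendsto_const by blast
qed

text \<open>Extension by zero: the open sets \<open>A\<close> and \<open>- K\<close> cover the
  space, and the functions are regular on the first and vanish on the second.\<close>

lemma integral_pd_eq_0:
  assumes A: "open A" and pd: "\<And>x. x \<in> A \<Longrightarrow> pd i h x (h' x)"
    and ch: "continuous_on A h" and ch': "continuous_on A h'"
    and K: "compact K" "K \<subseteq> A" and z: "\<And>x. x \<notin> K \<Longrightarrow> h x = 0" "\<And>x. x \<notin> K \<Longrightarrow> h' x = 0"
  shows "(\<integral>x. h' x \<partial>lborel) = 0"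
proof (rule integral_pd_eq_0_global[where h=h and K=K])
  have oK: "open (- K)" using K(1) by (simp add: compact_imp_closed open_Compl)
  have U: "A \<union> - K = UNIV" using K(2) by auto
  have c0: "continuous_on (- K) f" if "\<And>x. x \<notin> K \<Longrightarrow> f x = 0" for f :: "real^'a \<Rightarrow> real"
    using that by (subst continuous_on_cong[of _ "- K" f "\<lambda>_. 0"]) auto
  show "continuous_on UNIV h" "continuous_on UNIV h'"
    using continuous_on_open_Un[OF A oK ch c0[OF z(1)]] continuous_on_open_Un[OF A oK ch' c0[OF z(2)]] U
    by auto
  show "pd i h x (h' x)" for x
  proof (cases "x \<in> A")
    case False
    then have x: "x \<in> - K" using K by auto
    have "pd i (\<lambda>_. 0) x 0" by (simp add: pd_def)
    then have "pd i h x 0" by (rule pd_cong_open[OF oK x, rotated]) (use z in auto)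
    then show ?thesis using z(2)[of x] x by simp
  qed (rule pd)
qed (use K z in auto)

section \<open>Calculus of the derivatives in the logarithm of the radius and in the polar
  angle\<close>

definition C1_on :: "(real^2) set \<Rightarrow> (real^2 \<Rightarrow> real) \<Rightarrow> (real^2 \<Rightarrow> real) \<Rightarrow> (real^2 \<Rightarrow> real) \<Rightarrow> bool" where
  "C1_on A u u\<^sub>1 u\<^sub>2 \<longleftrightarrow> continuous_on A u \<and> continuous_on A u\<^sub>1 \<and> continuous_on A u\<^sub>2 \<and>
     (\<forall>x\<in>A. pd 1 u x (u\<^sub>1 x) \<and> pd 2 u x (u\<^sub>2 x))"

text \<open>The functions \<open>s\<close> and \<open>t\<close> are the derivatives of \<open>u\<close> with respect to \<open>ln r\<close> and to the
  polar angle.\<close>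

definition polar_C1 :: "(real^2) set \<Rightarrow> (real^2 \<Rightarrow> real) \<Rightarrow> (real^2 \<Rightarrow> real) \<Rightarrow> (real^2 \<Rightarrow> real) \<Rightarrow> bool" where
  "polar_C1 A u s t \<longleftrightarrow> (\<exists>u\<^sub>1 u\<^sub>2. C1_on A u u\<^sub>1 u\<^sub>2 \<and>
     (\<forall>x\<in>A. s x = x$1 * u\<^sub>1 x + x$2 * u\<^sub>2 x \<and> t x = x$1 * u\<^sub>2 x - x$2 * u\<^sub>1 x))"

lemma continuous_on_component' [continuous_intros]:
  "continuous_on A (\<lambda>x::real^'n::finite. x $ i)"
  by (intro continuous_intros)

lemma polar_C1_continuous:
  assumes "polar_C1 A u s t"
  shows "continuous_on A u" "continuous_on A s" "continuous_on A t"
proof -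
  obtain u1 u2 where u: "C1_on A u u1 u2"
    "\<And>x. x \<in> A \<Longrightarrow> s x = x$1 * u1 x + x$2 * u2 x" "\<And>x. x \<in> A \<Longrightarrow> t x = x$1 * u2 x - x$2 * u1 x"
    using assms by (auto simp: polar_C1_def)
  show "continuous_on A u" using u(1) by (simp add: C1_on_def)
  have "continuous_on A (\<lambda>x. x$1 * u1 x + x$2 * u2 x)" "continuous_on A (\<lambda>x. x$1 * u2 x - x$2 * u1 x)"
    using u(1) by (auto simp: C1_on_def intro!: continuous_intros)
  then show "continuous_on A s" "continuous_on A t"
    using u(2,3) by (simp_all cong: continuous_on_cong)
qed

lemma polar_C1_cong:
  assumes "open A" "polar_C1 A u s t" "\<And>x. x \<in> A \<Longrightarrow> u x = u' x" "\<And>x. x \<in> A \<Longrightarrow> s x = s' x"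
    "\<And>x. x \<in> A \<Longrightarrow> t x = t' x"
  shows "polar_C1 A u' s' t'"
proof -
  obtain u1 u2 where u: "C1_on A u u1 u2"
    "\<And>x. x \<in> A \<Longrightarrow> s x = x$1 * u1 x + x$2 * u2 x \<and> t x = x$1 * u2 x - x$2 * u1 x"
    using assms(2) by (auto simp: polar_C1_def)
  have "C1_on A u' u1 u2"
    unfolding C1_on_def
  proof (intro conjI ballI)
    show "continuous_on A u'" "continuous_on A u1" "continuous_on A u2"
      using u(1) assms(3) by (auto simp: C1_on_def cong: continuous_on_cong)
    show "pd 1 u' x (u1 x)" "pd 2 u' x (u2 x)" if "x \<in> A" for x
      using u(1) that by (auto simp: C1_on_def intro: pd_cong_open[OF assms(1) that assms(3)])
  qed
  then show ?thesis unfolding polar_C1_def using u(2) assms(4,5) by metis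
qed

lemma polar_C1_add:
  assumes "polar_C1 A u s t" "polar_C1 A w s' t'"
  shows "polar_C1 A (\<lambda>x. u x + w x) (\<lambda>x. s x + s' x) (\<lambda>x. t x + t' x)"
proof -
  obtain u1 u2 where u: "C1_on A u u1 u2"
    "\<forall>x\<in>A. s x = x$1 * u1 x + x$2 * u2 x \<and> t x = x$1 * u2 x - x$2 * u1 x"
    using assms(1) by (auto simp: polar_C1_def)
  obtain w1 w2 where w: "C1_on A w w1 w2"
    "\<forall>x\<in>A. s' x = x$1 * w1 x + x$2 * w2 x \<and> t' x = x$1 * w2 x - x$2 * w1 x"
    using assms(2) by (auto simp: polar_C1_def)
  have "C1_on A (\<lambda>x. u x + w x) (\<lambda>x. u1 x + w1 x) (\<lambda>x. u2 x + w2 x)"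
    using u(1) w(1) unfolding C1_on_def by (auto intro!: continuous_intros pd_add)
  then show ?thesis unfolding polar_C1_def
    by (rule_tac x="\<lambda>x. u1 x + w1 x" in exI, rule_tac x="\<lambda>x. u2 x + w2 x" in exI)
      (auto simp: u(2) w(2) algebra_simps)
qed

lemma polar_C1_mult:
  assumes "polar_C1 A u s t" "polar_C1 A w s' t'"
  shows "polar_C1 A (\<lambda>x. u x * w x) (\<lambda>x. s x * w x + u x * s' x) (\<lambda>x. t x * w x + u x * t' x)"
proof -
  obtain u1 u2 where u: "C1_on A u u1 u2"
    "\<forall>x\<in>A. s x = x$1 * u1 x + x$2 * u2 x \<and> t x = x$1 * u2 x - x$2 * u1 x"
    using assms(1) by (auto simp: polar_C1_def)
  obtain w1 w2 where w: "C1_on A w w1 w2"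
    "\<forall>x\<in>A. s' x = x$1 * w1 x + x$2 * w2 x \<and> t' x = x$1 * w2 x - x$2 * w1 x"
    using assms(2) by (auto simp: polar_C1_def)
  have "C1_on A (\<lambda>x. u x * w x) (\<lambda>x. u1 x * w x + w1 x * u x) (\<lambda>x. u2 x * w x + w2 x * u x)"
    using u(1) w(1) unfolding C1_on_def by (auto intro!: continuous_intros pd_mult)
  then show ?thesis unfolding polar_C1_def
    by (rule_tac x="\<lambda>x. u1 x * w x + w1 x * u x" in exI, rule_tac x="\<lambda>x. u2 x * w x + w2 x * u x" in exI)
      (auto simp: u(2) w(2) algebra_simps)
qed

lemma polar_C1_chain:
  assumes "polar_C1 A u s t" "\<And>y. (f has_real_derivative f' y) (at y)" "continuous_on UNIV f'"
  shows "polar_C1 A (\<lambda>x. f (u x)) (\<lambda>x. f' (u x) * s x) (\<lambda>x. f' (u x) * t x)"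
proof -
  obtain u1 u2 where u: "C1_on A u u1 u2"
    "\<forall>x\<in>A. s x = x$1 * u1 x + x$2 * u2 x \<and> t x = x$1 * u2 x - x$2 * u1 x"
    using assms(1) by (auto simp: polar_C1_def)
  have cf: "continuous_on UNIV f"
    using assms(2) by (meson DERIV_isCont continuous_at_imp_continuous_on)
  have "continuous_on A u" using u(1) by (simp add: C1_on_def)
  then have "continuous_on A (\<lambda>x. f (u x))" "continuous_on A (\<lambda>x. f' (u x))"
    using continuous_on_compose2[OF cf] continuous_on_compose2[OF assms(3)] by auto
  then have "C1_on A (\<lambda>x. f (u x)) (\<lambda>x. f' (u x) * u1 x) (\<lambda>x. f' (u x) * u2 x)"
    using u(1) unfolding C1_on_def by (auto intro!: continuous_intros pd_chain[where g=f, OF _ assms(2)])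
  then show ?thesis unfolding polar_C1_def
    by (rule_tac x="\<lambda>x. f' (u x) * u1 x" in exI, rule_tac x="\<lambda>x. f' (u x) * u2 x" in exI)
      (auto simp: u(2) algebra_simps)
qed

lemma polar_C1_components:
  "polar_C1 A (\<lambda>x. x$1) (\<lambda>x. x$1) (\<lambda>x. - x$2)" "polar_C1 A (\<lambda>x. x$2) (\<lambda>x. x$2) (\<lambda>x. x$1)"
proof -
  have "C1_on A (\<lambda>x. x$1) (\<lambda>_. 1) (\<lambda>_. 0)" "C1_on A (\<lambda>x. x$2) (\<lambda>_. 0) (\<lambda>_. 1)"
    unfolding C1_on_def using pd_component[of "1::2" 1] pd_component[of "1::2" 2] pd_component[of "2::2" 1] pd_component[of "2::2" 2]
    by (auto intro!: continuous_intros)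
  then show "polar_C1 A (\<lambda>x. x$1) (\<lambda>x. x$1) (\<lambda>x. - x$2)" "polar_C1 A (\<lambda>x. x$2) (\<lambda>x. x$2) (\<lambda>x. x$1)"
    unfolding polar_C1_def by fastforce+
qed

lemma norm2_power2: "(norm (x::real^2))\<^sup>2 = (x$1)\<^sup>2 + (x$2)\<^sup>2"
  unfolding power2_norm_eq_inner inner_vec_def sum_2 by (simp add: power2_eq_square)

lemma polar_C1_ln_norm:
  assumes "0 \<notin> A"
  shows "polar_C1 A (\<lambda>x. ln (norm x)) (\<lambda>_. 1) (\<lambda>_. 0)"
proof -
  have nz: "x \<noteq> 0" "norm x \<noteq> 0" if "x \<in> A" for x using assms that by auto
  have C: "C1_on A (\<lambda>x. ln (norm x)) (\<lambda>x. x$1 / (norm x)\<^sup>2) (\<lambda>x. x$2 / (norm x)\<^sup>2)"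
    unfolding C1_on_def using nz by (auto intro!: continuous_intros pd_ln_norm)
  show ?thesis unfolding polar_C1_def
  proof (intro exI conjI ballI)
    show "C1_on A (\<lambda>x. ln (norm x)) (\<lambda>x. x$1 / (norm x)\<^sup>2) (\<lambda>x. x$2 / (norm x)\<^sup>2)" by (rule C)
    fix x assume "x \<in> A"
    then have "(x$1)\<^sup>2 + (x$2)\<^sup>2 \<noteq> 0" using nz[of x] norm2_power2[of x] by auto
    then show "1 = x$1 * (x$1 / (norm x)\<^sup>2) + x$2 * (x$2 / (norm x)\<^sup>2)"
      unfolding norm2_power2 by (simp add: power2_eq_square add_divide_distrib[symmetric])
    show "0 = x$1 * (x$2 / (norm x)\<^sup>2) - x$2 * (x$1 / (norm x)\<^sup>2)" by simp
  qed
qed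

lemma polar_C1_radial:
  assumes "0 \<notin> A" "\<And>y. (f has_real_derivative f' y) (at y)" "continuous_on UNIV f'"
  shows "polar_C1 A (\<lambda>x. f (ln (norm x))) (\<lambda>x. f' (ln (norm x))) (\<lambda>_. 0)"
  using polar_C1_chain[OF polar_C1_ln_norm[OF assms(1)] assms(2,3)] by simp

text \<open>Inverts the linear system that expresses \<open>s\<close> and \<open>t\<close> through
  the Cartesian partial derivatives; its determinant is \<open>|x|\<^sup>2\<close>.\<close>

lemma pd_mult_components:
  assumes A: "0 \<notin> A" and q: "polar_C1 A q s t" and x: "x \<in> A"
  shows "pd 1 q x ((x$1 * s x - x$2 * t x) / (norm x)\<^sup>2)" "pd 2 q x ((x$2 * s x + x$1 * t x) / (norm x)\<^sup>2)"
proof -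
  obtain u1 u2 where u: "C1_on A q u1 u2"
    "\<forall>x\<in>A. s x = x$1 * u1 x + x$2 * u2 x \<and> t x = x$1 * u2 x - x$2 * u1 x"
    using q by (auto simp: polar_C1_def)
  have nz: "(x$1)\<^sup>2 + (x$2)\<^sup>2 \<noteq> 0" using A x norm2_power2[of x] by auto
  have "(x$1 * s x - x$2 * t x) / (norm x)\<^sup>2 = u1 x" "(x$2 * s x + x$1 * t x) / (norm x)\<^sup>2 = u2 x"
    using nz u(2) x unfolding norm2_power2
    by (simp_all add: divide_eq_eq) (simp_all add: power2_eq_square algebra_simps)
  then show "pd 1 q x ((x$1 * s x - x$2 * t x) / (norm x)\<^sup>2)" "pd 2 q x ((x$2 * s x + x$1 * t x) / (norm x)\<^sup>2)"
    using u(1) x by (simp_all add: C1_on_def)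
qed

text \<open>The vector fields \<open>x / |x|\<^sup>2\<close> and its rotation by a right angle are divergence free in the plane.\<close>

lemma integral_polar_eq_0:
  assumes A: "open A" "0 \<notin> A" and q: "polar_C1 A q s t" and K: "compact K" "K \<subseteq> A"
    and z: "\<And>x. x \<notin> K \<Longrightarrow> q x = 0" "\<And>x. x \<notin> K \<Longrightarrow> s x = 0" "\<And>x. x \<notin> K \<Longrightarrow> t x = 0"
  shows "(\<integral>x. s x / (norm x)\<^sup>2 \<partial>lborel) = 0" "(\<integral>x. t x / (norm x)\<^sup>2 \<partial>lborel) = 0"
proof -
  \<comment> \<open>This is \<open>1 / |x|\<^sup>2\<close> off the origin, written as a function of
    \<open>ln |x|\<close> so that the radial rule yields its derivatives \<open>-2 m\<close> and
    0.\<close>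
  define m where "m x = exp (-2 * ln (norm x))" for x :: "real^2"
  have m: "m x = 1 / (norm x)\<^sup>2" if "x \<noteq> 0" for x
    using that by (simp add: m_def exp_minus exp_double[of "ln (norm x)"] divide_inverse power2_eq_square exp_add[symmetric])
  have "polar_C1 A m (\<lambda>x. -2 * m x) (\<lambda>_. 0)"
    unfolding m_def using A(2)
    by (intro polar_C1_radial[where f="\<lambda>y. exp (-2 * y)" and f'="\<lambda>y. -2 * exp (-2 * y)"])
      (auto intro!: derivative_eq_intros continuous_intros)
  from polar_C1_mult[OF this q]
  have mq: "polar_C1 A (\<lambda>x. m x * q x) (\<lambda>x. m x * s x - 2 * m x * q x) (\<lambda>x. m x * t x)"
    by (rule polar_C1_cong[OF A(1)]) auto
  note h1 = polar_C1_mult[OF polar_C1_components(1) mq] and h2 = polar_C1_mult[OF polar_C1_components(2) mq]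
  define s1 t1 s2 t2 where
    "s1 x = x$1 * (m x * q x) + x$1 * (m x * s x - 2 * m x * q x)" and
    "t1 x = - x$2 * (m x * q x) + x$1 * (m x * t x)" and
    "s2 x = x$2 * (m x * q x) + x$2 * (m x * s x - 2 * m x * q x)" and
    "t2 x = x$1 * (m x * q x) + x$2 * (m x * t x)" for x
  have P1: "polar_C1 A (\<lambda>x. x$1 * (m x * q x)) s1 t1" and P2: "polar_C1 A (\<lambda>x. x$2 * (m x * q x)) s2 t2"
    using h1 h2 by (simp_all add: s1_def[abs_def] t1_def[abs_def] s2_def[abs_def] t2_def[abs_def])
  define d11 d12 d21 d22 where
    "d11 x = (x$1 * s1 x - x$2 * t1 x) / (norm x)\<^sup>2" and "d12 x = (x$2 * s1 x + x$1 * t1 x) / (norm x)\<^sup>2" and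
    "d21 x = (x$1 * s2 x - x$2 * t2 x) / (norm x)\<^sup>2" and "d22 x = (x$2 * s2 x + x$1 * t2 x) / (norm x)\<^sup>2" for x
  note c = polar_C1_continuous[OF P1] polar_C1_continuous[OF P2]
  have nz: "norm x \<noteq> 0" if "x \<in> A" for x using A(2) that by auto
  have cd: "continuous_on A d11" "continuous_on A d12" "continuous_on A d21" "continuous_on A d22"
    unfolding d11_def[abs_def] d12_def[abs_def] d21_def[abs_def] d22_def[abs_def]
    using c nz by (auto intro!: continuous_intros)
  have zd: "x$1 * (m x * q x) = 0" "x$2 * (m x * q x) = 0" "d11 x = 0" "d12 x = 0" "d21 x = 0" "d22 x = 0"
    if "x \<notin> K" for x
    using z[OF that] by (simp_all add: d11_def d12_def d21_def d22_def s1_def s2_def t1_def t2_def)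
  have I: "(\<integral>x. d11 x \<partial>lborel) = 0" "(\<integral>x. d12 x \<partial>lborel) = 0" "(\<integral>x. d21 x \<partial>lborel) = 0" "(\<integral>x. d22 x \<partial>lborel) = 0"
    using integral_pd_eq_0[OF A(1) _ c(1) cd(1) K zd(1,3)] integral_pd_eq_0[OF A(1) _ c(1) cd(2) K zd(1,4)]
      integral_pd_eq_0[OF A(1) _ c(4) cd(3) K zd(2,5)] integral_pd_eq_0[OF A(1) _ c(4) cd(4) K zd(2,6)]
      pd_mult_components[OF A(2) P1] pd_mult_components[OF A(2) P2]
    by (auto simp: d11_def[symmetric] d12_def[symmetric] d21_def[symmetric] d22_def[symmetric])
  have int: "integrable lborel d" if "continuous_on A d" "\<And>x. x \<notin> K \<Longrightarrow> d x = 0" for d :: "real^2 \<Rightarrow> real"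
  proof -
    have "integrable lborel (\<lambda>x. indicator K x *\<^sub>R d x)"
      using K that by (intro borel_integrable_compact continuous_on_subset[OF that(1)]) auto
    moreover have "(\<lambda>x. indicator K x *\<^sub>R d x) = d" using that(2) by (intro ext) (auto simp: indicator_def)
    ultimately show ?thesis by simp
  qed
  \<comment> \<open>The first sum is the divergence of \<open>q x / |x|\<^sup>2\<close>, the second
    that of \<open>q (x\<^sub>2, -x\<^sub>1) / |x|\<^sup>2\<close>. As both fields are divergence
    free for constant \<open>q\<close>, only derivatives of \<open>q\<close> remain.\<close>
  have e: "d11 x + d22 x = s x / (norm x)\<^sup>2 \<and> d12 x * - 1 + d21 x * 1 = - t x / (norm x)\<^sup>2" for x
  proof (cases "x \<in> K")
    case True
    then have x: "x \<noteq> 0" using K A(2) by auto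
    define n where "n = (x$1)\<^sup>2 + (x$2)\<^sup>2"
    have n: "n \<noteq> 0" using x norm2_power2[of x] by (auto simp: n_def)
    have nn: "(norm x)\<^sup>2 = n" by (simp add: n_def norm2_power2)
    have mm: "m x = 1 / n" using m[OF x] nn by simp
    have "x$1 * s1 x - x$2 * t1 x + (x$2 * s2 x + x$1 * t2 x) = m x * s x * n"
      by (simp add: s1_def s2_def t1_def t2_def n_def power2_eq_square algebra_simps)
    moreover have "(x$1 * s2 x - x$2 * t2 x) - (x$2 * s1 x + x$1 * t1 x) = - (m x * t x * n)"
      by (simp add: s1_def s2_def t1_def t2_def n_def power2_eq_square algebra_simps)
    ultimately show ?thesis
      using n unfolding d11_def d12_def d21_def d22_def nn mm
      by (simp add: add_divide_distrib[symmetric] diff_divide_distrib[symmetric])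
  next
    case False
    then show ?thesis using zd[OF False] z[OF False] by simp
  qed
  have "(\<integral>x. s x / (norm x)\<^sup>2 \<partial>lborel) = (\<integral>x. d11 x + d22 x \<partial>lborel)"
    using e by simp
  also have "\<dots> = 0" using I int[OF cd(1) zd(3)] int[OF cd(4) zd(6)] by simp
  finally show "(\<integral>x. s x / (norm x)\<^sup>2 \<partial>lborel) = 0" .
  have "(\<integral>x. - t x / (norm x)\<^sup>2 \<partial>lborel) = (\<integral>x. d12 x * - 1 + d21 x * 1 \<partial>lborel)"
    using e by simp
  also have "\<dots> = 0" using I int[OF cd(2) zd(4)] int[OF cd(3) zd(5)] by simp
  finally show "(\<integral>x. t x / (norm x)\<^sup>2 \<partial>lborel) = 0" by simp
qed

section \<open>Square-integrable functions with polar derivatives on an annulus\<close>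

text \<open>Defined by strong approximation instead of weak derivatives: an identity for
  \<open>polar_C1\<close> functions that is continuous in L2 then extends at once. \<open>S\<close>
  and \<open>T\<close> are part of the data, as in a graph closure.\<close>

definition polar_H1 :: "(real^2) set \<Rightarrow> (real^2 \<Rightarrow> real) \<Rightarrow> (real^2 \<Rightarrow> real) \<Rightarrow> (real^2 \<Rightarrow> real) \<Rightarrow> bool" where
  "polar_H1 A U S T \<longleftrightarrow> (\<exists>u s t. (\<forall>n. polar_C1 A (u n) (s n) (t n)) \<and>
     L2_tendsto (restrict_space lborel A) u U \<and> L2_tendsto (restrict_space lborel A) s S \<and>
     L2_tendsto (restrict_space lborel A) t T)"

lemma polar_H1I:
  assumes "\<And>n. polar_C1 A (u n) (s n) (t n)" "L2_tendsto (restrict_space lborel A) u U"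
    "L2_tendsto (restrict_space lborel A) s S" "L2_tendsto (restrict_space lborel A) t T"
  shows "polar_H1 A U S T"
  using assms unfolding polar_H1_def by blast

lemma continuous_on_imp_measurable_restrict:
  fixes f :: "'a::euclidean_space \<Rightarrow> real"
  assumes "continuous_on A f"
  shows "f \<in> borel_measurable (restrict_space lborel A)"
proof -
  have "f \<in> borel_measurable (restrict_space borel A)"
    using assms by (rule borel_measurable_continuous_on_restrict)
  moreover have "sets (restrict_space lborel A) = sets (restrict_space borel A)"
    by (intro sets_restrict_space_cong) simp
  ultimately show ?thesis using measurable_cong_sets by blast
qed

lemma polar_H1_L2:
  assumes "polar_H1 A U S T"
  shows "L2 (restrict_space lborel A) U" "L2 (restrict_space lborel A) S" "L2 (restrict_space lborel A) T"
  using assms by (auto simp: polar_H1_def L2_tendsto_def)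

lemma polar_H1_add:
  assumes "polar_H1 A U S T" "polar_H1 A U' S' T'"
  shows "polar_H1 A (\<lambda>x. U x + U' x) (\<lambda>x. S x + S' x) (\<lambda>x. T x + T' x)"
proof -
  let ?M = "restrict_space lborel A"
  obtain u s t where 1: "\<And>n. polar_C1 A (u n) (s n) (t n)"
    "L2_tendsto ?M u U" "L2_tendsto ?M s S" "L2_tendsto ?M t T"
    using assms(1) by (auto simp: polar_H1_def)
  obtain u' s' t' where 2: "\<And>n. polar_C1 A (u' n) (s' n) (t' n)"
    "L2_tendsto ?M u' U'" "L2_tendsto ?M s' S'" "L2_tendsto ?M t' T'"
    using assms(2) by (auto simp: polar_H1_def)
  show ?thesis
    by (rule polar_H1I[OF polar_C1_add[OF 1(1) 2(1)] L2_tendsto_add[OF 1(2) 2(2)]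
      L2_tendsto_add[OF 1(3) 2(3)] L2_tendsto_add[OF 1(4) 2(4)]])
qed

lemma polar_H1_mult:
  assumes g: "polar_C1 A g g\<^sub>s g\<^sub>t" and U: "polar_H1 A U S T"
    and B: "\<And>x. x \<in> A \<Longrightarrow> \<bar>g x\<bar> \<le> B" "\<And>x. x \<in> A \<Longrightarrow> \<bar>g\<^sub>s x\<bar> \<le> B" "\<And>x. x \<in> A \<Longrightarrow> \<bar>g\<^sub>t x\<bar> \<le> B"
  shows "polar_H1 A (\<lambda>x. g x * U x) (\<lambda>x. g\<^sub>s x * U x + g x * S x) (\<lambda>x. g\<^sub>t x * U x + g x * T x)"
proof -
  let ?M = "restrict_space lborel A"
  obtain u s t where 1: "\<And>n. polar_C1 A (u n) (s n) (t n)"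
    "L2_tendsto ?M u U" "L2_tendsto ?M s S" "L2_tendsto ?M t T"
    using U by (auto simp: polar_H1_def)
  note m = polar_C1_continuous[OF g, THEN continuous_on_imp_measurable_restrict]
  have sp: "x \<in> space ?M \<Longrightarrow> x \<in> A" for x by (simp add: space_restrict_space)
  have l: "L2_tendsto ?M (\<lambda>n x. h x * w n x) (\<lambda>x. h x * W x)"
    if "L2_tendsto ?M w W" "h \<in> borel_measurable ?M" "\<And>x. x \<in> A \<Longrightarrow> \<bar>h x\<bar> \<le> B" for h w W
    by (rule L2_tendsto_bounded_mult[OF that(1,2), of B], rule that(3), rule sp)
  show ?thesis
    by (rule polar_H1I[OF polar_C1_mult[OF g 1(1)] l[OF 1(2) m(1) B(1)]
      L2_tendsto_add[OF l[OF 1(2) m(2) B(2)] l[OF 1(3) m(1) B(1)]]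
      L2_tendsto_add[OF l[OF 1(2) m(3) B(3)] l[OF 1(4) m(1) B(1)]]])
qed

lemma L2_tendsto_cong_AE:
  assumes "L2_tendsto M u f" "AE x in M. f x = g x" "g \<in> borel_measurable M"
  shows "L2_tendsto M u g"
proof -
  note f = L2_tendstoD(2)[OF assms(1)]
  have "integrable M (\<lambda>x. (g x)\<^sup>2)"
    using assms f by (subst integrable_cong_AE[where g="\<lambda>x. (f x)\<^sup>2"]) (auto simp: L2_def)
  moreover have "(\<integral>x. (u n x - g x)\<^sup>2 \<partial>M) = (\<integral>x. (u n x - f x)\<^sup>2 \<partial>M)" for n
    using L2_tendstoD(1)[OF assms(1), of n] f assms(2,3)
    by (intro integral_cong_AE borel_measurable_power borel_measurable_diff) (auto simp: L2_def)
  ultimately show ?thesis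
    using assms by (simp add: L2_tendsto_def L2_def)
qed

lemma polar_H1_cong_AE:
  assumes "polar_H1 A U S T"
    and "AE x in restrict_space lborel A. U x = U' x" "U' \<in> borel_measurable (restrict_space lborel A)"
    and "AE x in restrict_space lborel A. S x = S' x" "S' \<in> borel_measurable (restrict_space lborel A)"
    and "AE x in restrict_space lborel A. T x = T' x" "T' \<in> borel_measurable (restrict_space lborel A)"
  shows "polar_H1 A U' S' T'"
proof -
  let ?M = "restrict_space lborel A"
  obtain u s t where 1: "\<And>n. polar_C1 A (u n) (s n) (t n)"
    "L2_tendsto ?M u U" "L2_tendsto ?M s S" "L2_tendsto ?M t T"
    using assms(1) by (auto simp: polar_H1_def)
  show ?thesis
    by (rule polar_H1I[OF 1(1) L2_tendsto_cong_AE[OF 1(2) assms(2,3)]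
      L2_tendsto_cong_AE[OF 1(3) assms(4,5)] L2_tendsto_cong_AE[OF 1(4) assms(6,7)]])
qed

text \<open>The bound \<open>b \<le> 1\<close> keeps the origin outside the support of the cutoffs in \<open>ln |x|\<close>, because \<open>ln 0 = 0\<close>.\<close>

locale annulus =
  fixes a b :: real
  assumes a_pos: "0 < a" and a_less_b: "a < b" and b_le_1: "b \<le> 1"
begin

definition An :: "(real^2) set" where
  "An = {x. a < norm x \<and> norm x < b}"

definition MA :: "(real^2) measure" where
  "MA = restrict_space lborel An"

text \<open>The support bounds lie strictly inside the interval \<open>(ln a, ln b)\<close>, so a
  cutoff in \<open>ln |x|\<close> vanishes near both boundary circles and no boundary terms occur.
  Differentiability is stated separately where it is needed, with the derivative again a
  cutoff.\<close>

definition cutoff :: "(real \<Rightarrow> real) \<Rightarrow> bool" where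
  "cutoff \<psi> \<longleftrightarrow> continuous_on UNIV \<psi> \<and>
     (\<exists>\<alpha> \<beta>. ln a < \<alpha> \<and> \<beta> < ln b \<and> (\<forall>s. s < \<alpha> \<or> \<beta> < s \<longrightarrow> \<psi> s = 0))"

text \<open>Since \<open>dx / |x|\<^sup>2 = ds d\<theta>\<close>, this is the integral of \<open>\<psi>(s) F\<close> in logarithmic polar coordinates.\<close>

definition PI :: "(real \<Rightarrow> real) \<Rightarrow> (real^2 \<Rightarrow> real) \<Rightarrow> real" where
  "PI \<psi> F = (\<integral>x. \<psi> (ln (norm x)) / (norm x)\<^sup>2 * F x \<partial>MA)"

lemma open_An: "open An"
  unfolding An_def by (intro open_Collect_conj open_Collect_less continuous_intros)

lemma An_nz: "x \<in> An \<Longrightarrow> x \<noteq> 0" "0 \<notin> An"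
  using a_pos by (auto simp: An_def)

lemma space_MA: "space MA = An"
  by (simp add: MA_def space_restrict_space)

lemma measurable_MA: "continuous_on An f \<Longrightarrow> f \<in> borel_measurable MA" for f :: "real^2 \<Rightarrow> real"
  unfolding MA_def by (rule continuous_on_imp_measurable_restrict)

lemma finite_MA: "emeasure MA (space MA) < \<infinity>"
proof -
  have "emeasure MA (space MA) = emeasure lborel An"
    unfolding MA_def using open_An by (simp add: emeasure_restrict_space space_restrict_space)
  moreover have "bounded An"
    by (rule bounded_subset[OF bounded_ball, of _ 0 b]) (auto simp: An_def)
  ultimately show ?thesis using emeasure_bounded_finite[of An] by simp
qed

lemma cutoff_weight:
  assumes "cutoff \<psi>"
  shows "continuous_on An (\<lambda>x. \<psi> (ln (norm x)) / (norm x)\<^sup>2)"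
    and "\<exists>B. \<forall>x\<in>An. \<bar>\<psi> (ln (norm x)) / (norm x)\<^sup>2\<bar> \<le> B"
proof -
  have c: "continuous_on UNIV \<psi>" using assms by (simp add: cutoff_def)
  have "continuous_on An (\<lambda>x. ln (norm x))"
    using An_nz by (auto intro!: continuous_intros)
  then have "continuous_on An (\<lambda>x. \<psi> (ln (norm x)))"
    using continuous_on_compose2[OF c] by auto
  then show "continuous_on An (\<lambda>x. \<psi> (ln (norm x)) / (norm x)\<^sup>2)"
    using An_nz by (auto intro!: continuous_intros)
  obtain \<alpha> \<beta> where "\<And>s. s < \<alpha> \<or> \<beta> < s \<Longrightarrow> \<psi> s = 0"
    using assms by (auto simp: cutoff_def)
  then obtain B where B: "0 \<le> B" "\<And>s. \<bar>\<psi> s\<bar> \<le> B"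
    using bounded_continuous_compact_support[OF c, of "{\<alpha>..\<beta>}"] by (auto simp: not_le)
  have "\<bar>\<psi> (ln (norm x)) / (norm x)\<^sup>2\<bar> \<le> B / a\<^sup>2" if "x \<in> An" for x
  proof -
    have "a\<^sup>2 \<le> (norm x)\<^sup>2" using that a_pos by (intro power_mono) (auto simp: An_def)
    then show ?thesis
      unfolding abs_divide using B a_pos by (intro frac_le) auto
  qed
  then show "\<exists>B. \<forall>x\<in>An. \<bar>\<psi> (ln (norm x)) / (norm x)\<^sup>2\<bar> \<le> B" by blast
qed

lemma cutoff_integrable:
  assumes "cutoff \<psi>" "integrable MA F"
  shows "integrable MA (\<lambda>x. \<psi> (ln (norm x)) / (norm x)\<^sup>2 * F x)"
proof -
  obtain B where B: "\<And>x. x \<in> An \<Longrightarrow> \<bar>\<psi> (ln (norm x)) / (norm x)\<^sup>2\<bar> \<le> B"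
    using cutoff_weight(2)[OF assms(1)] by auto
  show ?thesis
  proof (rule Bochner_Integration.integrable_bound)
    show "integrable MA (\<lambda>x. B * \<bar>F x\<bar>)" using assms by simp
    show "(\<lambda>x. \<psi> (ln (norm x)) / (norm x)\<^sup>2 * F x) \<in> borel_measurable MA"
      using measurable_MA[OF cutoff_weight(1)[OF assms(1)]] borel_measurable_integrable[OF assms(2)]
      by (rule borel_measurable_times)
    show "AE x in MA. norm (\<psi> (ln (norm x)) / (norm x)\<^sup>2 * F x) \<le> norm (B * \<bar>F x\<bar>)"
    proof (rule AE_I2)
      fix x assume "x \<in> space MA"
      then have "\<bar>\<psi> (ln (norm x)) / (norm x)\<^sup>2\<bar> \<le> B" using B by (simp add: space_MA)
      then have "\<bar>\<psi> (ln (norm x)) / (norm x)\<^sup>2\<bar> * \<bar>F x\<bar> \<le> \<bar>B\<bar> * \<bar>F x\<bar>"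
        by (intro mult_right_mono) auto
      then show "norm (\<psi> (ln (norm x)) / (norm x)\<^sup>2 * F x) \<le> norm (B * \<bar>F x\<bar>)"
        by (simp only: real_norm_def abs_mult abs_abs)
    qed
  qed
qed

lemma PI_add:
  assumes "cutoff \<psi>" "integrable MA F" "integrable MA G"
  shows "PI \<psi> (\<lambda>x. F x + G x) = PI \<psi> F + PI \<psi> G"
  using cutoff_integrable[OF assms(1,2)] cutoff_integrable[OF assms(1,3)]
  by (simp add: PI_def distrib_left)

lemma PI_cmult: "PI \<psi> (\<lambda>x. c * F x) = c * PI \<psi> F"
  unfolding PI_def by (subst integral_mult_right_zero[symmetric]) (simp add: mult.left_commute)

lemma PI_mult_weight: "PI (\<lambda>s. c * \<psi> s) F = c * PI \<psi> F"
  unfolding PI_def by (subst integral_mult_right_zero[symmetric]) (simp add: mult.assoc)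

lemma PI_add_weight:
  assumes "cutoff \<psi>" "cutoff \<eta>" "integrable MA F"
  shows "PI (\<lambda>s. \<psi> s + \<eta> s) F = PI \<psi> F + PI \<eta> F"
  using cutoff_integrable[OF assms(1,3)] cutoff_integrable[OF assms(2,3)]
  by (simp add: PI_def distrib_right add_divide_distrib)

lemma PI_tendsto:
  assumes "cutoff \<psi>" "L2_tendsto MA u U" "L2_tendsto MA v V"
  shows "(\<lambda>n. PI \<psi> (\<lambda>x. u n x * v n x)) \<longlonglongrightarrow> PI \<psi> (\<lambda>x. U x * V x)"
proof -
  obtain B where B: "\<And>x. x \<in> An \<Longrightarrow> \<bar>\<psi> (ln (norm x)) / (norm x)\<^sup>2\<bar> \<le> B"
    using cutoff_weight(2)[OF assms(1)] by auto
  have "L2_tendsto MA (\<lambda>n x. \<psi> (ln (norm x)) / (norm x)\<^sup>2 * u n x) (\<lambda>x. \<psi> (ln (norm x)) / (norm x)\<^sup>2 * U x)"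
    using assms(2) measurable_MA[OF cutoff_weight(1)[OF assms(1)]] B
    by (rule L2_tendsto_bounded_mult) (simp add: space_MA)
  from L2_tendsto_integral_mult[OF this assms(3)] show ?thesis
    unfolding PI_def by (simp only: mult.assoc)
qed

section \<open>Integration by parts on an annulus\<close>

lemma cutoff_support:
  assumes "cutoff \<psi>" "cutoff \<psi>'"
  obtains K where "compact K" "K \<subseteq> An" "\<And>x. x \<notin> K \<Longrightarrow> \<psi> (ln (norm x)) = 0 \<and> \<psi>' (ln (norm x)) = 0"
proof -
  obtain \<alpha> \<beta> where 1: "ln a < \<alpha>" "\<beta> < ln b" "\<And>s. s < \<alpha> \<or> \<beta> < s \<Longrightarrow> \<psi> s = 0"
    using assms(1) by (auto simp: cutoff_def)
  obtain \<alpha>' \<beta>' where 2: "ln a < \<alpha>'" "\<beta>' < ln b" "\<And>s. s < \<alpha>' \<or> \<beta>' < s \<Longrightarrow> \<psi>' s = 0"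
    using assms(2) by (auto simp: cutoff_def)
  define l r where "l = min \<alpha> \<alpha>'" and "r = max \<beta> \<beta>'"
  have b: "0 < b" "ln b \<le> 0" using a_pos a_less_b b_le_1 by auto
  have lr: "ln a < l" "r < ln b" using 1 2 by (auto simp: l_def r_def)
  define K where "K = cball 0 (exp r) - ball (0::real^2) (exp l)"
  show thesis
  proof (rule that)
    show "compact K" unfolding K_def by (intro compact_diff) auto
    have "a < exp l" "exp r < b" using lr a_pos b(1)
      by (metis exp_less_mono exp_ln)+
    then show "K \<subseteq> An" by (auto simp: K_def An_def)
    fix x assume x: "x \<notin> K"
    have "ln (norm x) < l \<or> r < ln (norm x)"
    proof (cases "x = 0")
      case True
      then have "ln (norm x) = 0" by simp
      then show ?thesis using lr b by linarith
    next
      case False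
      have "norm x < exp l \<or> exp r < norm x" using x by (auto simp: K_def)
      then show ?thesis using False by (metis exp_ln exp_less_cancel_iff zero_less_norm_iff)
    qed
    then show "\<psi> (ln (norm x)) = 0 \<and> \<psi>' (ln (norm x)) = 0"
      using 1(3) 2(3) by (auto simp: l_def r_def)
  qed
qed

text \<open>The divergence identities applied to \<open>\<psi> (ln |x|) q\<close>. The weight is
  radial, hence \<psi>' appears in the first identity and not in the angular one.\<close>

lemma PI_polar_C1_eq_0:
  assumes q: "polar_C1 An q s t" and \<psi>: "\<And>s. (\<psi> has_real_derivative \<psi>' s) (at s)" "cutoff \<psi>" "cutoff \<psi>'"
  shows "PI \<psi>' q + PI \<psi> s = 0" "PI \<psi> t = 0"
proof -
  obtain K where K: "compact K" "K \<subseteq> An" "\<And>x. x \<notin> K \<Longrightarrow> \<psi> (ln (norm x)) = 0 \<and> \<psi>' (ln (norm x)) = 0"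
    using cutoff_support[OF \<psi>(2,3)] by metis
  have P: "polar_C1 An (\<lambda>x. \<psi> (ln (norm x))) (\<lambda>x. \<psi>' (ln (norm x))) (\<lambda>_. 0)"
    using An_nz \<psi>(1) \<psi>(3) by (intro polar_C1_radial) (auto simp: cutoff_def)
  have P2: "polar_C1 An (\<lambda>x. \<psi> (ln (norm x)) * q x) (\<lambda>x. \<psi>' (ln (norm x)) * q x + \<psi> (ln (norm x)) * s x)
      (\<lambda>x. \<psi> (ln (norm x)) * t x)"
    using polar_C1_mult[OF P q] by simp
  have I: "(\<integral>x. (\<psi>' (ln (norm x)) * q x + \<psi> (ln (norm x)) * s x) / (norm x)\<^sup>2 \<partial>lborel) = 0"
    "(\<integral>x. (\<psi> (ln (norm x)) * t x) / (norm x)\<^sup>2 \<partial>lborel) = 0"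
    using integral_polar_eq_0[OF open_An An_nz(2) P2 K(1,2)] K(3) by auto
  have R: "(\<integral>x. f x \<partial>lborel) = (\<integral>x. f x \<partial>MA)" if "\<And>x. x \<notin> K \<Longrightarrow> f x = 0" for f :: "real^2 \<Rightarrow> real"
  proof -
    have "(\<integral>x. f x \<partial>MA) = (\<integral>x. indicator An x *\<^sub>R f x \<partial>lborel)"
      unfolding MA_def using open_An by (subst integral_restrict_space) (auto simp: set_lebesgue_integral_def)
    also have "\<dots> = (\<integral>x. f x \<partial>lborel)"
      using that K(2) by (intro Bochner_Integration.integral_cong) (auto simp: indicator_def)
    finally show ?thesis by simp
  qed
  have supp: "integrable MA (\<lambda>x. \<eta> (ln (norm x)) / (norm x)\<^sup>2 * f x)"
    if "continuous_on An f" "cutoff \<eta>" "\<And>x. x \<notin> K \<Longrightarrow> \<eta> (ln (norm x)) = 0" for \<eta> f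
  proof -
    have "integrable lborel (\<lambda>x. indicator K x *\<^sub>R (\<eta> (ln (norm x)) / (norm x)\<^sup>2 * f x))"
      using K cutoff_weight(1)[OF that(2)] that(1)
      by (intro borel_integrable_compact continuous_on_mult) (auto intro: continuous_on_subset)
    moreover have "(\<lambda>x. indicator K x *\<^sub>R (\<eta> (ln (norm x)) / (norm x)\<^sup>2 * f x)) =
        (\<lambda>x. indicator An x *\<^sub>R (\<eta> (ln (norm x)) / (norm x)\<^sup>2 * f x))"
      using K(2) that(3) by (intro ext) (auto simp: indicator_def)
    ultimately show ?thesis
      unfolding MA_def using open_An by (subst integrable_restrict_space) (auto simp: set_integrable_def)
  qed
  note c = polar_C1_continuous[OF q]
  have "PI \<psi>' q + PI \<psi> s = (\<integral>x. (\<psi>' (ln (norm x)) * q x + \<psi> (ln (norm x)) * s x) / (norm x)\<^sup>2 \<partial>MA)"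
    unfolding PI_def using supp[OF c(1) \<psi>(3)] supp[OF c(2) \<psi>(2)] K(3)
    by (subst Bochner_Integration.integral_add[symmetric]) (auto simp: add_divide_distrib)
  also have "\<dots> = 0" using I(1) K(3) by (subst R[symmetric]) auto
  finally show "PI \<psi>' q + PI \<psi> s = 0" .
  have "PI \<psi> t = (\<integral>x. (\<psi> (ln (norm x)) * t x) / (norm x)\<^sup>2 \<partial>MA)"
    unfolding PI_def by simp
  also have "\<dots> = 0" using I(2) K(3) by (subst R[symmetric]) auto
  finally show "PI \<psi> t = 0" .
qed

text \<open>Products of C^1 approximants are C^1 and satisfy both identities; each term is a
  weighted integral of a product of two L2-convergent sequences, so the identities survive in the
  limit.\<close>

lemma PI_polar_H1_product:
  assumes U: "polar_H1 An U U\<^sub>s U\<^sub>t" and V: "polar_H1 An V V\<^sub>s V\<^sub>t"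
    and \<psi>: "\<And>s. (\<psi> has_real_derivative \<psi>' s) (at s)" "cutoff \<psi>" "cutoff \<psi>'"
  shows "PI \<psi>' (\<lambda>x. U x * V x) + PI \<psi> (\<lambda>x. U\<^sub>s x * V x) + PI \<psi> (\<lambda>x. U x * V\<^sub>s x) = 0"
    and "PI \<psi> (\<lambda>x. U\<^sub>t x * V x) + PI \<psi> (\<lambda>x. U x * V\<^sub>t x) = 0"
proof -
  obtain u s t where 1: "\<And>n. polar_C1 An (u n) (s n) (t n)"
    "L2_tendsto MA u U" "L2_tendsto MA s U\<^sub>s" "L2_tendsto MA t U\<^sub>t"
    using U by (auto simp: polar_H1_def MA_def)
  obtain v s' t' where 2: "\<And>n. polar_C1 An (v n) (s' n) (t' n)"
    "L2_tendsto MA v V" "L2_tendsto MA s' V\<^sub>s" "L2_tendsto MA t' V\<^sub>t"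
    using V by (auto simp: polar_H1_def MA_def)
  note i = L2_integrable_mult[OF L2_tendstoD(1) L2_tendstoD(1)]
  have e: "PI \<psi>' (\<lambda>x. u n x * v n x) + PI \<psi> (\<lambda>x. s n x * v n x) + PI \<psi> (\<lambda>x. u n x * s' n x) = 0"
    "PI \<psi> (\<lambda>x. t n x * v n x) + PI \<psi> (\<lambda>x. u n x * t' n x) = 0" for n
    using PI_polar_C1_eq_0[OF polar_C1_mult[OF 1(1)[of n] 2(1)[of n]] \<psi>]
      PI_add[OF \<psi>(2) i[OF 1(3) 2(2), of n n] i[OF 1(2) 2(3), of n n]]
      PI_add[OF \<psi>(2) i[OF 1(4) 2(2), of n n] i[OF 1(2) 2(4), of n n]] by simp_all
  have "(\<lambda>n. PI \<psi>' (\<lambda>x. u n x * v n x) + PI \<psi> (\<lambda>x. s n x * v n x) + PI \<psi> (\<lambda>x. u n x * s' n x)) \<longlonglongrightarrow>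
      PI \<psi>' (\<lambda>x. U x * V x) + PI \<psi> (\<lambda>x. U\<^sub>s x * V x) + PI \<psi> (\<lambda>x. U x * V\<^sub>s x)"
    by (intro tendsto_add PI_tendsto \<psi> 1 2)
  then show "PI \<psi>' (\<lambda>x. U x * V x) + PI \<psi> (\<lambda>x. U\<^sub>s x * V x) + PI \<psi> (\<lambda>x. U x * V\<^sub>s x) = 0"
    unfolding e LIMSEQ_const_iff by (rule sym)
  have "(\<lambda>n. PI \<psi> (\<lambda>x. t n x * v n x) + PI \<psi> (\<lambda>x. u n x * t' n x)) \<longlonglongrightarrow>
      PI \<psi> (\<lambda>x. U\<^sub>t x * V x) + PI \<psi> (\<lambda>x. U x * V\<^sub>t x)"
    by (intro tendsto_add PI_tendsto \<psi> 1 2)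
  then show "PI \<psi> (\<lambda>x. U\<^sub>t x * V x) + PI \<psi> (\<lambda>x. U x * V\<^sub>t x) = 0"
    unfolding e LIMSEQ_const_iff by (rule sym)
qed

sublocale MA: finite_measure MA
  using finite_MA by (intro finite_measureI) auto

text \<open>A Lipschitz \<open>f\<close> with \<open>f 0 = 0\<close> maps L2-convergent sequences to
  L2-convergent ones, and its primitive \<open>F\<close> grows at most quadratically, so both terms
  pass to the limit along the approximants.\<close>

lemma PI_polar_H1_chain:
  assumes U: "polar_H1 An U U\<^sub>s U\<^sub>t"
    and \<psi>: "\<And>s. (\<psi> has_real_derivative \<psi>' s) (at s)" "cutoff \<psi>" "cutoff \<psi>'"
    and F: "\<And>y. (F has_real_derivative f y) (at y)" "f 0 = 0"
    and L: "\<And>y z. \<bar>f y - f z\<bar> \<le> L * \<bar>y - z\<bar>"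
  shows "PI \<psi>' (\<lambda>x. F (U x)) + PI \<psi> (\<lambda>x. f (U x) * U\<^sub>s x) = 0"
proof -
  obtain u s t where u: "\<And>n. polar_C1 An (u n) (s n) (t n)"
    "L2_tendsto MA u U" "L2_tendsto MA s U\<^sub>s" "L2_tendsto MA t U\<^sub>t"
    using U by (auto simp: polar_H1_def MA_def)
  have L0: "0 \<le> L" using L[of 1 0] by simp
  have cf: "continuous_on UNIV f"
  proof (rule continuous_at_imp_continuous_on, rule ballI)
    fix y
    have "((\<lambda>z. f z - f y) \<longlongrightarrow> 0) (at y)"
    proof (rule Lim_null_comparison)
      show "\<forall>\<^sub>F z in at y. norm (f z - f y) \<le> L * \<bar>z - y\<bar>" using L by simp
      have "isCont (\<lambda>z. L * \<bar>z - y\<bar>) y" by (intro continuous_intros)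
      then show "((\<lambda>z. L * \<bar>z - y\<bar>) \<longlongrightarrow> 0) (at y)" by (simp add: isCont_def)
    qed
    then show "isCont f y" by (simp add: isCont_def LIM_zero_iff)
  qed
  have cF: "continuous_on UNIV F"
    using F(1) by (meson DERIV_isCont continuous_at_imp_continuous_on)
  have m: "(\<lambda>x. f (w x)) \<in> borel_measurable MA" "(\<lambda>x. F (w x)) \<in> borel_measurable MA" if "L2 MA w" for w
    using borel_measurable_continuous_onI[OF cf] borel_measurable_continuous_onI[OF cF] L2_measurable[OF that]
    by (auto intro: measurable_compose)
  have fb: "\<bar>f y\<bar> \<le> L * \<bar>y\<bar>" for y using L[of y 0] F(2) by simp
  have f_L2: "L2 MA (\<lambda>x. f (w x))" if w: "L2 MA w" for w
    unfolding L2_def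
  proof (rule conjI, rule m(1)[OF w], rule Bochner_Integration.integrable_bound)
    show "integrable MA (\<lambda>x. L\<^sup>2 * (w x)\<^sup>2)" using w by (simp add: L2_def)
    show "(\<lambda>x. (f (w x))\<^sup>2) \<in> borel_measurable MA" using m(1)[OF w] by simp
    have "(f y)\<^sup>2 \<le> L\<^sup>2 * y\<^sup>2" for y
      using power_mono[OF fb[of y], of 2] by (simp add: power_mult_distrib)
    then show "AE x in MA. norm ((f (w x))\<^sup>2) \<le> norm (L\<^sup>2 * (w x)\<^sup>2)" by simp
  qed
  have fu: "L2_tendsto MA (\<lambda>n x. f (u n x)) (\<lambda>x. f (U x))"
    unfolding L2_tendsto_def
  proof (intro conjI allI f_L2 L2_tendstoD[OF u(2)])
    have lim: "(\<lambda>n. L\<^sup>2 * (\<integral>x. (u n x - U x)\<^sup>2 \<partial>MA)) \<longlonglongrightarrow> 0"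
      using tendsto_mult_left[OF L2_tendstoD(3)[OF u(2)], of "L\<^sup>2"] by simp
    show "(\<lambda>n. \<integral>x. (f (u n x) - f (U x))\<^sup>2 \<partial>MA) \<longlonglongrightarrow> 0"
    proof (rule tendsto_sandwich[OF _ _ tendsto_const lim])
      show "\<forall>\<^sub>F n in sequentially. (\<integral>x. (f (u n x) - f (U x))\<^sup>2 \<partial>MA) \<le> L\<^sup>2 * (\<integral>x. (u n x - U x)\<^sup>2 \<partial>MA)"
      proof (rule always_eventually, rule allI)
        fix n
        note d = L2_diff[OF L2_tendstoD(1)[OF u(2), of n] L2_tendstoD(2)[OF u(2)]]
        have "(\<integral>x. (f (u n x) - f (U x))\<^sup>2 \<partial>MA) \<le> (\<integral>x. L\<^sup>2 * (u n x - U x)\<^sup>2 \<partial>MA)"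
        proof (rule integral_mono)
          show "integrable MA (\<lambda>x. (f (u n x) - f (U x))\<^sup>2)"
            using L2_diff[OF f_L2[OF L2_tendstoD(1)[OF u(2), of n]] f_L2[OF L2_tendstoD(2)[OF u(2)]]]
            by (simp add: L2_def)
          show "integrable MA (\<lambda>x. L\<^sup>2 * (u n x - U x)\<^sup>2)" using d by (simp add: L2_def)
          show "(f (u n x) - f (U x))\<^sup>2 \<le> L\<^sup>2 * (u n x - U x)\<^sup>2" for x
            using power_mono[OF L[of "u n x" "U x"], of 2] by (simp add: power_mult_distrib)
        qed
        then show "(\<integral>x. (f (u n x) - f (U x))\<^sup>2 \<partial>MA) \<le> L\<^sup>2 * (\<integral>x. (u n x - U x)\<^sup>2 \<partial>MA)" by simp
      qed
    qed simp
  qed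
  \<comment> \<open>Mean value estimate on the segment, where
    \<open>|f| \<le> L (|y - z| + |z|)\<close>. The bound avoids \<open>|y|\<close>: with
    \<open>z\<close> the limit and \<open>y\<close> an approximant, it tends to 0 in the integral by
    Cauchy-Schwarz.\<close>
  have Fd: "\<bar>F y - F z\<bar> \<le> L * (\<bar>y - z\<bar> * \<bar>y - z\<bar> + \<bar>z\<bar> * \<bar>y - z\<bar>)" for y z
  proof -
    have "norm (F y - F z) \<le> L * (\<bar>y - z\<bar> + \<bar>z\<bar>) * norm (y - z)"
    proof (rule field_differentiable_bound[where S="closed_segment z y" and f'=f])
      fix c assume c: "c \<in> closed_segment z y"
      show "(F has_field_derivative f c) (at c within closed_segment z y)"
        using F(1) has_field_derivative_at_within by blast
      have "\<bar>c\<bar> \<le> \<bar>y - z\<bar> + \<bar>z\<bar>" using c by (auto simp: closed_segment_eq_real_ivl split: if_splits)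
      then show "norm (f c) \<le> L * (\<bar>y - z\<bar> + \<bar>z\<bar>)"
        using fb[of c] mult_left_mono[OF _ L0, of "\<bar>c\<bar>" "\<bar>y - z\<bar> + \<bar>z\<bar>"] by simp
    qed auto
    then show ?thesis by (simp add: algebra_simps)
  qed
  have F_int: "integrable MA (\<lambda>x. F (w x))" if w: "L2 MA w" for w
  proof (rule Bochner_Integration.integrable_bound)
    show "integrable MA (\<lambda>x. \<bar>F 0\<bar> + L * (w x)\<^sup>2)"
      using w finite_MA by (simp add: L2_def)
    have "\<bar>F y\<bar> \<le> \<bar>F 0\<bar> + L * y\<^sup>2" for y
      using Fd[of y 0] by (simp add: power2_eq_square abs_if split: if_splits)
    then show "AE x in MA. norm (F (w x)) \<le> norm (\<bar>F 0\<bar> + L * (w x)\<^sup>2)"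
      using L0 by simp
  qed (rule m(2)[OF w])
  obtain B where B: "\<And>x. x \<in> An \<Longrightarrow> \<bar>\<psi>' (ln (norm x)) / (norm x)\<^sup>2\<bar> \<le> B"
    using cutoff_weight(2)[OF \<psi>(3)] by auto
  \<comment> \<open>\<open>B\<close> bounds the weight on the annulus only, so its sign is read off
    at a point there: the midpoint radius on the first axis.\<close>
  have B0: "0 \<le> B"
    using order_trans[OF abs_ge_zero B, of "((a + b) / 2) *\<^sub>R axis 1 1"] a_pos a_less_b by (auto simp: An_def)
  have FU: "(\<lambda>n. PI \<psi>' (\<lambda>x. F (u n x))) \<longlonglongrightarrow> PI \<psi>' (\<lambda>x. F (U x))"
  proof -
    define e where "e n = sqrt (\<integral>x. (u n x - U x)\<^sup>2 \<partial>MA)" for n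
    define N where "N = sqrt (\<integral>x. (U x)\<^sup>2 \<partial>MA)"
    have e0: "e \<longlonglongrightarrow> 0"
      using tendsto_real_sqrt[OF L2_tendstoD(3)[OF u(2)]] by (simp add: e_def[abs_def])
    have "(\<lambda>n. B * L * (e n * e n + N * e n)) \<longlonglongrightarrow> B * L * (0 * 0 + N * 0)"
      by (intro tendsto_intros e0)
    then have lim: "(\<lambda>n. B * L * (e n * e n + N * e n)) \<longlonglongrightarrow> 0" by simp
    have "(\<lambda>n. PI \<psi>' (\<lambda>x. F (u n x)) - PI \<psi>' (\<lambda>x. F (U x))) \<longlonglongrightarrow> 0"
    proof (rule Lim_null_comparison[OF always_eventually lim], rule allI)
      fix n
      note d = L2_diff[OF L2_tendstoD(1)[OF u(2), of n] L2_tendstoD(2)[OF u(2)]]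
      have absL2: "L2 MA (\<lambda>x. \<bar>w x\<bar>)" if "L2 MA w" for w
        using that by (auto simp: L2_def intro!: borel_measurable_abs)
      have eq: "PI \<psi>' (\<lambda>x. F (u n x)) - PI \<psi>' (\<lambda>x. F (U x)) =
          (\<integral>x. \<psi>' (ln (norm x)) / (norm x)\<^sup>2 * F (u n x) - \<psi>' (ln (norm x)) / (norm x)\<^sup>2 * F (U x) \<partial>MA)"
        unfolding PI_def
        using cutoff_integrable[OF \<psi>(3) F_int[OF L2_tendstoD(1)[OF u(2), of n]]]
          cutoff_integrable[OF \<psi>(3) F_int[OF L2_tendstoD(2)[OF u(2)]]]
        by (rule Bochner_Integration.integral_diff[symmetric])
      have "\<bar>PI \<psi>' (\<lambda>x. F (u n x)) - PI \<psi>' (\<lambda>x. F (U x))\<bar> \<le> (\<integral>x. B * L * (\<bar>u n x - U x\<bar> * \<bar>u n x - U x\<bar> + \<bar>U x\<bar> * \<bar>u n x - U x\<bar>) \<partial>MA)"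
        unfolding eq
      proof (rule order_trans[OF integral_abs_bound integral_mono])
        show "integrable MA (\<lambda>x. \<bar>\<psi>' (ln (norm x)) / (norm x)\<^sup>2 * F (u n x) - \<psi>' (ln (norm x)) / (norm x)\<^sup>2 * F (U x)\<bar>)"
          using cutoff_integrable[OF \<psi>(3) F_int[OF L2_tendstoD(1)[OF u(2), of n]]]
            cutoff_integrable[OF \<psi>(3) F_int[OF L2_tendstoD(2)[OF u(2)]]]
          by (intro integrable_abs Bochner_Integration.integrable_diff)
        show "integrable MA (\<lambda>x. B * L * (\<bar>u n x - U x\<bar> * \<bar>u n x - U x\<bar> + \<bar>U x\<bar> * \<bar>u n x - U x\<bar>))"
          by (intro integrable_mult_right Bochner_Integration.integrable_add L2_integrable_mult absL2 d
            L2_tendstoD[OF u(2)])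
        fix x assume "x \<in> space MA"
        then have "\<bar>\<psi>' (ln (norm x)) / (norm x)\<^sup>2\<bar> * \<bar>F (u n x) - F (U x)\<bar>
            \<le> B * (L * (\<bar>u n x - U x\<bar> * \<bar>u n x - U x\<bar> + \<bar>U x\<bar> * \<bar>u n x - U x\<bar>))"
          using B B0 Fd by (intro mult_mono) (auto simp: space_MA)
        then show "\<bar>\<psi>' (ln (norm x)) / (norm x)\<^sup>2 * F (u n x) - \<psi>' (ln (norm x)) / (norm x)\<^sup>2 * F (U x)\<bar>
            \<le> B * L * (\<bar>u n x - U x\<bar> * \<bar>u n x - U x\<bar> + \<bar>U x\<bar> * \<bar>u n x - U x\<bar>)"
          unfolding right_diff_distrib[symmetric] abs_mult mult.assoc .
      qed
      also have "\<dots> = B * L * ((\<integral>x. \<bar>u n x - U x\<bar> * \<bar>u n x - U x\<bar> \<partial>MA) + (\<integral>x. \<bar>U x\<bar> * \<bar>u n x - U x\<bar> \<partial>MA))"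
        by (simp only: integral_mult_right_zero Bochner_Integration.integral_add[OF
          L2_integrable_mult[OF absL2[OF d] absL2[OF d]]
          L2_integrable_mult[OF absL2[OF L2_tendstoD(2)[OF u(2)]] absL2[OF d]]])
      also have "\<dots> \<le> B * L * (e n * e n + N * e n)"
        using L2_Cauchy_Schwarz[OF absL2[OF d] absL2[OF d]]
          L2_Cauchy_Schwarz[OF absL2[OF L2_tendstoD(2)[OF u(2)]] absL2[OF d]] B0 L0
        by (intro mult_left_mono add_mono) (auto simp: e_def N_def)
      finally show "norm (PI \<psi>' (\<lambda>x. F (u n x)) - PI \<psi>' (\<lambda>x. F (U x))) \<le> B * L * (e n * e n + N * e n)"
        by simp
    qed
    then show ?thesis by (simp add: LIM_zero_iff)
  qed
  have e: "PI \<psi>' (\<lambda>x. F (u n x)) + PI \<psi> (\<lambda>x. f (u n x) * s n x) = 0" for n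
    using PI_polar_C1_eq_0[OF polar_C1_chain[OF u(1)[of n] F(1) cf] \<psi>] by simp
  have "(\<lambda>n. PI \<psi>' (\<lambda>x. F (u n x)) + PI \<psi> (\<lambda>x. f (u n x) * s n x)) \<longlonglongrightarrow>
     PI \<psi>' (\<lambda>x. F (U x)) + PI \<psi> (\<lambda>x. f (U x) * U\<^sub>s x)"
    by (intro tendsto_add FU PI_tendsto \<psi> fu u)
  then show ?thesis unfolding e LIMSEQ_const_iff by (rule sym)
qed

end

section \<open>Smooth compactly supported kernels\<close>

lemma partial_const: "partial i (\<lambda>_. c) = (\<lambda>_. 0)"
  by (intro ext) (simp add: partial_def frechet_derivative_at[OF has_derivative_const, symmetric])

lemma partial_add:
  assumes "f differentiable (at x)" "g differentiable (at x)"
  shows "partial i (\<lambda>x. f x + g x) x = partial i f x + partial i g x"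
proof -
  have "((\<lambda>x. f x + g x) has_derivative (\<lambda>h. frechet_derivative f (at x) h + frechet_derivative g (at x) h)) (at x)"
    using assms by (intro has_derivative_add) (simp_all add: frechet_derivative_works)
  from frechet_derivative_at[OF this] show ?thesis
    by (simp add: partial_def fun_eq_iff)
qed

lemma partial_mult:
  assumes "f differentiable (at x)" "g differentiable (at x)"
  shows "partial i (\<lambda>x. f x * g x) x = f x * partial i g x + partial i f x * g x"
proof -
  have "((\<lambda>x. f x * g x) has_derivative
      (\<lambda>h. f x * frechet_derivative g (at x) h + frechet_derivative f (at x) h * g x)) (at x)"
    using assms by (intro has_derivative_mult) (simp_all add: frechet_derivative_works)
  from frechet_derivative_at[OF this] show ?thesis
    by (simp add: partial_def fun_eq_iff)
qed

text \<open>Connects the two notions of partial derivative: test functions are described by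
  \<open>partial\<close>, kernels by \<open>pd\<close>.\<close>

lemma partial_eq_pd:
  assumes "f differentiable (at x)" "pd i f x d"
  shows "partial i f x = d"
proof -
  have "(f has_derivative frechet_derivative f (at x)) (at (x + 0 *\<^sub>R axis i 1))"
    using assms(1) by (simp add: frechet_derivative_works)
  moreover have "((\<lambda>t::real. x + t *\<^sub>R axis i 1) has_derivative (\<lambda>h. h *\<^sub>R axis i 1)) (at 0)"
    by (auto intro!: derivative_eq_intros)
  ultimately have "((\<lambda>t. f (x + t *\<^sub>R axis i 1)) has_derivative
      (\<lambda>h. frechet_derivative f (at x) (h *\<^sub>R axis i 1))) (at 0)"
    by (rule has_derivative_compose[rotated])
  moreover have "((\<lambda>t. f (x + t *\<^sub>R axis i 1)) has_derivative (\<lambda>h. d * h)) (at 0)"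
    using assms(2) by (simp add: pd_def has_field_derivative_def)
  ultimately have "(\<lambda>h::real. frechet_derivative f (at x) (h *\<^sub>R axis i 1)) = (\<lambda>h. d * h)"
    by (rule has_derivative_unique)
  from fun_cong[OF this, of 1] show ?thesis by (simp add: partial_def)
qed

lemma C_class_const: "C_class k UNIV (\<lambda>_. c)"
  by (induction k arbitrary: c) (simp_all add: partial_const)

lemma C_class_Suc_imp: "C_class (Suc k) UNIV f \<Longrightarrow> C_class k UNIV f"
proof (induction k arbitrary: f)
  case 0
  then show ?case
    by (auto simp: continuous_on_eq_continuous_at intro: differentiable_imp_continuous_within)
next
  case (Suc k)
  then show ?case by (metis C_class.simps(2))
qed

lemma C_class_add:
  "C_class k UNIV f \<Longrightarrow> C_class k UNIV g \<Longrightarrow> C_class k UNIV (\<lambda>x. f x + g x)"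
proof (induction k arbitrary: f g)
  case 0
  then show ?case by (auto intro: continuous_intros)
next
  case (Suc k)
  have "partial i (\<lambda>x. f x + g x) = (\<lambda>x. partial i f x + partial i g x)" for i
    using Suc.prems by (intro ext partial_add) auto
  then show ?case using Suc by auto
qed

lemma C_class_mult:
  "C_class k UNIV f \<Longrightarrow> C_class k UNIV g \<Longrightarrow> C_class k UNIV (\<lambda>x. f x * g x)"
proof (induction k arbitrary: f g)
  case 0
  then show ?case by (auto intro: continuous_intros)
next
  case (Suc k)
  have "partial i (\<lambda>x. f x * g x) = (\<lambda>x. f x * partial i g x + partial i f x * g x)" for i
    using Suc.prems by (intro ext partial_mult) auto
  moreover have "C_class k UNIV (\<lambda>x. f x * partial i g x + partial i f x * g x)" for i
    using Suc.prems
    by (intro C_class_add[OF Suc.IH Suc.IH] C_class_Suc_imp[OF Suc.prems(1)] C_class_Suc_imp[OF Suc.prems(2)]) auto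
  ultimately show ?case using Suc.prems by auto
qed

section \<open>Flat functions built from \<open>exp (- 1 / t)\<close>, and smooth bumps\<close>

definition hexp :: "nat \<Rightarrow> real \<Rightarrow> real" where
  "hexp m t = (if t \<le> 0 then 0 else exp (- inverse t) * inverse t ^ m)"

lemma hexp_tendsto_0: "(hexp m \<longlongrightarrow> 0) (at 0)"
proof (rule filterlim_split_at)
  have "\<forall>\<^sub>F t in at_left 0. hexp m t = 0"
    by (auto simp: eventually_at_filter hexp_def)
  then show "(hexp m \<longlongrightarrow> 0) (at_left 0)" by (rule tendsto_eventually)
  have "((\<lambda>t. inverse t ^ m / exp (inverse t)) \<longlongrightarrow> (0::real)) (at_right 0)"
    by (rule filterlim_compose[OF tendsto_power_div_exp_0 filterlim_inverse_at_top_right])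
  moreover have "\<forall>\<^sub>F t in at_right 0. inverse t ^ m / exp (inverse t) = hexp m t"
    by (auto simp: eventually_at_filter hexp_def exp_minus field_simps)
  ultimately show "(hexp m \<longlongrightarrow> 0) (at_right 0)" by (rule Lim_transform_eventually)
qed

text \<open>The exponent \<open>m\<close> makes the family closed under differentiation up to linear
  combinations, so smoothness of every order follows by a single induction.\<close>

lemma hexp_DERIV:
  "(hexp m has_real_derivative (hexp (m + 2) t - real m * hexp (m + 1) t)) (at t)"
proof -
  consider "t < 0" | "t = 0" | "t > 0" by linarith
  then show ?thesis
  proof cases
    case 1
    have "((\<lambda>_. 0) has_real_derivative 0) (at t)" by simp
    then have "(hexp m has_real_derivative 0) (at t)"
      by (rule has_field_derivative_transform_within_open[where S="{..<0}"]) (use 1 in \<open>auto simp: hexp_def\<close>)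
    then show ?thesis using 1 by (simp add: hexp_def)
  next
    case 2
    \<comment> \<open>At the origin the difference quotient of \<open>hexp m\<close> is
      \<open>hexp (m + 1)\<close>, which tends to 0.\<close>
    have "\<forall>\<^sub>F h in at 0. hexp (m + 1) h = (hexp m (0 + h) - hexp m 0) / h"
      by (auto simp: eventually_at_filter hexp_def divide_inverse)
    with hexp_tendsto_0 have "((\<lambda>h. (hexp m (0 + h) - hexp m 0) / h) \<longlongrightarrow> 0) (at 0)"
      by (rule Lim_transform_eventually)
    then show ?thesis using 2 by (simp add: DERIV_def hexp_def)
  next
    case 3
    have "((\<lambda>t. exp (- inverse t) * inverse t ^ m) has_real_derivative
        exp (- inverse t) * inverse t ^ (m + 2) - real m * (exp (- inverse t) * inverse t ^ (m + 1))) (at t)"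
    proof (rule DERIV_cong)
      have "((\<lambda>y. exp (- y) * y ^ m) has_real_derivative
          (- exp (- y) * y ^ m + exp (- y) * (real m * y ^ (m - 1)))) (at y)" for y :: real
        by (auto intro!: derivative_eq_intros)
      then show "((\<lambda>t. exp (- inverse t) * inverse t ^ m) has_real_derivative
          (- exp (- inverse t) * inverse t ^ m + exp (- inverse t) * (real m * inverse t ^ (m - 1)))
            * - (inverse t ^ Suc (Suc 0))) (at t)"
        by (rule DERIV_chain2) (rule DERIV_inverse, use 3 in simp)
      show "(- exp (- inverse t) * inverse t ^ m + exp (- inverse t) * (real m * inverse t ^ (m - 1)))
            * - (inverse t ^ Suc (Suc 0))
         = exp (- inverse t) * inverse t ^ (m + 2) - real m * (exp (- inverse t) * inverse t ^ (m + 1))"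
        by (cases m) (simp_all add: algebra_simps)
    qed
    then have "(hexp m has_real_derivative
        exp (- inverse t) * inverse t ^ (m + 2) - real m * (exp (- inverse t) * inverse t ^ (m + 1))) (at t)"
      by (rule has_field_derivative_transform_within_open[where S="{0<..}"]) (use 3 in \<open>auto simp: hexp_def\<close>)
    then show ?thesis using 3 by (simp add: hexp_def)
  qed
qed

lemma continuous_hexp: "continuous_on UNIV (hexp m)"
  using hexp_DERIV by (meson DERIV_isCont continuous_at_imp_continuous_on)

lemma affine_component_has_derivative:
  "((\<lambda>x::real^'n::finite. c + d * x $ i) has_derivative (\<lambda>h. d * h $ i)) (at x)"
proof -
  have "((\<lambda>x::real^'n. x $ i) has_derivative (\<lambda>h. h $ i)) (at x)"
    by (rule bounded_linear_imp_has_derivative) (rule bounded_linear_vec_nth)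
  then show ?thesis by (auto intro!: derivative_eq_intros)
qed

lemma C_class_hexp: "C_class k UNIV (\<lambda>x::real^'n::finite. hexp m (c + d * x $ i))"
proof (induction k arbitrary: m)
  case 0
  have "continuous_on UNIV (\<lambda>x::real^'n. c + d * x $ i)" by (intro continuous_intros)
  then show ?case using continuous_on_compose2[OF continuous_hexp, of UNIV] by simp
next
  case (Suc k)
  define e where "e m t = hexp (m + 2) t - real m * hexp (m + 1) t" for m t
  have D: "((\<lambda>x::real^'n. hexp m (c + d * x $ i)) has_derivative (\<lambda>h. e m (c + d * x $ i) * (d * h $ i))) (at x)" for x
    using has_derivative_compose[OF affine_component_has_derivative hexp_DERIV[unfolded has_field_derivative_def]]
    unfolding e_def by simp
  have P: "partial j (\<lambda>x::real^'n. hexp m (c + d * x $ i)) =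
     (\<lambda>x. (d * axis j 1 $ i) * (hexp (m + 2) (c + d * x $ i) + (- real m) * hexp (m + 1) (c + d * x $ i)))" for j
    using frechet_derivative_at[OF D] by (simp add: partial_def fun_eq_iff e_def algebra_simps)
  show ?case unfolding C_class.simps P
  proof (intro conjI ballI allI)
    show "(\<lambda>x::real^'n. hexp m (c + d * x $ i)) differentiable (at x)" for x
      using D by (auto simp: differentiable_def)
    show "C_class k UNIV (\<lambda>x::real^'n. (d * axis j 1 $ i) *
       (hexp (m + 2) (c + d * x $ i) + (- real m) * hexp (m + 1) (c + d * x $ i)))" for j
      by (intro C_class_mult C_class_add C_class_const Suc)
  qed
qed

text \<open>On (-1, 1) this equals \<open>exp (- 2 / (1 - s\<^sup>2))\<close>. The factored form
  reduces smoothness to that of \<open>hexp\<close>.\<close>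

definition bump :: "real \<Rightarrow> real" where
  "bump s = hexp 0 (1 + s) * hexp 0 (1 - s)"

definition bump_deriv :: "real \<Rightarrow> real" where
  "bump_deriv s = hexp 2 (1 + s) * hexp 0 (1 - s) - hexp 0 (1 + s) * hexp 2 (1 - s)"

lemma bump_DERIV: "(bump has_real_derivative bump_deriv s) (at s)"
proof -
  have h: "(hexp 0 has_real_derivative hexp 2 t) (at t)" for t
    using hexp_DERIV[of 0 t] by (simp add: numeral_2_eq_2)
  have "((\<lambda>s. hexp 0 (1 + s)) has_real_derivative hexp 2 (1 + s) * 1) (at s)"
    by (rule DERIV_chain2[OF h]) (auto intro!: derivative_eq_intros)
  moreover have "((\<lambda>s. hexp 0 (1 - s)) has_real_derivative hexp 2 (1 - s) * - 1) (at s)"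
    by (rule DERIV_chain2[OF h]) (auto intro!: derivative_eq_intros)
  ultimately have "((\<lambda>s. hexp 0 (1 + s) * hexp 0 (1 - s)) has_real_derivative
      hexp 2 (1 + s) * 1 * hexp 0 (1 - s) + hexp 2 (1 - s) * - 1 * hexp 0 (1 + s)) (at s)"
    by (rule DERIV_mult)
  then show ?thesis unfolding bump_def[abs_def] bump_deriv_def by (simp add: algebra_simps)
qed

lemma bump_facts:
  "0 \<le> bump s" "bump (- s) = bump s" "1 \<le> \<bar>s\<bar> \<Longrightarrow> bump s = 0" "1 \<le> \<bar>s\<bar> \<Longrightarrow> bump_deriv s = 0" "0 < bump 0"
  by (auto simp: bump_def bump_deriv_def hexp_def abs_if split: if_splits)

lemma continuous_bump: "continuous_on UNIV bump" "continuous_on UNIV bump_deriv"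
proof -
  show "continuous_on UNIV bump"
    using bump_DERIV by (meson DERIV_isCont continuous_at_imp_continuous_on)
  have "continuous_on UNIV (\<lambda>s. hexp m (1 + s))" "continuous_on UNIV (\<lambda>s. hexp m (1 - s))" for m
    by (rule continuous_on_compose2[OF continuous_hexp, of UNIV]; simp add: continuous_intros)+
  then show "continuous_on UNIV bump_deriv"
    unfolding bump_deriv_def[abs_def] by (intro continuous_intros)
qed

text \<open>Smoothness is demanded of \<open>y \<mapsto> \<kappa> (x - y)\<close>, the function that
  is used to test weak derivatives. The common mixed derivative
  \<open>\<kappa>\<^sub>1\<^sub>2\<close> serves to show that second weak derivatives commute;
  evenness makes the mass 1 in either variable.\<close>

definition mollifier :: "real \<Rightarrow> (real^2 \<Rightarrow> real) \<Rightarrow> (real^2 \<Rightarrow> real) \<Rightarrow> (real^2 \<Rightarrow> real) \<Rightarrow> bool" where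
  "mollifier r \<kappa> \<kappa>\<^sub>1 \<kappa>\<^sub>2 \<longleftrightarrow> C1_on UNIV \<kappa> \<kappa>\<^sub>1 \<kappa>\<^sub>2 \<and> (\<forall>z. 0 \<le> \<kappa> z) \<and> (\<forall>z. \<kappa> (- z) = \<kappa> z) \<and>
     (\<forall>z. r \<le> norm z \<longrightarrow> \<kappa> z = 0 \<and> \<kappa>\<^sub>1 z = 0 \<and> \<kappa>\<^sub>2 z = 0) \<and> (\<integral>z. \<kappa> z \<partial>lborel) = 1 \<and>
     (\<forall>k x. C_class k UNIV (\<lambda>y. \<kappa> (x - y))) \<and>
     (\<exists>\<kappa>\<^sub>1\<^sub>2. continuous_on UNIV \<kappa>\<^sub>1\<^sub>2 \<and> (\<forall>z. r \<le> norm z \<longrightarrow> \<kappa>\<^sub>1\<^sub>2 z = 0) \<and>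
       (\<forall>z. pd 2 \<kappa>\<^sub>1 z (\<kappa>\<^sub>1\<^sub>2 z) \<and> pd 1 \<kappa>\<^sub>2 z (\<kappa>\<^sub>1\<^sub>2 z)))"

lemma mollifier_exists:
  assumes "0 < r"
  shows "\<exists>\<kappa> \<kappa>\<^sub>1 \<kappa>\<^sub>2. mollifier r \<kappa> \<kappa>\<^sub>1 \<kappa>\<^sub>2"
proof -
  \<comment> \<open>A point of norm at least \<open>r\<close> has a coordinate of absolute value at
    least \<open>r / 2\<close>, and there the rescaled bump is 0.\<close>
  define c where "c = 2 / r"
  have c: "0 < c" using assms by (simp add: c_def)
  define \<eta> where "\<eta> z = bump (c * z$1) * bump (c * z$2)" for z :: "real^2"
  define \<eta>1 where "\<eta>1 z = c * bump_deriv (c * z$1) * bump (c * z$2)" for z :: "real^2"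
  define \<eta>2 where "\<eta>2 z = bump (c * z$1) * (c * bump_deriv (c * z$2))" for z :: "real^2"
  define \<eta>3 where "\<eta>3 z = c * bump_deriv (c * z$1) * (c * bump_deriv (c * z$2))" for z :: "real^2"
  have supp: "\<eta> z = 0" "\<eta>1 z = 0" "\<eta>2 z = 0" "\<eta>3 z = 0" if "r \<le> norm z" for z
  proof -
    have "norm z \<le> \<bar>z$1\<bar> + \<bar>z$2\<bar>" using norm_le_l1_cart[of z] by (simp add: sum_2)
    then have "r / 2 \<le> \<bar>z$1\<bar> \<or> r / 2 \<le> \<bar>z$2\<bar>" using that by linarith
    then have "1 \<le> \<bar>c * z$1\<bar> \<or> 1 \<le> \<bar>c * z$2\<bar>"
      using assms by (auto simp: c_def abs_mult field_simps)
    then show "\<eta> z = 0" "\<eta>1 z = 0" "\<eta>2 z = 0" "\<eta>3 z = 0"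
      by (auto simp: \<eta>_def \<eta>1_def \<eta>2_def \<eta>3_def bump_facts)
  qed
  have cc: "continuous_on UNIV (\<lambda>z::real^2. bump (c * z$i))" "continuous_on UNIV (\<lambda>z::real^2. bump_deriv (c * z$i))" for i
    by (rule continuous_on_compose2[OF continuous_bump(1), of UNIV], simp_all add: continuous_intros)
      (rule continuous_on_compose2[OF continuous_bump(2), of UNIV], simp_all add: continuous_intros)
  have cont: "continuous_on UNIV \<eta>" "continuous_on UNIV \<eta>1" "continuous_on UNIV \<eta>2"
    unfolding \<eta>_def[abs_def] \<eta>1_def[abs_def] \<eta>2_def[abs_def] by (intro continuous_intros cc)+
  have pb: "pd i (\<lambda>z::real^2. bump (c * z$j)) z (bump_deriv (c * z$j) * (if i = j then c else 0))" for i j z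
  proof -
    have "pd i (\<lambda>z::real^2. c * z$j) z (0 * z$j + (if i = j then 1 else 0) * c)"
      by (rule pd_mult[OF _ pd_component]) (simp add: pd_def)
    from pd_chain[OF this bump_DERIV] show ?thesis by (simp split: if_splits)
  qed
  have pds: "pd 1 \<eta> z (\<eta>1 z)" "pd 2 \<eta> z (\<eta>2 z)" for z
    using pd_mult[OF pb[of 1 1 z] pb[of 1 2 z]] pd_mult[OF pb[of 2 1 z] pb[of 2 2 z]]
    unfolding \<eta>_def[abs_def] \<eta>1_def \<eta>2_def by (simp_all add: mult_ac)
  have pb0: "pd i (\<lambda>z::real^2. c * bump_deriv (c * z$j)) z 0" if "i \<noteq> j" for i j z
    using that by (simp add: pd_def axis_def)
  have pds3: "pd 2 \<eta>1 z (\<eta>3 z)" "pd 1 \<eta>2 z (\<eta>3 z)" for z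
    using pd_mult[OF pb0[of 2 1 z] pb[of 2 2 z]] pd_mult[OF pb[of 1 1 z] pb0[of 1 2 z]]
    unfolding \<eta>1_def[abs_def] \<eta>2_def[abs_def] \<eta>3_def by (simp_all add: mult_ac)
  have cont3: "continuous_on UNIV \<eta>3"
    unfolding \<eta>3_def[abs_def] by (intro continuous_intros cc)
  define Z where "Z = (\<integral>z. \<eta> z \<partial>lborel)"
  have nn: "0 \<le> \<eta> z" for z by (simp add: \<eta>_def bump_facts)
  have int: "integrable lborel \<eta>"
    by (rule integrable_continuous_compact_support[OF cont(1) compact_cball[of 0 r]]) (auto intro: supp)
  have "Z \<noteq> 0"
  proof
    assume "Z = 0"
    then have "AE z in lborel. \<eta> z = 0"
      using integral_nonneg_eq_0_iff_AE[OF int] nn by (simp add: Z_def)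
    moreover have op: "open {z. \<eta> z \<noteq> 0}"
      using open_Collect_neq[OF cont(1) continuous_on_const] by simp
    ultimately have "{z. \<eta> z \<noteq> 0} \<in> null_sets lborel"
      by (subst (asm) AE_iff_null) (auto intro: borel_open)
    then have "negligible {z. \<eta> z \<noteq> 0}"
      by (simp add: negligible_iff_null_sets null_sets_completionI)
    moreover have "0 \<in> {z. \<eta> z \<noteq> 0}" using bump_facts(5) by (simp add: \<eta>_def)
    ultimately show False using op open_not_negligible by blast
  qed
  moreover have "0 \<le> Z" using nn by (simp add: Z_def)
  ultimately have Z: "0 < Z" by simp
  have Csm: "C_class k UNIV (\<lambda>y. \<eta> (x - y) / Z)" for k x
  proof -
    have e: "\<eta> (x - y) / Z = inverse Z * ((hexp 0 ((1 + c * x$1) + (- c) * y$1) * hexp 0 ((1 - c * x$1) + c * y$1)) *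
        (hexp 0 ((1 + c * x$2) + (- c) * y$2) * hexp 0 ((1 - c * x$2) + c * y$2)))" for y
      by (simp add: \<eta>_def bump_def divide_inverse algebra_simps)
    show ?thesis unfolding e by (intro C_class_mult C_class_hexp C_class_const)
  qed
  have pc: "pd i (\<lambda>z. f z / Z) z (d / Z)" if "pd i f z d" for i f z d
    using that unfolding pd_def by (rule DERIV_cdivide)
  have "mollifier r (\<lambda>z. \<eta> z / Z) (\<lambda>z. \<eta>1 z / Z) (\<lambda>z. \<eta>2 z / Z)"
    unfolding mollifier_def C1_on_def
  proof (intro conjI allI impI ballI)
    show "(\<integral>z. \<eta> z / Z \<partial>lborel) = 1" using Z by (simp add: Z_def)
    show "\<eta> (- z) / Z = \<eta> z / Z" for z by (simp add: \<eta>_def bump_facts(2))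
    show "\<exists>\<kappa>\<^sub>1\<^sub>2. continuous_on UNIV \<kappa>\<^sub>1\<^sub>2 \<and> (\<forall>z. r \<le> norm z \<longrightarrow> \<kappa>\<^sub>1\<^sub>2 z = 0) \<and>
       (\<forall>z. pd 2 (\<lambda>z. \<eta>1 z / Z) z (\<kappa>\<^sub>1\<^sub>2 z) \<and> pd 1 (\<lambda>z. \<eta>2 z / Z) z (\<kappa>\<^sub>1\<^sub>2 z))"
      using cont3 Z supp(4) pc[OF pds3(1)] pc[OF pds3(2)] by (intro exI[of _ "\<lambda>z. \<eta>3 z / Z"]) (auto intro!: continuous_intros)
  qed (use cont Z nn supp pc[OF pds(1)] pc[OF pds(2)] Csm in \<open>auto intro!: continuous_intros\<close>)
  then show ?thesis by blast
qed

section \<open>Mollification\<close>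

definition moll :: "(real^2 \<Rightarrow> real) \<Rightarrow> (real^2 \<Rightarrow> real) \<Rightarrow> real^2 \<Rightarrow> real" where
  "moll \<kappa> f x = (\<integral>y. \<kappa> (x - y) * f y \<partial>lborel)"

text \<open>What a mollifier shares with its derivatives, which have neither a sign nor unit
  mass.\<close>

definition kernel :: "real \<Rightarrow> (real^2 \<Rightarrow> real) \<Rightarrow> bool" where
  "kernel r \<kappa> \<longleftrightarrow> continuous_on UNIV \<kappa> \<and> (\<forall>z. r \<le> norm z \<longrightarrow> \<kappa> z = 0)"

lemma kernel_bounded:
  assumes "kernel r \<kappa>"
  obtains B where "0 \<le> B" "\<And>z. \<bar>\<kappa> z\<bar> \<le> B"
proof -
  have "\<kappa> z = 0" if "z \<notin> cball 0 r" for z using assms that by (auto simp: kernel_def)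
  then show thesis
    using bounded_continuous_compact_support[of \<kappa> "cball 0 r"] assms that by (auto simp: kernel_def)
qed

lemma kernel_measurable: "kernel r \<kappa> \<Longrightarrow> \<kappa> \<in> borel_measurable borel"
  by (auto simp: kernel_def intro: borel_measurable_continuous_onI)

lemma moll_integrable:
  assumes \<kappa>: "kernel r \<kappa>" and f: "integrable lborel f"
  shows "integrable lborel (\<lambda>y. \<kappa> (x - y) * f y)"
proof -
  obtain B where B: "0 \<le> B" "\<And>z. \<bar>\<kappa> z\<bar> \<le> B" using kernel_bounded[OF \<kappa>] by auto
  show ?thesis
  proof (rule Bochner_Integration.integrable_bound)
    show "integrable lborel (\<lambda>y. B * \<bar>f y\<bar>)" using f by simp
    show "(\<lambda>y. \<kappa> (x - y) * f y) \<in> borel_measurable lborel"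
      using kernel_measurable[OF \<kappa>] borel_measurable_integrable[OF f] by measurable
    have "\<bar>\<kappa> (x - y) * f y\<bar> \<le> B * \<bar>f y\<bar>" for y
      unfolding abs_mult using B by (intro mult_right_mono) auto
    then show "AE y in lborel. norm (\<kappa> (x - y) * f y) \<le> norm (B * \<bar>f y\<bar>)"
      using B(1) by (auto simp: abs_mult)
  qed
qed

lemma moll_diff:
  assumes "kernel r \<kappa>" "integrable lborel f" "integrable lborel g"
  shows "moll \<kappa> (\<lambda>y. f y - g y) x = moll \<kappa> f x - moll \<kappa> g x"
  using moll_integrable[OF assms(1,2)] moll_integrable[OF assms(1,3)]
  by (simp add: moll_def right_diff_distrib)

lemma moll_continuous:
  assumes \<kappa>: "kernel r \<kappa>" and f: "integrable lborel f"
  shows "continuous_on UNIV (moll \<kappa> f)"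
proof -
  obtain B where B: "0 \<le> B" "\<And>z. \<bar>\<kappa> z\<bar> \<le> B" using kernel_bounded[OF \<kappa>] by auto
  have "(\<lambda>n. moll \<kappa> f (X n)) \<longlonglongrightarrow> moll \<kappa> f x" if X: "X \<longlonglongrightarrow> x" for X x
    unfolding moll_def
  proof (rule integral_dominated_convergence[where w="\<lambda>y. B * \<bar>f y\<bar>"])
    show "integrable lborel (\<lambda>y. B * \<bar>f y\<bar>)" using f by simp
    show "(\<lambda>y. \<kappa> (x - y) * f y) \<in> borel_measurable lborel"
      using moll_integrable[OF \<kappa> f] by (rule borel_measurable_integrable)
    show "(\<lambda>y. \<kappa> (X n - y) * f y) \<in> borel_measurable lborel" for n
      using moll_integrable[OF \<kappa> f] by (rule borel_measurable_integrable)
    have "(\<lambda>n. \<kappa> (X n - y)) \<longlonglongrightarrow> \<kappa> (x - y)" for y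
      by (rule continuous_on_tendsto_compose[of UNIV \<kappa>])
        (use \<kappa> X in \<open>auto simp: kernel_def intro!: tendsto_intros\<close>)
    then show "AE y in lborel. (\<lambda>n. \<kappa> (X n - y) * f y) \<longlonglongrightarrow> \<kappa> (x - y) * f y"
      by (intro AE_I2 tendsto_intros)
    have "\<bar>\<kappa> (X n - y) * f y\<bar> \<le> B * \<bar>f y\<bar>" for y n
      unfolding abs_mult using B by (intro mult_right_mono) auto
    then show "AE y in lborel. norm (\<kappa> (X n - y) * f y) \<le> B * \<bar>f y\<bar>" for n
      by simp
  qed
  then show ?thesis
    by (auto simp: continuous_on_sequentially comp_def)
qed

text \<open>Differentiation under the integral: by the mean value theorem the difference quotients
  of \<kappa> are bounded by \<open>sup |\<kappa>'|\<close>, so a multiple of \<open>|f|\<close>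
  dominates.\<close>

lemma pd_moll:
  assumes \<kappa>: "kernel r \<kappa>" "kernel r \<kappa>'" "\<And>z. pd i \<kappa> z (\<kappa>' z)" and f: "integrable lborel f"
  shows "pd i (moll \<kappa> f) x (moll \<kappa>' f x)"
proof -
  obtain B where B: "0 \<le> B" "\<And>z. \<bar>\<kappa>' z\<bar> \<le> B" using kernel_bounded[OF \<kappa>(2)] by auto
  let ?e = "axis i (1::real)"
  have bd: "\<bar>\<kappa> (z + h *\<^sub>R ?e) - \<kappa> z\<bar> \<le> B * \<bar>h\<bar>" for z h
  proof (cases "0 < h")
    case True
    then show ?thesis using pd_difference_quotient_bound[OF \<kappa>(3) B(2) True, of z] by simp
  next
    case False
    show ?thesis
    proof (cases "h = 0")
      case False
      with \<open>\<not> 0 < h\<close> have "0 < - h" by simp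
      from pd_difference_quotient_bound[OF \<kappa>(3) B(2) this, of "z + h *\<^sub>R ?e"] show ?thesis
        using \<open>\<not> 0 < h\<close> by (simp add: abs_minus_commute)
    qed simp
  qed
  have "((\<lambda>h. (moll \<kappa> f (x + h *\<^sub>R ?e) - moll \<kappa> f x) / h) \<longlongrightarrow> moll \<kappa>' f x) (at 0)"
    unfolding tendsto_at_iff_sequentially
  proof (intro allI impI)
    fix X :: "nat \<Rightarrow> real" assume X: "\<forall>n. X n \<in> UNIV - {0}" "X \<longlonglongrightarrow> 0"
    have eq: "(moll \<kappa> f (x + h *\<^sub>R ?e) - moll \<kappa> f x) / h =
        (\<integral>y. (\<kappa> (x + h *\<^sub>R ?e - y) - \<kappa> (x - y)) / h * f y \<partial>lborel)" for h
      using moll_integrable[OF \<kappa>(1) f]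
      by (simp add: moll_def left_diff_distrib diff_divide_distrib flip: Bochner_Integration.integral_diff)
        (simp add: moll_def diff_divide_distrib left_diff_distrib)
    have "(\<lambda>n. \<integral>y. (\<kappa> (x + X n *\<^sub>R ?e - y) - \<kappa> (x - y)) / X n * f y \<partial>lborel) \<longlonglongrightarrow> (\<integral>y. \<kappa>' (x - y) * f y \<partial>lborel)"
    proof (rule integral_dominated_convergence[where w="\<lambda>y. B * \<bar>f y\<bar>"])
      show "integrable lborel (\<lambda>y. B * \<bar>f y\<bar>)" using f by simp
      show "(\<lambda>y. \<kappa>' (x - y) * f y) \<in> borel_measurable lborel"
        using moll_integrable[OF \<kappa>(2) f] by (rule borel_measurable_integrable)
      show "(\<lambda>y. (\<kappa> (x + X n *\<^sub>R ?e - y) - \<kappa> (x - y)) / X n * f y) \<in> borel_measurable lborel" for n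
        using kernel_measurable[OF \<kappa>(1)] borel_measurable_integrable[OF f] by measurable
      show "AE y in lborel. (\<lambda>n. (\<kappa> (x + X n *\<^sub>R ?e - y) - \<kappa> (x - y)) / X n * f y) \<longlonglongrightarrow> \<kappa>' (x - y) * f y"
      proof (intro AE_I2 tendsto_mult tendsto_const)
        fix y
        have "((\<lambda>h. (\<kappa> ((x - y) + h *\<^sub>R ?e) - \<kappa> (x - y)) / h) \<longlongrightarrow> \<kappa>' (x - y)) (at 0)"
          using \<kappa>(3)[of "x - y"] by (simp add: pd_def DERIV_def)
        then show "(\<lambda>n. (\<kappa> (x + X n *\<^sub>R ?e - y) - \<kappa> (x - y)) / X n) \<longlonglongrightarrow> \<kappa>' (x - y)"
          using X unfolding tendsto_at_iff_sequentially by (auto simp: comp_def algebra_simps)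
      qed
      show "AE y in lborel. norm ((\<kappa> (x + X n *\<^sub>R ?e - y) - \<kappa> (x - y)) / X n * f y) \<le> B * \<bar>f y\<bar>" for n
      proof (rule AE_I2)
        fix y
        have "X n \<noteq> 0" using X(1) by auto
        moreover have "\<bar>\<kappa> (x + X n *\<^sub>R ?e - y) - \<kappa> (x - y)\<bar> \<le> B * \<bar>X n\<bar>"
          using bd[of "x - y" "X n"] by (simp add: algebra_simps)
        ultimately have "\<bar>(\<kappa> (x + X n *\<^sub>R ?e - y) - \<kappa> (x - y)) / X n\<bar> \<le> B"
          by (simp add: divide_le_eq)
        then show "norm ((\<kappa> (x + X n *\<^sub>R ?e - y) - \<kappa> (x - y)) / X n * f y) \<le> B * \<bar>f y\<bar>"
          unfolding real_norm_def abs_mult by (intro mult_right_mono) auto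
      qed
    qed
    then show "((\<lambda>h. (moll \<kappa> f (x + h *\<^sub>R ?e) - moll \<kappa> f x) / h) \<circ> X) \<longlonglongrightarrow> moll \<kappa>' f x"
      unfolding comp_def eq moll_def[of \<kappa>'] .
  qed
  then show ?thesis by (simp add: pd_def DERIV_def)
qed

lemma mollifier_kernels:
  assumes "mollifier r \<kappa> \<kappa>\<^sub>1 \<kappa>\<^sub>2"
  shows "kernel r \<kappa>" "kernel r \<kappa>\<^sub>1" "kernel r \<kappa>\<^sub>2" "\<And>z. pd 1 \<kappa> z (\<kappa>\<^sub>1 z)" "\<And>z. pd 2 \<kappa> z (\<kappa>\<^sub>2 z)"
    "\<And>z. 0 \<le> \<kappa> z" "\<And>x y. \<kappa> (x - y) = \<kappa> (y - x)"
proof -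
  show "\<kappa> (x - y) = \<kappa> (y - x)" for x y
    using assms by (metis minus_diff_eq mollifier_def)
qed (use assms in \<open>auto simp: mollifier_def kernel_def C1_on_def\<close>)

lemma mollifier_mixed:
  assumes "mollifier r \<kappa> \<kappa>\<^sub>1 \<kappa>\<^sub>2"
  obtains \<kappa>\<^sub>1\<^sub>2 where "kernel r \<kappa>\<^sub>1\<^sub>2" "\<And>z. pd 2 \<kappa>\<^sub>1 z (\<kappa>\<^sub>1\<^sub>2 z)" "\<And>z. pd 1 \<kappa>\<^sub>2 z (\<kappa>\<^sub>1\<^sub>2 z)"
  using assms by (auto simp: mollifier_def kernel_def)

lemma mollifier_integrals:
  assumes "mollifier r \<kappa> \<kappa>\<^sub>1 \<kappa>\<^sub>2"
  shows "integrable lborel (\<lambda>x. \<kappa> (x - y))" "(\<integral>x. \<kappa> (x - y) \<partial>lborel) = 1"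
    "integrable lborel (\<lambda>y. \<kappa> (x - y))" "(\<integral>y. \<kappa> (x - y) \<partial>lborel) = 1"
proof -
  note k = mollifier_kernels[OF assms]
  have i: "integrable lborel \<kappa>"
    by (rule integrable_continuous_compact_support[of _ "cball 0 r"]) (use k(1) in \<open>auto simp: kernel_def\<close>)
  have 1: "(\<integral>x. \<kappa> x \<partial>lborel) = 1" using assms by (simp add: mollifier_def)
  show A: "integrable lborel (\<lambda>x. \<kappa> (x - y))" "(\<integral>x. \<kappa> (x - y) \<partial>lborel) = 1" for y
    using integral_lborel_translate[OF kernel_measurable[OF k(1)], of "- y"] i 1 by simp_all
  show "integrable lborel (\<lambda>y. \<kappa> (x - y))" "(\<integral>y. \<kappa> (x - y) \<partial>lborel) = 1"
    unfolding k(7)[of x] using A by auto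
qed

text \<open>Jensen's inequality, as nonnegativity of a variance.\<close>

lemma moll_square_le:
  assumes \<kappa>: "mollifier r \<kappa> \<kappa>\<^sub>1 \<kappa>\<^sub>2" and f: "L2 lborel f" "integrable lborel f"
  shows "(moll \<kappa> f x)\<^sup>2 \<le> moll \<kappa> (\<lambda>y. (f y)\<^sup>2) x"
proof -
  note k = mollifier_kernels[OF \<kappa>] and mi = mollifier_integrals[OF \<kappa>]
  define m where "m = moll \<kappa> f x"
  note i = moll_integrable[OF k(1) f(2), of x] moll_integrable[OF k(1) L2_integrable_square[OF f(1)], of x]
  have "0 \<le> (\<integral>y. \<kappa> (x - y) * (f y - m)\<^sup>2 \<partial>lborel)"
    using k(6) by (intro Bochner_Integration.integral_nonneg) auto
  also have "\<dots> = (\<integral>y. \<kappa> (x - y) * (f y)\<^sup>2 - 2 * m * (\<kappa> (x - y) * f y) + m\<^sup>2 * \<kappa> (x - y) \<partial>lborel)"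
    by (rule Bochner_Integration.integral_cong) (auto simp: power2_eq_square algebra_simps)
  also have "\<dots> = moll \<kappa> (\<lambda>y. (f y)\<^sup>2) x - 2 * m * m + m\<^sup>2 * 1"
    using i mi(3,4) by (simp add: moll_def m_def)
  finally show ?thesis by (simp add: m_def power2_eq_square)
qed

text \<open>Mollification is an L2 contraction: Jensen's inequality pointwise, then Tonelli and the
  unit mass of \<kappa> in the other variable.\<close>

lemma moll_L2:
  assumes \<kappa>: "mollifier r \<kappa> \<kappa>\<^sub>1 \<kappa>\<^sub>2" and f: "L2 lborel f" "integrable lborel f"
  shows "L2 lborel (moll \<kappa> f)" "(\<integral>x. (moll \<kappa> f x)\<^sup>2 \<partial>lborel) \<le> (\<integral>x. (f x)\<^sup>2 \<partial>lborel)"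
proof -
  note k = mollifier_kernels[OF \<kappa>] and mi = mollifier_integrals[OF \<kappa>]
  have km: "\<kappa> \<in> borel_measurable borel" by (rule kernel_measurable[OF k(1)])
  have fm: "f \<in> borel_measurable borel" using f(1) by (simp add: L2_def)
  have m: "moll \<kappa> f \<in> borel_measurable borel"
    using moll_continuous[OF k(1) f(2)] by (rule borel_measurable_continuous_onI)
  have "(\<integral>\<^sup>+x. ennreal ((moll \<kappa> f x)\<^sup>2) \<partial>lborel) \<le> (\<integral>\<^sup>+x. (\<integral>\<^sup>+y. ennreal (\<kappa> (x - y) * (f y)\<^sup>2) \<partial>lborel) \<partial>lborel)"
  proof (rule nn_integral_mono)
    fix x
    have "ennreal ((moll \<kappa> f x)\<^sup>2) \<le> ennreal (moll \<kappa> (\<lambda>y. (f y)\<^sup>2) x)"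
      using moll_square_le[OF \<kappa> f] by (rule ennreal_leI)
    also have "\<dots> = (\<integral>\<^sup>+y. ennreal (\<kappa> (x - y) * (f y)\<^sup>2) \<partial>lborel)"
      unfolding moll_def
      using moll_integrable[OF k(1) L2_integrable_square[OF f(1)], of x] k(6)
      by (intro nn_integral_eq_integral[symmetric]) auto
    finally show "ennreal ((moll \<kappa> f x)\<^sup>2) \<le> (\<integral>\<^sup>+y. ennreal (\<kappa> (x - y) * (f y)\<^sup>2) \<partial>lborel)" .
  qed
  also have "\<dots> = (\<integral>\<^sup>+y. (\<integral>\<^sup>+x. ennreal (\<kappa> (x - y) * (f y)\<^sup>2) \<partial>lborel) \<partial>lborel)"
    by (rule lborel_pair.Fubini'[symmetric]) (use km fm in measurable)
  also have "\<dots> = (\<integral>\<^sup>+y. ennreal ((f y)\<^sup>2) \<partial>lborel)"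
  proof (rule nn_integral_cong)
    fix y
    have "(\<integral>\<^sup>+x. ennreal (\<kappa> (x - y) * (f y)\<^sup>2) \<partial>lborel) = ennreal (\<integral>x. \<kappa> (x - y) * (f y)\<^sup>2 \<partial>lborel)"
      using mi(1) k(6) by (intro nn_integral_eq_integral) auto
    then show "(\<integral>\<^sup>+x. ennreal (\<kappa> (x - y) * (f y)\<^sup>2) \<partial>lborel) = ennreal ((f y)\<^sup>2)"
      using mi(2) by simp
  qed
  also have "\<dots> = ennreal (\<integral>y. (f y)\<^sup>2 \<partial>lborel)"
    using L2_integrable_square[OF f(1)] by (intro nn_integral_eq_integral) auto
  finally have le: "(\<integral>\<^sup>+x. ennreal ((moll \<kappa> f x)\<^sup>2) \<partial>lborel) \<le> ennreal (\<integral>y. (f y)\<^sup>2 \<partial>lborel)" .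
  have i: "integrable lborel (\<lambda>x. (moll \<kappa> f x)\<^sup>2)"
    using le m by (intro integrableI_bounded) (auto simp: order_le_less_trans[OF le])
  then show "L2 lborel (moll \<kappa> f)" using m by (simp add: L2_def)
  have "ennreal (\<integral>x. (moll \<kappa> f x)\<^sup>2 \<partial>lborel) \<le> ennreal (\<integral>y. (f y)\<^sup>2 \<partial>lborel)"
    using le i by (subst nn_integral_eq_integral[symmetric]) auto
  then show "(\<integral>x. (moll \<kappa> f x)\<^sup>2 \<partial>lborel) \<le> (\<integral>x. (f x)\<^sup>2 \<partial>lborel)"
    by (subst (asm) ennreal_le_iff) auto
qed

section \<open>Approximation by continuous functions and L2 convergence of mollifications\<close>

lemma L2_bounded_support:
  fixes f :: "'a::euclidean_space \<Rightarrow> real"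
  assumes "f \<in> borel_measurable borel" "\<And>x. \<bar>f x\<bar> \<le> B * indicator (cball 0 R) x"
  shows "L2 lborel f" "integrable lborel f"
proof -
  have c: "integrable lborel (\<lambda>x::'a. C * indicator (cball 0 R) x)" for C :: real
    using emeasure_bounded_finite[OF bounded_cball, of 0 R]
    by (intro integrable_mult_right integrable_real_indicator) (auto simp: less_top)
  show "integrable lborel f"
    using assms order_trans[OF abs_ge_zero assms(2)]
    by (intro Bochner_Integration.integrable_bound[OF c[of B]]) auto
  have "(f x)\<^sup>2 \<le> B\<^sup>2 * indicator (cball 0 R) x" for x
    using power_mono[OF assms(2)[of x] abs_ge_zero, of 2] by (auto simp: power_mult_distrib indicator_def split: if_splits)
  then have "integrable lborel (\<lambda>x. (f x)\<^sup>2)"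
    using assms(1) by (intro Bochner_Integration.integrable_bound[OF c[of "B\<^sup>2"]]) auto
  then show "L2 lborel f" using assms(1) by (simp add: L2_def)
qed

lemma clamp_approx_L2:
  assumes f: "L2 M f" and e: "0 < e"
  shows "\<exists>m::nat. (\<integral>x. (f x - max (- real m) (min (real m) (f x)))\<^sup>2 \<partial>M) < e"
proof -
  define h where "h m x = f x - max (- real m) (min (real m) (f x))" for m x
  have fm: "f \<in> borel_measurable M" using f by (simp add: L2_def)
  have "(\<lambda>m. \<integral>x. (h m x)\<^sup>2 \<partial>M) \<longlonglongrightarrow> (\<integral>x. 0 \<partial>M)"
  proof (rule integral_dominated_convergence[where w="\<lambda>x. (f x)\<^sup>2"])
    show "integrable M (\<lambda>x. (f x)\<^sup>2)" using f by (simp add: L2_def)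
    show "(\<lambda>x. (h m x)\<^sup>2) \<in> borel_measurable M" for m
      unfolding h_def using fm by measurable
    show "AE x in M. norm ((h m x)\<^sup>2) \<le> (f x)\<^sup>2" for m
    proof (rule AE_I2)
      fix x
      have "\<bar>h m x\<bar> \<le> \<bar>f x\<bar>" by (auto simp: h_def max_def min_def abs_if)
      then show "norm ((h m x)\<^sup>2) \<le> (f x)\<^sup>2" by (simp add: abs_le_square_iff)
    qed
    show "AE x in M. (\<lambda>m. (h m x)\<^sup>2) \<longlonglongrightarrow> 0"
    proof (rule AE_I2)
      fix x
      obtain N :: nat where "\<bar>f x\<bar> \<le> real N" using real_arch_simple by blast
      then have "(h m x)\<^sup>2 = 0" if "N \<le> m" for m
        using that by (auto simp: h_def max_def min_def abs_if split: if_splits)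
      then show "(\<lambda>m. (h m x)\<^sup>2) \<longlonglongrightarrow> 0"
        by (intro tendsto_eventually) (auto simp: eventually_sequentially)
    qed
  qed simp
  then have "\<forall>\<^sub>F m in sequentially. (\<integral>x. (h m x)\<^sup>2 \<partial>M) < e"
    using e by (auto dest: order_tendstoD(2))
  then show ?thesis unfolding h_def by (auto simp: eventually_sequentially)
qed

text \<open>After truncation at level \<open>m\<close>, continuous functions converging almost
  everywhere and clamped at the same level converge dominatedly on the ball. The indicator replaces
  a continuous cutoff; it does no harm where only points inside the ball matter.\<close>

lemma continuous_dense_L2:
  fixes f :: "real^2 \<Rightarrow> real"
  assumes f: "L2 lborel f" and z: "\<And>x. x \<notin> cball 0 R \<Longrightarrow> f x = 0" and e: "0 < e"
  shows "\<exists>g m. continuous_on UNIV g \<and> (\<forall>x. \<bar>g x\<bar> \<le> m) \<and> (\<integral>x. (f x - indicator (cball 0 R) x * g x)\<^sup>2 \<partial>lborel) < e"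
proof -
  obtain m :: nat where m: "(\<integral>x. (f x - max (- real m) (min (real m) (f x)))\<^sup>2 \<partial>lborel) < e / 4"
    using clamp_approx_L2[OF f, of "e / 4"] e by auto
  define c where "c y = max (- real m) (min (real m) y)" for y
  have cc: "continuous_on UNIV c" unfolding c_def[abs_def] by (intro continuous_intros)
  have cb: "\<bar>c y\<bar> \<le> real m" for y by (auto simp: c_def)
  have fm: "f \<in> borel_measurable borel" using f by (simp add: L2_def)
  have cfm: "(\<lambda>x. c (f x)) \<in> borel_measurable borel"
    using measurable_compose[OF fm borel_measurable_continuous_onI[OF cc]] .
  have "f measurable_on UNIV"
    using fm by (intro lebesgue_measurable_imp_measurable_on_real measurable_completion) auto
  then obtain N g where N: "negligible N" and gc: "\<And>n. continuous_on UNIV (g n)"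
    and gl: "\<And>x. x \<notin> N \<Longrightarrow> (\<lambda>n. g n x) \<longlonglongrightarrow> f x"
    unfolding measurable_on_def by auto
  have cgc: "continuous_on UNIV (\<lambda>x. c (g n x))" for n
    using continuous_on_compose2[OF cc gc] by auto
  have aeN: "AE x in lborel. x \<notin> N"
  proof -
    have "N \<in> null_sets lebesgue" using N by (simp add: negligible_iff_null_sets)
    then have "AE x in lebesgue. x \<notin> N" by (rule AE_not_in)
    then show ?thesis by (simp add: AE_completion_iff)
  qed
  have im: "(\<lambda>x::real^2. indicator (cball 0 R) x :: real) \<in> borel_measurable borel"
    by (intro borel_measurable_indicator borel_closed) auto
  have "(\<lambda>n. \<integral>x. (c (f x) - indicator (cball 0 R) x * c (g n x))\<^sup>2 \<partial>lborel) \<longlonglongrightarrow> (\<integral>x. 0 \<partial>(lborel :: (real^2) measure))"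
  proof (rule integral_dominated_convergence[where w="\<lambda>x. (2 * real m)\<^sup>2 * indicator (cball 0 R) x"])
    show "integrable lborel (\<lambda>x::real^2. (2 * real m)\<^sup>2 * indicator (cball 0 R) x)"
      using emeasure_bounded_finite[OF bounded_cball, of 0 R]
      by (intro integrable_mult_right integrable_real_indicator) (auto simp: less_top)
    show "(\<lambda>x. (c (f x) - indicator (cball 0 R) x * c (g n x))\<^sup>2) \<in> borel_measurable lborel" for n
      using cfm im borel_measurable_continuous_onI[OF cgc[of n]]
      by (intro borel_measurable_power borel_measurable_diff borel_measurable_times) auto
    have c0: "c 0 = 0" by (simp add: c_def)
    show "AE x in lborel. norm ((c (f x) - indicator (cball 0 R) x * c (g n x))\<^sup>2) \<le> (2 * real m)\<^sup>2 * indicator (cball 0 R) x" for n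
    proof (rule AE_I2)
      fix x
      have "\<bar>c (f x) - c (g n x)\<bar> \<le> 2 * real m" using cb[of "f x"] cb[of "g n x"] by linarith
      then have "(c (f x) - c (g n x))\<^sup>2 \<le> (2 * real m)\<^sup>2" by (metis abs_ge_zero power2_abs power_mono)
      then show "norm ((c (f x) - indicator (cball 0 R) x * c (g n x))\<^sup>2) \<le> (2 * real m)\<^sup>2 * indicator (cball 0 R) x"
        using z[of x] c0 by (cases "x \<in> cball 0 R") auto
    qed
    show "AE x in lborel. (\<lambda>n. (c (f x) - indicator (cball 0 R) x * c (g n x))\<^sup>2) \<longlonglongrightarrow> 0"
      using aeN
    proof eventually_elim
      fix x assume "x \<notin> N"
      then have "(\<lambda>n. c (g n x)) \<longlonglongrightarrow> c (f x)"
        using continuous_on_tendsto_compose[OF cc gl] by auto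
      then have "(\<lambda>n. (c (f x) - indicator (cball 0 R) x * c (g n x))\<^sup>2) \<longlonglongrightarrow> (c (f x) - indicator (cball 0 R) x * c (f x))\<^sup>2"
        by (intro tendsto_intros)
      moreover have "c (f x) - indicator (cball 0 R) x * c (f x) = 0"
        using z[of x] c0 by (cases "x \<in> cball 0 R") auto
      ultimately show "(\<lambda>n. (c (f x) - indicator (cball 0 R) x * c (g n x))\<^sup>2) \<longlonglongrightarrow> 0" by simp
    qed
  qed simp
  then have "\<forall>\<^sub>F n in sequentially. (\<integral>x. (c (f x) - indicator (cball 0 R) x * c (g n x))\<^sup>2 \<partial>lborel) < e / 4"
    by (rule order_tendstoD(2)) (use e in simp)
  then obtain n where n: "(\<integral>x. (c (f x) - indicator (cball 0 R) x * c (g n x))\<^sup>2 \<partial>lborel) < e / 4"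
    by (auto simp: eventually_sequentially)
  have c0: "c 0 = 0" by (simp add: c_def)
  have cf: "L2 lborel (\<lambda>x. c (f x))"
    by (rule L2_bounded_support[where B="real m" and R=R, OF cfm])
      (use cb c0 z in \<open>auto simp: indicator_def\<close>)
  have cg: "L2 lborel (\<lambda>x. indicator (cball 0 R) x * c (g n x))"
    by (rule L2_bounded_support[where B="real m" and R=R])
      (use cb im borel_measurable_continuous_onI[OF cgc[of n]] in \<open>auto simp: indicator_def intro!: borel_measurable_times\<close>)
  have "(\<integral>x. (f x - indicator (cball 0 R) x * c (g n x))\<^sup>2 \<partial>lborel) < e"
    using integral_square_add_le[OF L2_diff[OF f cf] L2_diff[OF cf cg]] m n by (simp add: c_def)
  then show ?thesis using cgc cb by blast
qed

text \<open>Split \<open>f\<close> into a function continuous on the ball of radius 4 and a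
  remainder small in L2. The contraction property handles the remainder, uniform continuity the
  rest: points within distance 1 of the unit ball never reach the jump at radius 4.\<close>

lemma moll_tendsto:
  assumes \<kappa>: "\<And>n. mollifier (r n) (\<kappa> n) (\<kappa>\<^sub>1 n) (\<kappa>\<^sub>2 n)" and r: "r \<longlonglongrightarrow> 0"
    and f: "L2 lborel f" "integrable lborel f" and z: "\<And>x. x \<notin> cball 0 4 \<Longrightarrow> f x = 0"
    and A: "A \<in> sets borel" "A \<subseteq> ball 0 1"
  shows "L2_tendsto (restrict_space lborel A) (\<lambda>n. moll (\<kappa> n) f) f"
proof -
  have res: "L2 (restrict_space lborel A) w" "(\<integral>x. (w x)\<^sup>2 \<partial>restrict_space lborel A) \<le> (\<integral>x. (w x)\<^sup>2 \<partial>lborel)"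
    if w: "L2 lborel w" for w
  proof -
    have m: "w \<in> borel_measurable borel" using w by (simp add: L2_def)
    have i: "integrable lborel (\<lambda>x. indicator A x *\<^sub>R (w x)\<^sup>2)"
      using A(1) L2_integrable_square[OF w] by (intro integrable_mult_indicator) auto
    then show "L2 (restrict_space lborel A) w"
      using A(1) m by (auto simp: L2_def integrable_restrict_space set_integrable_def intro!: measurable_restrict_space1)
    have "(\<integral>x. (w x)\<^sup>2 \<partial>restrict_space lborel A) = (\<integral>x. indicator A x *\<^sub>R (w x)\<^sup>2 \<partial>lborel)"
      using A(1) by (subst integral_restrict_space) (auto simp: set_lebesgue_integral_def)
    also have "\<dots> \<le> (\<integral>x. (w x)\<^sup>2 \<partial>lborel)"
      using i L2_integrable_square[OF w] by (intro integral_mono) (auto simp: indicator_def)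
    finally show "(\<integral>x. (w x)\<^sup>2 \<partial>restrict_space lborel A) \<le> (\<integral>x. (w x)\<^sup>2 \<partial>lborel)" .
  qed
  let ?M = "restrict_space lborel A"
  define a where "a = measure lborel (ball (0::real^2) 1)"
  have a0: "0 \<le> a" by (simp add: a_def)
  have "(\<lambda>n. \<integral>x. (moll (\<kappa> n) f x - f x)\<^sup>2 \<partial>?M) \<longlonglongrightarrow> 0"
  proof (rule LIMSEQ_I)
    fix e :: real assume e: "0 < e"
    \<comment> \<open>Since \<open>d \<le> 1\<close>, the square of a uniform error \<open>d\<close>
      integrates to at most \<open>d a \<le> e / 8\<close>. The remainder contributes at most
      \<open>e / 4\<close>, and \<open>2 (e / 4 + e / 8) < e\<close>.\<close>
    define d where "d = min 1 (e / (8 * (a + 1)))"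
    have d: "0 < d" "d \<le> 1" using e a0 by (auto simp: d_def)
    have "d * (a + 1) \<le> e / (8 * (a + 1)) * (a + 1)"
      using a0 by (intro mult_right_mono) (auto simp: d_def)
    also have "\<dots> = e / 8" using a0 by (simp add: field_simps)
    finally have da: "d * (a + 1) \<le> e / 8" .
    obtain g m where g: "continuous_on UNIV g" "\<And>x. \<bar>g x\<bar> \<le> m"
      "(\<integral>x. (f x - indicator (cball 0 4) x * g x)\<^sup>2 \<partial>lborel) < e / 16"
      using continuous_dense_L2[OF f(1) z, where R=4 and e="e / 16"] e by auto
    define g' where "g' x = indicator (cball 0 4) x * g x" for x
    have g'm: "g' \<in> borel_measurable borel"
      unfolding g'_def[abs_def] using borel_measurable_continuous_onI[OF g(1)]
      by (intro borel_measurable_times borel_measurable_indicator borel_closed) auto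
    have g'b: "\<bar>g' x\<bar> \<le> m * indicator (cball 0 4) x" for x
      using g(2)[of x] by (auto simp: g'_def indicator_def)
    note g' = L2_bounded_support[OF g'm g'b]
    define h where "h x = f x - g' x" for x
    have h: "L2 lborel h" "integrable lborel h"
      unfolding h_def[abs_def] using f g' by (auto intro: L2_diff)
    have hI: "(\<integral>x. (h x)\<^sup>2 \<partial>lborel) < e / 16" using g(3) by (simp add: h_def g'_def)
    have "uniformly_continuous_on (cball 0 4) g"
      by (rule compact_uniformly_continuous[OF continuous_on_subset[OF g(1)]]) auto
    then obtain \<delta> where \<delta>: "0 < \<delta>" "\<And>x y. x \<in> cball 0 4 \<Longrightarrow> y \<in> cball 0 4 \<Longrightarrow> dist y x < \<delta> \<Longrightarrow> \<bar>g y - g x\<bar> < d"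
      using d(1) unfolding uniformly_continuous_on_def dist_real_def by meson
    obtain n0 where n0: "\<And>n. n0 \<le> n \<Longrightarrow> \<bar>r n\<bar> < min \<delta> 1"
      using LIMSEQ_D[OF r, of "min \<delta> 1"] \<delta>(1) by auto
    show "\<exists>no. \<forall>n\<ge>no. norm ((\<integral>x. (moll (\<kappa> n) f x - f x)\<^sup>2 \<partial>?M) - 0) < e"
    proof (intro exI allI impI)
      fix n assume n: "n0 \<le> n"
      note k = mollifier_kernels[OF \<kappa>[of n]] and mi = mollifier_integrals[OF \<kappa>[of n]]
      have near: "\<bar>moll (\<kappa> n) g' x - g' x\<bar> \<le> d" if x: "x \<in> ball 0 1" for x
      proof -
        have "moll (\<kappa> n) g' x - g' x = (\<integral>y. \<kappa> n (x - y) * g' y - \<kappa> n (x - y) * g' x \<partial>lborel)"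
          using moll_integrable[OF k(1) g'(2), of x] mi(3,4)[of x] by (simp add: moll_def)
        also have "\<bar>\<dots>\<bar> \<le> (\<integral>y. \<kappa> n (x - y) * d \<partial>lborel)"
        proof (rule order_trans[OF integral_abs_bound integral_mono])
          show "integrable lborel (\<lambda>y. \<bar>\<kappa> n (x - y) * g' y - \<kappa> n (x - y) * g' x\<bar>)"
            using moll_integrable[OF k(1) g'(2), of x] mi(3)[of x] by simp
          show "integrable lborel (\<lambda>y. \<kappa> n (x - y) * d)" using mi(3)[of x] by simp
          fix y
          show "\<bar>\<kappa> n (x - y) * g' y - \<kappa> n (x - y) * g' x\<bar> \<le> \<kappa> n (x - y) * d"
          proof (cases "r n \<le> norm (x - y)")
            case True
            then have "\<kappa> n (x - y) = 0" using k(1) by (auto simp: kernel_def)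
            then show ?thesis by simp
          next
            case False
            then have 1: "dist y x < \<delta>" "dist y x < 1"
              using n0[OF n] by (auto simp: dist_norm norm_minus_commute)
            have xy: "x \<in> cball 0 4" "y \<in> cball 0 4"
              using x 1(2) norm_triangle_ineq[of "y - x" x] by (auto simp: dist_norm)
            then have "\<bar>g' y - g' x\<bar> \<le> d" using \<delta>(2)[OF xy 1(1)] by (simp add: g'_def)
            then have "\<kappa> n (x - y) * \<bar>g' y - g' x\<bar> \<le> \<kappa> n (x - y) * d"
              using k(6) by (intro mult_left_mono) auto
            then show ?thesis
              using k(6)[of "x - y"] by (simp add: right_diff_distrib[symmetric] abs_mult)
          qed
        qed
        also have "\<dots> = d" using mi(4)[of x] by simp
        finally show ?thesis .
      qed
      note mh = moll_L2[OF \<kappa>[of n] h]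
      define u w where "u x = moll (\<kappa> n) h x - h x" and "w x = moll (\<kappa> n) g' x - g' x" for x
      have uL: "L2 lborel u" unfolding u_def[abs_def] by (intro L2_diff mh h)
      have wL: "L2 lborel w" unfolding w_def[abs_def] by (intro L2_diff moll_L2[OF \<kappa>] g')
      have fe: "moll (\<kappa> n) f x - f x = u x + w x" for x
        using moll_diff[OF k(1) f(2) g'(2), of x] by (simp add: u_def w_def h_def[abs_def])
      have mhn: "L2 lborel (\<lambda>x. - h x)" using L2_cmult[OF h(1), of "-1"] by simp
      have "(\<integral>x. (u x)\<^sup>2 \<partial>?M) \<le> (\<integral>x. (u x)\<^sup>2 \<partial>lborel)" by (rule res(2)[OF uL])
      also have "\<dots> \<le> 4 * (\<integral>x. (h x)\<^sup>2 \<partial>lborel)"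
        using integral_square_add_le[OF mh(1) mhn] mh(2) by (simp add: u_def)
      finally have U: "(\<integral>x. (u x)\<^sup>2 \<partial>?M) \<le> e / 4" using hI by simp
      have W: "(\<integral>x. (w x)\<^sup>2 \<partial>?M) \<le> e / 8"
      proof -
        have "(\<integral>x. (w x)\<^sup>2 \<partial>?M) = (\<integral>x. indicator A x *\<^sub>R (w x)\<^sup>2 \<partial>lborel)"
          using A(1) by (subst integral_restrict_space) (auto simp: set_lebesgue_integral_def)
        also have "\<dots> \<le> (\<integral>x. d * indicator (ball (0::real^2) 1) x \<partial>lborel)"
        proof (rule integral_mono)
          show "integrable lborel (\<lambda>x. indicator A x *\<^sub>R (w x)\<^sup>2)"
            using A(1) L2_integrable_square[OF wL] by (intro integrable_mult_indicator) auto
          show "integrable lborel (\<lambda>x::real^2. d * indicator (ball 0 1) x)"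
            using emeasure_bounded_finite[OF bounded_ball, of 0 1]
            by (intro integrable_mult_right integrable_real_indicator) (auto simp: less_top)
          fix x
          have "(w x)\<^sup>2 \<le> d" if "x \<in> ball 0 1"
          proof -
            have "(w x)\<^sup>2 \<le> d\<^sup>2"
              using near[OF that] by (metis abs_ge_zero power2_abs power_mono w_def)
            also have "\<dots> \<le> d" using d by (simp add: power2_eq_square mult_left_le)
            finally show ?thesis .
          qed
          then show "indicator A x *\<^sub>R (w x)\<^sup>2 \<le> d * indicator (ball 0 1) x"
            using A(2) d(1) by (auto simp: indicator_def)
        qed
        also have "\<dots> = d * a" by (simp add: a_def)
        also have "\<dots> \<le> e / 8" using d da by (simp add: algebra_simps)
        finally show ?thesis .
      qed
      have "(\<integral>x. (moll (\<kappa> n) f x - f x)\<^sup>2 \<partial>?M) < e"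
        unfolding fe using integral_square_add_le[OF res(1)[OF uL] res(1)[OF wL]] U W e by linarith
      then show "norm ((\<integral>x. (moll (\<kappa> n) f x - f x)\<^sup>2 \<partial>?M) - 0) < e" by simp
    qed
  qed
  then show ?thesis
    unfolding L2_tendsto_def using res(1)[OF f(1)] res(1)[OF moll_L2(1)[OF \<kappa> f]] by blast
qed

section \<open>From weak to polar derivatives\<close>

text \<open>Weak derivatives are Lebesgue measurable, fixed up to null sets and given on the open
  disc only, while mollification integrates over the plane with respect to \<open>lborel\<close>.
  Hence a Borel representative on a smaller closed disc, extended by zero.\<close>

definition borel_rep :: "real \<Rightarrow> (real^2 \<Rightarrow> real) \<Rightarrow> (real^2 \<Rightarrow> real) \<Rightarrow> bool" where
  "borel_rep \<rho> f F \<longleftrightarrow> L2 lborel F \<and> integrable lborel F \<and> (\<forall>x. x \<notin> cball 0 \<rho> \<longrightarrow> F x = 0) \<and>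
     (AE x in lebesgue. x \<in> cball 0 \<rho> \<longrightarrow> F x = f x)"

lemma borel_rep_exists:
  assumes f: "Lq_loc 2 (ball 0 1) f" and \<rho>: "\<rho> < 1"
  shows "\<exists>F. borel_rep \<rho> f F"
proof -
  let ?K = "cball (0::real^2) \<rho>"
  have K: "?K \<in> sets lebesgue" "?K \<in> sets borel" by auto
  have "compact ?K" "?K \<subseteq> ball 0 1" using \<rho> by auto
  then have m: "f \<in> borel_measurable (lebesgue_on ?K)" and i: "integrable (lebesgue_on ?K) (\<lambda>x. \<bar>f x\<bar> powr 2)"
    using f by (auto simp: Lq_loc_def)
  define h where "h x = indicator ?K x * f x" for x
  have hm: "h \<in> borel_measurable lebesgue"
    using m K(1) by (simp add: borel_measurable_restrict_space_iff h_def[abs_def] mult.commute)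
  then obtain h' where h': "h' \<in> borel_measurable lborel" "AE x in lborel. h x = h' x"
    using completion_ex_borel_measurable_real[of h lborel] by auto
  have ae: "AE x in lebesgue. h x = h' x" using h'(2) by (rule AE_completion)
  define F where "F x = indicator ?K x * h' x" for x
  have Fm: "F \<in> borel_measurable borel"
    unfolding F_def[abs_def] using h'(1) K(2) by (intro borel_measurable_times borel_measurable_indicator) auto
  have aeF: "AE x in lebesgue. x \<in> ?K \<longrightarrow> F x = f x"
    using ae by eventually_elim (auto simp: F_def h_def)
  have "integrable lebesgue (\<lambda>x. indicator ?K x *\<^sub>R (\<bar>f x\<bar> powr 2))"
    using i K(1) by (simp add: integrable_restrict_space set_integrable_def)
  then have "integrable lebesgue (\<lambda>x. (F x)\<^sup>2)"
  proof (rule Bochner_Integration.integrable_bound)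
    show "(\<lambda>x. (F x)\<^sup>2) \<in> borel_measurable lebesgue" using Fm by (auto intro: measurable_completion)
    show "AE x in lebesgue. norm ((F x)\<^sup>2) \<le> norm (indicator ?K x *\<^sub>R (\<bar>f x\<bar> powr 2))"
      using aeF by eventually_elim (auto simp: F_def indicator_def)
  qed
  then have F2: "integrable lborel (\<lambda>x. (F x)\<^sup>2)"
    using Fm by (simp add: integrable_completion)
  have L: "L2 lborel F" using Fm F2 by (simp add: L2_def)
  have "L2 lborel (indicator ?K)"
    by (rule L2_bounded_support[where B=1 and R=\<rho>]) (auto simp: indicator_def intro!: borel_measurable_indicator)
  from L2_integrable_mult[OF this L] have "integrable lborel (\<lambda>x. indicator ?K x * F x)" .
  moreover have "(\<lambda>x. indicator ?K x * F x) = F" by (auto simp: F_def indicator_def)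
  ultimately have "integrable lborel F" by simp
  then have "borel_rep \<rho> f F" using L aeF by (auto simp: borel_rep_def F_def)
  then show ?thesis by blast
qed

lemma pd_reflect:
  assumes "\<And>z. pd i f z (f' z)"
  shows "pd i (\<lambda>y. f (x - y)) y (- f' (x - y))"
proof -
  have "((\<lambda>s. f ((x - y) + s *\<^sub>R axis i 1)) has_real_derivative f' (x - y)) (at (- 0))"
    using assms[of "x - y"] by (simp add: pd_def)
  then have "((\<lambda>t. f ((x - y) + (- t) *\<^sub>R axis i 1)) has_real_derivative f' (x - y) * - 1) (at 0)"
    by (rule DERIV_chain2[where f="\<lambda>s. f ((x - y) + s *\<^sub>R axis i 1)" and g=uminus])
      (auto intro!: derivative_eq_intros)
  then show ?thesis by (simp add: pd_def algebra_simps)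
qed

text \<open>The weak derivative is tested with \<open>y \<mapsto> \<kappa> (x - y)\<close>, whose
  partial derivative is \<open>- \<kappa>' (x - y)\<close>. The condition
  \<open>norm x + r < \<rho>\<close> keeps its support where \<open>F\<close> and \<open>G\<close>
  represent \<open>f\<close> and \<open>g\<close>.\<close>

lemma moll_weak_partial:
  assumes \<kappa>: "kernel r \<kappa>" "kernel r \<kappa>'" "\<And>z. pd i \<kappa> z (\<kappa>' z)" "\<And>k x. C_class k UNIV (\<lambda>y. \<kappa> (x - y))"
    and w: "has_weak_partial (ball 0 1) i f g" and F: "borel_rep \<rho> f F" and G: "borel_rep \<rho> g G"
    and x: "norm x + r < \<rho>" and \<rho>: "\<rho> < 1"
  shows "moll \<kappa>' F x = moll \<kappa> G x"
proof -
  define \<phi> where "\<phi> y = \<kappa> (x - y)" for y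
  have C: "C_class k UNIV \<phi>" for k unfolding \<phi>_def[abs_def] by (rule \<kappa>(4))
  have \<phi>': "partial i \<phi> y = - \<kappa>' (x - y)" for y
  proof (rule partial_eq_pd)
    show "\<phi> differentiable (at y)" using C[of 1] by simp
    show "pd i \<phi> y (- \<kappa>' (x - y))" unfolding \<phi>_def[abs_def] by (rule pd_reflect[OF \<kappa>(3)])
  qed
  have out: "\<phi> y = 0" "\<kappa>' (x - y) = 0" if "y \<notin> cball x r" for y
    using that \<kappa>(1,2) by (auto simp: \<phi>_def kernel_def dist_norm)
  have sub: "cball x r \<subseteq> cball 0 \<rho>" "cball 0 \<rho> \<subseteq> ball 0 1"
  proof -
    show "cball x r \<subseteq> cball 0 \<rho>"
    proof
      fix y assume "y \<in> cball x r"
      then have "norm (y - x) \<le> r" by (simp add: dist_norm norm_minus_commute)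
      then show "y \<in> cball 0 \<rho>" using x norm_triangle_sub[of y x] by simp
    qed
  qed (use \<rho> in auto)
  have cl: "closure {y. \<phi> y \<noteq> 0} \<subseteq> cball x r"
    using out(1) by (intro closure_minimal) (blast, simp)
  have "\<phi> \<in> test_functions (ball 0 1)"
    unfolding test_functions_def
  proof (intro CollectI conjI allI C)
    show "compact (closure {y. \<phi> y \<noteq> 0})"
      using cl by (metis bounded_cball bounded_subset closed_closure compact_eq_bounded_closed)
    show "closure {y. \<phi> y \<noteq> 0} \<subseteq> ball 0 1" using cl sub by blast
  qed
  then have eq: "(LINT y:ball 0 1|lebesgue. f y * partial i \<phi> y) = - (LINT y:ball 0 1|lebesgue. g y * \<phi> y)"
    using w by (simp add: has_weak_partial_def)
  have conv: "(LINT y:ball 0 1|lebesgue. h y * \<psi> y) = (\<integral>y. H y * \<psi> y \<partial>lborel)"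
    if H: "borel_rep \<rho> h H" and \<psi>: "\<psi> \<in> borel_measurable borel" "\<And>y. y \<notin> cball x r \<Longrightarrow> \<psi> y = 0" for h H \<psi>
  proof -
    have Hm: "H \<in> borel_measurable borel" using H by (simp add: borel_rep_def L2_def)
    have ae: "AE y in lebesgue. y \<in> cball 0 \<rho> \<longrightarrow> H y = h y" using H by (simp add: borel_rep_def)
    have e: "indicator (ball 0 1) y *\<^sub>R (h y * \<psi> y) = H y * \<psi> y" if "y \<in> cball 0 \<rho> \<longrightarrow> H y = h y" for y
    proof (cases "y \<in> cball x r")
      case True
      then have "y \<in> cball 0 \<rho>" "y \<in> ball 0 1" using sub by blast+
      then show ?thesis using that by simp
    qed (simp add: \<psi>(2))
    have bm: "(\<lambda>y. H y * \<psi> y) \<in> borel_measurable lborel" using Hm \<psi>(1) by simp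
    have "(LINT y:ball 0 1|lebesgue. h y * \<psi> y) = (\<integral>y. H y * \<psi> y \<partial>lebesgue)"
      unfolding set_lebesgue_integral_def
    proof (rule integral_cong_AE)
      show ae2: "AE y in lebesgue. indicator (ball 0 1) y *\<^sub>R (h y * \<psi> y) = H y * \<psi> y"
        using ae by eventually_elim (rule e)
      show "(\<lambda>y. H y * \<psi> y) \<in> borel_measurable lebesgue" by (rule measurable_completion[OF bm])
      moreover have "AE y in lebesgue. H y * \<psi> y = indicator (ball 0 1) y *\<^sub>R (h y * \<psi> y)"
        using ae by eventually_elim (rule e[symmetric])
      ultimately show "(\<lambda>y. indicator (ball 0 1) y *\<^sub>R (h y * \<psi> y)) \<in> borel_measurable lebesgue"
        by (rule borel_measurable_AE)
    qed
    also have "\<dots> = (\<integral>y. H y * \<psi> y \<partial>lborel)" using bm by (rule integral_completion)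
    finally show ?thesis .
  qed
  have km: "(\<lambda>y. \<kappa>' (x - y)) \<in> borel_measurable borel" "\<phi> \<in> borel_measurable borel"
    unfolding \<phi>_def[abs_def] using kernel_measurable[OF \<kappa>(1)] kernel_measurable[OF \<kappa>(2)] by measurable
  have "(\<integral>y. F y * - \<kappa>' (x - y) \<partial>lborel) = - (\<integral>y. G y * \<phi> y \<partial>lborel)"
    using eq conv[OF F, of "\<lambda>y. - \<kappa>' (x - y)"] conv[OF G km(2) out(1)] km(1) out(2) by (simp add: \<phi>')
  then show ?thesis by (simp add: moll_def \<phi>_def mult.commute)
qed

lemma (in annulus) An_bounds: "x \<in> An \<Longrightarrow> \<bar>x$i\<bar> \<le> 1"
  using component_le_norm_cart[of x i] b_le_1 by (auto simp: An_def)

lemma (in annulus) polar_H1_of_moll: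
  assumes u: "\<And>n. continuous_on An (u n)" "\<And>n. continuous_on An (u1 n)" "\<And>n. continuous_on An (u2 n)"
    and pd: "\<And>n x. x \<in> An \<Longrightarrow> pd 1 (u n) x (u1 n x) \<and> pd 2 (u n) x (u2 n x)"
    and l: "L2_tendsto MA u U" "L2_tendsto MA u1 U1" "L2_tendsto MA u2 U2"
  shows "polar_H1 An U (\<lambda>x. x$1 * U1 x + x$2 * U2 x) (\<lambda>x. x$1 * U2 x + - x$2 * U1 x)"
proof (rule polar_H1I)
  have C: "C1_on An (u n) (u1 n) (u2 n)" for n
    using u pd by (auto simp: C1_on_def)
  show "polar_C1 An (u n) (\<lambda>x. x$1 * u1 n x + x$2 * u2 n x) (\<lambda>x. x$1 * u2 n x + - x$2 * u1 n x)" for n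
    unfolding polar_C1_def
  proof (intro exI conjI ballI)
    show "C1_on An (u n) (u1 n) (u2 n)" by (rule C)
  qed auto
  have m: "(\<lambda>x. x$i) \<in> borel_measurable MA" "(\<lambda>x. - x$i) \<in> borel_measurable MA" for i
    by (intro measurable_MA continuous_intros)+
  have b: "x \<in> space MA \<Longrightarrow> \<bar>x$i\<bar> \<le> 1" "x \<in> space MA \<Longrightarrow> \<bar>- x$i\<bar> \<le> 1" for x i
    using An_bounds by (auto simp: space_MA)
  show "L2_tendsto (restrict_space lborel An) u U" using l(1) by (simp add: MA_def)
  show "L2_tendsto (restrict_space lborel An) (\<lambda>n x. x$1 * u1 n x + x$2 * u2 n x) (\<lambda>x. x$1 * U1 x + x$2 * U2 x)"
    using L2_tendsto_add[OF L2_tendsto_bounded_mult[OF l(2) m(1) b(1)] L2_tendsto_bounded_mult[OF l(3) m(1) b(1)]]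
    by (simp add: MA_def)
  show "L2_tendsto (restrict_space lborel An) (\<lambda>n x. x$1 * u2 n x + - x$2 * u1 n x) (\<lambda>x. x$1 * U2 x + - x$2 * U1 x)"
    using L2_tendsto_add[OF L2_tendsto_bounded_mult[OF l(3) m(1) b(1)] L2_tendsto_bounded_mult[OF l(2) m(2) b(2)]]
    by (simp add: MA_def)
qed

text \<open>One function \<open>V12\<close> represents both mixed second derivatives. This is what
  later makes the angular derivative of W_s and the derivative of W_\<theta> in ln r the same
  function.\<close>

lemma (in annulus) polar_H1_of_W2_loc:
  assumes v: "W2_loc 2 (ball 0 1) v" and b: "b < 1"
  shows "\<exists>V V1 V2 V11 V12 V22.
    polar_H1 An V (\<lambda>x. x$1 * V1 x + x$2 * V2 x) (\<lambda>x. x$1 * V2 x + - x$2 * V1 x) \<and>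
    polar_H1 An V1 (\<lambda>x. x$1 * V11 x + x$2 * V12 x) (\<lambda>x. x$1 * V12 x + - x$2 * V11 x) \<and>
    polar_H1 An V2 (\<lambda>x. x$1 * V12 x + x$2 * V22 x) (\<lambda>x. x$1 * V22 x + - x$2 * V12 x) \<and>
    (AE x in lebesgue. x \<in> An \<longrightarrow> V x = v x \<and> V1 x = weak_partial (ball 0 1) 1 v x \<and> V2 x = weak_partial (ball 0 1) 2 v x \<and>
      V11 x = weak_partial (ball 0 1) 1 (weak_partial (ball 0 1) 1 v) x \<and>
      V12 x = weak_partial (ball 0 1) 2 (weak_partial (ball 0 1) 1 v) x \<and>
      V12 x = weak_partial (ball 0 1) 1 (weak_partial (ball 0 1) 2 v) x \<and>
      V22 x = weak_partial (ball 0 1) 2 (weak_partial (ball 0 1) 2 v) x) \<and>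
    V \<in> borel_measurable borel \<and> V1 \<in> borel_measurable borel \<and> V2 \<in> borel_measurable borel \<and>
    V11 \<in> borel_measurable borel \<and> V12 \<in> borel_measurable borel \<and> V22 \<in> borel_measurable borel"
proof -
  let ?B = "ball (0::real^2) 1"
  define w where "w i = weak_partial ?B i v" for i
  define ww where "ww i j = weak_partial ?B j (w i)" for i j
  define \<rho> where "\<rho> = (1 + b) / 2"
  have \<rho>: "b < \<rho>" "\<rho> < 1" using b by (auto simp: \<rho>_def)
  have W: "Lq_loc 2 ?B v" "\<And>i. \<exists>g. has_weak_partial ?B i v g" "\<And>i. Lq_loc 2 ?B (w i)"
    "\<And>i j. \<exists>g. has_weak_partial ?B j (w i) g" "\<And>i j. Lq_loc 2 ?B (ww i j)"
    using v by (auto simp: numeral_2_eq_2 w_def ww_def)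
  have wp: "has_weak_partial ?B i v (w i)" for i
    unfolding w_def weak_partial_def using W(2) by (rule someI_ex)
  have wwp: "has_weak_partial ?B j (w i) (ww i j)" for i j
    using someI_ex[OF W(4)[of j i]] unfolding ww_def weak_partial_def .
  obtain V where V: "borel_rep \<rho> v V" using borel_rep_exists[OF W(1) \<rho>(2)] by auto
  have "\<forall>i. \<exists>F. borel_rep \<rho> (w i) F" using borel_rep_exists[OF W(3) \<rho>(2)] by auto
  then obtain V' where V': "\<And>i. borel_rep \<rho> (w i) (V' i)" by metis
  have "\<forall>i j. \<exists>F. borel_rep \<rho> (ww i j) F" using borel_rep_exists[OF W(5) \<rho>(2)] by auto
  then obtain V'' where V'': "\<And>i j. borel_rep \<rho> (ww i j) (V'' i j)" by metis
  \<comment> \<open>Radii at most \<open>\<rho> - b\<close>, so that the kernel centred at a point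
    of the annulus stays in the disc of radius \<rho>.\<close>
  define r where "r n = (\<rho> - b) * inverse (real (Suc n))" for n
  have r: "0 < r n" "r n \<le> \<rho> - b" for n
    using \<rho>(1) by (auto simp: r_def mult_left_le inverse_le_1_iff)
  have r0: "r \<longlonglongrightarrow> 0"
    using tendsto_mult_left[OF LIMSEQ_inverse_real_of_nat, of "\<rho> - b"] by (simp add: r_def[abs_def])
  have "\<forall>n. \<exists>\<kappa> \<kappa>1 \<kappa>2. mollifier (r n) \<kappa> \<kappa>1 \<kappa>2" using mollifier_exists[OF r(1)] by blast
  then obtain \<kappa> \<kappa>1 \<kappa>2 where \<kappa>: "\<And>n. mollifier (r n) (\<kappa> n) (\<kappa>1 n) (\<kappa>2 n)" by metis
  have inA: "norm x + r n < \<rho>" if "x \<in> An" for x n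
    using that r(2)[of n] by (simp add: An_def)
  have smooth: "C_class k UNIV (\<lambda>y. \<kappa> n (x - y))" for k n x
    using \<kappa>[of n] by (simp add: mollifier_def)
  have smooth': "C_class k UNIV (\<lambda>y. f' (x - y))"
    if f: "\<And>k x. C_class k UNIV (\<lambda>y. f (x - y))" "\<And>z. pd i f z (f' z)" for k x i and f f' :: "real^2 \<Rightarrow> real"
  proof -
    have "partial i (\<lambda>y. f (x - y)) = (\<lambda>y. - f' (x - y))"
      using f(1)[of 1] by (intro ext partial_eq_pd pd_reflect f(2)) auto
    then have "C_class k UNIV (\<lambda>y. - f' (x - y))" using f(1)[of "Suc k" x] by (metis C_class.simps(2))
    then have "C_class k UNIV (\<lambda>y. (- 1) * (- f' (x - y)))" by (intro C_class_mult C_class_const)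
    then show ?thesis by simp
  qed
  note k = mollifier_kernels[OF \<kappa>]
  note mw = moll_weak_partial[OF _ _ _ _ _ _ _ inA \<rho>(2)]
  have m1: "moll (\<kappa>1 n) F x = moll (\<kappa> n) G x" "moll (\<kappa>2 n) F x = moll (\<kappa> n) H x"
    if "has_weak_partial ?B 1 f g" "has_weak_partial ?B 2 f h" "borel_rep \<rho> f F" "borel_rep \<rho> g G" "borel_rep \<rho> h H" "x \<in> An"
    for n f g h F G H x
    using mw[OF k(1) k(2) k(4) smooth that(1,3,4,6)] mw[OF k(1) k(3) k(5) smooth that(2,3,5,6)] by auto
  \<comment> \<open>Both derivatives are moved onto the kernel, where they commute because the
    kernel has one common mixed derivative.\<close>
  have mixed: "moll (\<kappa> n) (V'' 1 2) x = moll (\<kappa> n) (V'' 2 1) x" if x: "x \<in> An" for n x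
  proof -
    obtain \<kappa>12 where \<kappa>12: "kernel (r n) \<kappa>12" "\<And>z. pd 2 (\<kappa>1 n) z (\<kappa>12 z)" "\<And>z. pd 1 (\<kappa>2 n) z (\<kappa>12 z)"
      using mollifier_mixed[OF \<kappa>[of n]] by auto
    have "moll (\<kappa> n) (V'' 1 2) x = moll (\<kappa>2 n) (V' 1) x"
      by (rule mw[OF k(1) k(3) k(5) smooth wwp V' V'' x, symmetric])
    also have "\<dots> = moll \<kappa>12 V x"
      by (rule mw[OF k(3) \<kappa>12(1) \<kappa>12(3) smooth'[OF smooth k(5)] wp V V' x, symmetric])
    also have "\<dots> = moll (\<kappa>1 n) (V' 2) x"
      by (rule mw[OF k(2) \<kappa>12(1) \<kappa>12(2) smooth'[OF smooth k(4)] wp V V' x])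
    also have "\<dots> = moll (\<kappa> n) (V'' 2 1) x"
      by (rule mw[OF k(1) k(2) k(4) smooth wwp V' V'' x])
    finally show ?thesis .
  qed
  have An_sub: "An \<in> sets borel" "An \<subseteq> ball 0 1"
    using open_An b by (auto simp: An_def)
  have lim: "L2_tendsto MA (\<lambda>n. moll (\<kappa> n) F) F" if "borel_rep \<rho> f F" for f F
    unfolding MA_def using that \<rho>(2)
    by (intro moll_tendsto[OF \<kappa> r0 _ _ _ An_sub]) (auto simp: borel_rep_def)
  have cont: "continuous_on An (moll (\<kappa> n) F)" if "borel_rep \<rho> f F" for f F n
    using that by (intro continuous_on_subset[OF moll_continuous[OF k(1)]]) (auto simp: borel_rep_def)
  have H1: "polar_H1 An F (\<lambda>x. x$1 * G x + x$2 * H x) (\<lambda>x. x$1 * H x + - x$2 * G x)"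
    if h: "has_weak_partial ?B 1 f g" "has_weak_partial ?B 2 f h" "borel_rep \<rho> f F" "borel_rep \<rho> g G" "borel_rep \<rho> h H"
    for f g h F G H
  proof (rule polar_H1_of_moll[of "\<lambda>n. moll (\<kappa> n) F" "\<lambda>n. moll (\<kappa> n) G" "\<lambda>n. moll (\<kappa> n) H"])
    fix n x assume x: "x \<in> An"
    have "integrable lborel F" using h(3) by (simp add: borel_rep_def)
    then show "pd 1 (moll (\<kappa> n) F) x (moll (\<kappa> n) G x) \<and> pd 2 (moll (\<kappa> n) F) x (moll (\<kappa> n) H x)"
      using pd_moll[OF k(1) k(2) k(4)] pd_moll[OF k(1) k(3) k(5)] m1[OF h x] by metis
  qed (rule cont lim, rule h)+
  \<comment> \<open>One sequence of mollifications tends to both mixed derivatives in L2, and L2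
    limits are unique almost everywhere.\<close>
  have sym: "AE x in MA. V'' 2 1 x = V'' 1 2 x"
  proof -
    have "L2_tendsto MA (\<lambda>n. moll (\<kappa> n) (V'' 1 2)) (V'' 2 1)"
      unfolding L2_tendsto_def
    proof (intro conjI allI)
      note l1 = lim[OF V''[of 1 2]] and l2 = lim[OF V''[of 2 1]]
      show "L2 MA (moll (\<kappa> n) (V'' 1 2))" for n using l1 by (rule L2_tendstoD)
      show "L2 MA (V'' 2 1)" using l2 by (rule L2_tendstoD)
      have "(\<integral>x. (moll (\<kappa> n) (V'' 1 2) x - V'' 2 1 x)\<^sup>2 \<partial>MA) = (\<integral>x. (moll (\<kappa> n) (V'' 2 1) x - V'' 2 1 x)\<^sup>2 \<partial>MA)" for n
        by (rule Bochner_Integration.integral_cong) (auto simp: space_MA mixed)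
      then show "(\<lambda>n. \<integral>x. (moll (\<kappa> n) (V'' 1 2) x - V'' 2 1 x)\<^sup>2 \<partial>MA) \<longlonglongrightarrow> 0"
        using L2_tendstoD(3)[OF l2] by simp
    qed
    then show ?thesis using lim[OF V''] by (rule L2_tendsto_unique)
  qed
  have meas: "F \<in> borel_measurable borel" "F \<in> borel_measurable MA" if "borel_rep \<rho> f F" for f F
  proof -
    show m: "F \<in> borel_measurable borel" using that by (simp add: borel_rep_def L2_def)
    show "F \<in> borel_measurable MA" unfolding MA_def using m by (intro measurable_restrict_space1) simp
  qed
  have mi: "(\<lambda>x. x$i) \<in> borel_measurable MA" and mi': "(\<lambda>x. - x$i) \<in> borel_measurable MA" for i
    by (intro measurable_MA continuous_intros)+
  have H2: "polar_H1 An (V' 2) (\<lambda>x. x$1 * V'' 1 2 x + x$2 * V'' 2 2 x) (\<lambda>x. x$1 * V'' 2 2 x + - x$2 * V'' 1 2 x)"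
  proof (rule polar_H1_cong_AE[OF H1[OF wwp wwp V' V'' V''], folded MA_def])
    show "V' 2 \<in> borel_measurable MA" by (rule meas(2)[OF V'])
    show "AE x in MA. x$1 * V'' 2 1 x + x$2 * V'' 2 2 x = x$1 * V'' 1 2 x + x$2 * V'' 2 2 x"
      "AE x in MA. x$1 * V'' 2 2 x + - x$2 * V'' 2 1 x = x$1 * V'' 2 2 x + - x$2 * V'' 1 2 x"
      using sym by (eventually_elim, simp)+
    show "(\<lambda>x. x$1 * V'' 1 2 x + x$2 * V'' 2 2 x) \<in> borel_measurable MA"
      "(\<lambda>x. x$1 * V'' 2 2 x + - x$2 * V'' 1 2 x) \<in> borel_measurable MA"
      by (intro borel_measurable_add borel_measurable_times meas(2)[OF V''] mi mi')+
  qed simp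
  have ae_sub: "AE x in lebesgue. x \<in> An \<longrightarrow> F x = f x" if "borel_rep \<rho> f F" for f F
  proof -
    have "AE x in lebesgue. x \<in> cball 0 \<rho> \<longrightarrow> F x = f x" using that by (simp add: borel_rep_def)
    then show ?thesis by eventually_elim (use \<rho> in \<open>auto simp: An_def\<close>)
  qed
  have "AE x in lborel. x \<in> An \<longrightarrow> V'' 2 1 x = V'' 1 2 x"
    using sym open_An unfolding MA_def by (simp add: AE_restrict_space_iff)
  then have sym': "AE x in lebesgue. x \<in> An \<longrightarrow> V'' 2 1 x = V'' 1 2 x" by (rule AE_completion)
  have AE: "AE x in lebesgue. x \<in> An \<longrightarrow> V x = v x \<and> V' 1 x = w 1 x \<and> V' 2 x = w 2 x \<and>
      V'' 1 1 x = ww 1 1 x \<and> V'' 1 2 x = ww 1 2 x \<and> V'' 1 2 x = ww 2 1 x \<and> V'' 2 2 x = ww 2 2 x"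
    using ae_sub[OF V] ae_sub[OF V'[of 1]] ae_sub[OF V'[of 2]] ae_sub[OF V''[of 1 1]] ae_sub[OF V''[of 1 2]]
      ae_sub[OF V''[of 2 1]] ae_sub[OF V''[of 2 2]] sym'
    by eventually_elim auto
  show ?thesis
    using H1[OF wp wp V V' V'] H1[OF wwp wwp V' V'' V''] H2 AE meas(1)[OF V] meas(1)[OF V'] meas(1)[OF V'']
    unfolding w_def ww_def by blast
qed

section \<open>Energy identities\<close>

text \<open>The primitive \<open>w\<^sup>p\<^sup>+\<^sup>1 / (p + 1)\<close> of the nonlinearity is not regular enough at \<open>0\<close> for the chain rule;
  it is approximated by \<open>(w\<^sup>2 + t)\<^bsup>(p+1)/2\<^esup> / (p + 1)\<close>, whose derivative is Lipschitz.\<close>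

lemma square_powr_half:
  fixes w q :: real
  shows "(w\<^sup>2) powr (q / 2) = \<bar>w\<bar> powr q"
proof (cases "w = 0")
  case False
  then have "w\<^sup>2 = \<bar>w\<bar> powr 2" by simp
  then have "(w\<^sup>2) powr (q / 2) = (\<bar>w\<bar> powr 2) powr (q / 2)" by (rule arg_cong)
  then show ?thesis by (simp only: powr_powr) simp
qed simp

text \<open>Bounds uniform in \<open>t\<close>, to dominate as \<open>t\<close> tends to 0. For
  \<open>|w| > 1\<close> the negative power is at most 1; for \<open>|w| \<le> 1\<close> the product
  is at most \<open>|w| powr p\<close>.\<close>

lemma regularized_power_bounds:
  fixes p t w :: real
  assumes p: "0 \<le> p" "p < 1" and t: "0 < t" "t \<le> 1"
  shows "\<bar>w * (w\<^sup>2 + t) powr ((p - 1) / 2)\<bar> \<le> 1 + \<bar>w\<bar>"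
    and "(w\<^sup>2 + t) powr ((p + 1) / 2) \<le> w\<^sup>2 + 1"
proof -
  show "\<bar>w * (w\<^sup>2 + t) powr ((p - 1) / 2)\<bar> \<le> 1 + \<bar>w\<bar>"
  proof (cases "\<bar>w\<bar> \<le> 1")
    case False
    then have "1 \<le> w\<^sup>2" using abs_le_square_iff[of 1 w] by simp
    then have "(w\<^sup>2 + t) powr ((p - 1) / 2) \<le> 1"
      using p t powr_mono2'[of "(p - 1) / 2" 1 "w\<^sup>2 + t"] by simp
    then show ?thesis by (simp add: abs_mult mult_left_le add_increasing)
  next
    case True
    show ?thesis
    proof (cases "w = 0")
      case False
      have "(w\<^sup>2 + t) powr ((p - 1) / 2) \<le> (w\<^sup>2) powr ((p - 1) / 2)"
        using p t False by (intro powr_mono2') auto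
      also have "\<dots> = \<bar>w\<bar> powr (p - 1)" by (rule square_powr_half)
      finally have "\<bar>w\<bar> * (w\<^sup>2 + t) powr ((p - 1) / 2) \<le> \<bar>w\<bar> * \<bar>w\<bar> powr (p - 1)"
        by (intro mult_left_mono) auto
      also have "\<dots> = \<bar>w\<bar> powr p" using False by (simp add: powr_mult_base)
      also have "\<dots> \<le> 1" using p True False powr_mono2[of p "\<bar>w\<bar>" 1] by simp
      finally show ?thesis by (simp add: abs_mult)
    qed simp
  qed
  have "(w\<^sup>2 + t) powr ((p + 1) / 2) \<le> (w\<^sup>2 + 1) powr ((p + 1) / 2)"
    using p t by (intro powr_mono2) auto
  also have "\<dots> \<le> (w\<^sup>2 + 1) powr 1" using p by (intro powr_mono) auto
  finally show "(w\<^sup>2 + t) powr ((p + 1) / 2) \<le> w\<^sup>2 + 1" by (simp add: add_nonneg_eq_0_iff)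
qed

text \<open>The Lipschitz constant may blow up as \<open>t\<close> tends to 0, because the chain
  rule is applied for each fixed \<open>t\<close> before the limit is taken.\<close>

lemma regularized_power_deriv:
  fixes p t :: real
  assumes p: "0 \<le> p" "p < 1" and t: "0 < t"
  shows "((\<lambda>w. (w\<^sup>2 + t) powr ((p + 1) / 2) / (p + 1)) has_real_derivative w * (w\<^sup>2 + t) powr ((p - 1) / 2)) (at w)"
    and "\<bar>y * (y\<^sup>2 + t) powr ((p - 1) / 2) - z * (z\<^sup>2 + t) powr ((p - 1) / 2)\<bar> \<le> 2 * t powr ((p - 1) / 2) * \<bar>y - z\<bar>"
proof -
  have pos: "0 < w\<^sup>2 + t" for w using t by (simp add: add_nonneg_pos)
  have D: "((\<lambda>w. (w\<^sup>2 + t) powr q) has_real_derivative q * (w\<^sup>2 + t) powr (q - 1) * (2 * w)) (at w)" for q w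
  proof -
    have "((\<lambda>w. w\<^sup>2 + t) has_real_derivative 2 * w) (at w)"
      by (auto intro!: derivative_eq_intros)
    from DERIV_fun_powr[OF this pos] show ?thesis by simp
  qed
  have "(p + 1) / 2 - 1 = (p - 1) / 2" by (simp add: field_simps)
  then show "((\<lambda>w. (w\<^sup>2 + t) powr ((p + 1) / 2) / (p + 1)) has_real_derivative w * (w\<^sup>2 + t) powr ((p - 1) / 2)) (at w)"
    using DERIV_cdivide[OF D[of "(p + 1) / 2" w], of "p + 1"] p
    by (auto elim!: DERIV_cong simp: divide_simps)
  \<comment> \<open>The derivative of \<open>w (w\<^sup>2 + t) powr q\<close> is that power times
    \<open>1 + 2 q w\<^sup>2 / (w\<^sup>2 + t)\<close>; with \<open>q \<le> 0\<close> and
    \<open>|2 q| \<le> 1\<close> it is at most \<open>2 t powr q\<close> in absolute value.\<close>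
  define q where "q = (p - 1) / 2"
  have q: "- 1 \<le> 2 * q" "q \<le> 0" using p by (auto simp: q_def)
  have "norm (y * (y\<^sup>2 + t) powr q - z * (z\<^sup>2 + t) powr q) \<le> 2 * t powr q * norm (y - z)"
  proof (rule field_differentiable_bound[where S=UNIV and
      f'="\<lambda>w. (w\<^sup>2 + t) powr q + (q * (w\<^sup>2 + t) powr (q - 1) * (2 * w)) * w"])
    fix w :: real
    show "((\<lambda>w. w * (w\<^sup>2 + t) powr q) has_real_derivative
        (w\<^sup>2 + t) powr q + (q * (w\<^sup>2 + t) powr (q - 1) * (2 * w)) * w) (at w within UNIV)"
      using DERIV_mult[OF DERIV_ident D[of q w]] by simp
    have le: "(w\<^sup>2 + t) powr q \<le> t powr q" using q t by (intro powr_mono2') auto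
    have "(w\<^sup>2 + t) powr (q - 1) * w\<^sup>2 \<le> (w\<^sup>2 + t) powr (q - 1) * (w\<^sup>2 + t)"
      using t by (intro mult_left_mono) auto
    also have "\<dots> = (w\<^sup>2 + t) powr q" using pos[of w] by (simp add: powr_diff)
    finally have "(w\<^sup>2 + t) powr (q - 1) * w\<^sup>2 \<le> t powr q" using le by simp
    then have "\<bar>2 * q\<bar> * ((w\<^sup>2 + t) powr (q - 1) * w\<^sup>2) \<le> 1 * (t powr q)"
      using q by (intro mult_mono) auto
    moreover have "\<bar>(q * (w\<^sup>2 + t) powr (q - 1) * (2 * w)) * w\<bar> = \<bar>2 * q\<bar> * ((w\<^sup>2 + t) powr (q - 1) * w\<^sup>2)"
      by (simp add: abs_mult power2_eq_square)
    ultimately show "norm ((w\<^sup>2 + t) powr q + (q * (w\<^sup>2 + t) powr (q - 1) * (2 * w)) * w) \<le> 2 * t powr q"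
      using le abs_triangle_ineq[of "(w\<^sup>2 + t) powr q" "(q * (w\<^sup>2 + t) powr (q - 1) * (2 * w)) * w"] by simp
  qed auto
  then show "\<bar>y * (y\<^sup>2 + t) powr ((p - 1) / 2) - z * (z\<^sup>2 + t) powr ((p - 1) / 2)\<bar> \<le> 2 * t powr ((p - 1) / 2) * \<bar>y - z\<bar>"
    by (simp add: q_def)
qed

section \<open>Testing the equation in logarithmic polar coordinates\<close>

lemma (in annulus) PI_cong_AE:
  assumes "cutoff \<psi>" "AE x in MA. F x = G x" "F \<in> borel_measurable MA" "G \<in> borel_measurable MA"
  shows "PI \<psi> F = PI \<psi> G"
  unfolding PI_def
proof (rule integral_cong_AE)
  note m = measurable_MA[OF cutoff_weight(1)[OF assms(1)]]
  show "(\<lambda>x. \<psi> (ln (norm x)) / (norm x)\<^sup>2 * F x) \<in> borel_measurable MA"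
    "(\<lambda>x. \<psi> (ln (norm x)) / (norm x)\<^sup>2 * G x) \<in> borel_measurable MA"
    by (rule borel_measurable_times[OF m assms(3)], rule borel_measurable_times[OF m assms(4)])
  show "AE x in MA. \<psi> (ln (norm x)) / (norm x)\<^sup>2 * F x = \<psi> (ln (norm x)) / (norm x)\<^sup>2 * G x"
    using assms(2) by eventually_elim simp
qed

lemma (in annulus) PI_dominated_convergence:
  assumes "cutoff \<psi>" and m: "\<And>n. F n \<in> borel_measurable MA" "G \<in> borel_measurable MA"
    and l: "AE x in MA. (\<lambda>n. F n x) \<longlonglongrightarrow> G x" and w: "integrable MA w" "\<And>n. AE x in MA. \<bar>F n x\<bar> \<le> w x"
  shows "(\<lambda>n. PI \<psi> (F n)) \<longlonglongrightarrow> PI \<psi> G"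
proof -
  obtain B where B: "\<And>x. x \<in> An \<Longrightarrow> \<bar>\<psi> (ln (norm x)) / (norm x)\<^sup>2\<bar> \<le> B"
    using cutoff_weight(2)[OF assms(1)] by auto
  note mw = measurable_MA[OF cutoff_weight(1)[OF assms(1)]]
  show ?thesis unfolding PI_def
  proof (rule integral_dominated_convergence[where w="\<lambda>x. B * w x"])
    show "integrable MA (\<lambda>x. B * w x)" using w(1) by simp
    show "(\<lambda>x. \<psi> (ln (norm x)) / (norm x)\<^sup>2 * G x) \<in> borel_measurable MA"
      "(\<lambda>x. \<psi> (ln (norm x)) / (norm x)\<^sup>2 * F n x) \<in> borel_measurable MA" for n
      by (rule borel_measurable_times[OF mw m(2)], rule borel_measurable_times[OF mw m(1)])
    show "AE x in MA. (\<lambda>n. \<psi> (ln (norm x)) / (norm x)\<^sup>2 * F n x) \<longlonglongrightarrow> \<psi> (ln (norm x)) / (norm x)\<^sup>2 * G x"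
      using l by eventually_elim (intro tendsto_intros)
    show "AE x in MA. norm (\<psi> (ln (norm x)) / (norm x)\<^sup>2 * F n x) \<le> B * w x" for n
      using w(2)[of n] AE_space
    proof eventually_elim
      case (elim x)
      have "\<bar>\<psi> (ln (norm x)) / (norm x)\<^sup>2\<bar> * \<bar>F n x\<bar> \<le> B * w x"
        using elim B[of x] order_trans[OF abs_ge_zero B[of x]] by (intro mult_mono) (auto simp: space_MA)
      then show ?case unfolding real_norm_def abs_mult .
    qed
  qed
qed

text \<open>\<open>S\<close> and \<open>T\<close> are W_s and W_\<theta>. The derivative of
  \<open>T\<close> in ln r is the same \<open>S\<^sub>t\<close> as the angular derivative of
  \<open>S\<close>, which encodes the symmetry of the mixed derivatives.\<close>

locale polar_solution = annulus +
  fixes p \<beta> \<epsilon> :: real and W S T S\<^sub>s S\<^sub>t T\<^sub>t :: "real^2 \<Rightarrow> real"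
  assumes p: "0 \<le> p" "p < 1" and \<beta>: "\<beta> = 2 / (1 - p)" and \<epsilon>: "\<bar>\<epsilon>\<bar> < 1"
    and W: "polar_H1 An W S T" and S: "polar_H1 An S S\<^sub>s S\<^sub>t" and T: "polar_H1 An T S\<^sub>t T\<^sub>t"
    and eq: "AE x in MA. S\<^sub>s x + (2 * \<beta> + \<epsilon>) * S x + \<beta> * (\<beta> + \<epsilon>) * W x + (1 + \<epsilon>) * T\<^sub>t x = W x powr p"
    and W_nonneg: "AE x in MA. 0 \<le> W x"
begin

lemma L2s: "L2 MA W" "L2 MA S" "L2 MA T" "L2 MA S\<^sub>s" "L2 MA S\<^sub>t" "L2 MA T\<^sub>t"
  using polar_H1_L2[OF W] polar_H1_L2[OF S] polar_H1_L2[OF T] by (simp_all add: MA_def)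

lemma powr_measurable: "(\<lambda>x. W x powr q) \<in> borel_measurable MA"
  using L2_measurable[OF L2s(1)] by simp

text \<open>No derivative is moved here: the equation holds almost everywhere and each term on its
  left is in L2, so any L2 function may serve as test function.\<close>

lemma PI_equation:
  assumes \<psi>: "cutoff \<psi>" and Z: "L2 MA Z"
  shows "PI \<psi> (\<lambda>x. Z x * S\<^sub>s x) + (2 * \<beta> + \<epsilon>) * PI \<psi> (\<lambda>x. Z x * S x) + \<beta> * (\<beta> + \<epsilon>) * PI \<psi> (\<lambda>x. Z x * W x)
      + (1 + \<epsilon>) * PI \<psi> (\<lambda>x. Z x * T\<^sub>t x) = PI \<psi> (\<lambda>x. Z x * W x powr p)"
proof -
  note i = L2_integrable_mult[OF Z L2s(4)] L2_integrable_mult[OF Z L2s(2)] L2_integrable_mult[OF Z L2s(1)]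
    L2_integrable_mult[OF Z L2s(6)]
  note j = i(1) integrable_mult_right[OF i(2), of "2 * \<beta> + \<epsilon>"] integrable_mult_right[OF i(3), of "\<beta> * (\<beta> + \<epsilon>)"]
    integrable_mult_right[OF i(4), of "1 + \<epsilon>"]
  note j2 = Bochner_Integration.integrable_add[OF j(1,2)]
  note j3 = Bochner_Integration.integrable_add[OF j2 j(3)]
  have "PI \<psi> (\<lambda>x. Z x * S\<^sub>s x) + (2 * \<beta> + \<epsilon>) * PI \<psi> (\<lambda>x. Z x * S x) + \<beta> * (\<beta> + \<epsilon>) * PI \<psi> (\<lambda>x. Z x * W x)
      + (1 + \<epsilon>) * PI \<psi> (\<lambda>x. Z x * T\<^sub>t x) = PI \<psi> (\<lambda>x. Z x * S\<^sub>s x + (2 * \<beta> + \<epsilon>) * (Z x * S x)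
      + \<beta> * (\<beta> + \<epsilon>) * (Z x * W x) + (1 + \<epsilon>) * (Z x * T\<^sub>t x))"
    unfolding PI_add[OF \<psi> j3 j(4)] PI_add[OF \<psi> j2 j(3)] PI_add[OF \<psi> j(1,2)] PI_cmult ..
  also have "\<dots> = PI \<psi> (\<lambda>x. Z x * W x powr p)"
  proof (rule PI_cong_AE[OF \<psi>])
    show "AE x in MA. Z x * S\<^sub>s x + (2 * \<beta> + \<epsilon>) * (Z x * S x)
      + \<beta> * (\<beta> + \<epsilon>) * (Z x * W x) + (1 + \<epsilon>) * (Z x * T\<^sub>t x) = Z x * W x powr p"
      using eq
    proof eventually_elim
      case (elim x)
      show ?case unfolding elim[symmetric] by (simp add: algebra_simps)
    qed
    show "(\<lambda>x. Z x * S\<^sub>s x + (2 * \<beta> + \<epsilon>) * (Z x * S x)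
      + \<beta> * (\<beta> + \<epsilon>) * (Z x * W x) + (1 + \<epsilon>) * (Z x * T\<^sub>t x)) \<in> borel_measurable MA"
      using Bochner_Integration.integrable_add[OF j3 j(4)] by (rule borel_measurable_integrable)
    show "(\<lambda>x. Z x * W x powr p) \<in> borel_measurable MA"
      using L2_measurable[OF Z] powr_measurable by (rule borel_measurable_times)
  qed
  finally show ?thesis .
qed

text \<open>The chain rule for the primitive of the nonlinearity, as the limit of the regularized
  identities for \<open>t = 1 / (n + 1)\<close>.\<close>

lemma PI_powr_identity:
  assumes \<psi>: "\<And>s. (\<psi> has_real_derivative \<psi>' s) (at s)" "cutoff \<psi>" "cutoff \<psi>'"
  shows "PI \<psi>' (\<lambda>x. W x powr (p + 1)) / (p + 1) + PI \<psi> (\<lambda>x. S x * W x powr p) = 0"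
proof -
  define t where "t n = inverse (real (Suc n))" for n
  have t: "0 < t n" "t n \<le> 1" for n by (auto simp: t_def inverse_le_1_iff)
  have t0: "t \<longlonglongrightarrow> 0" unfolding t_def[abs_def] by (rule LIMSEQ_inverse_real_of_nat)
  have e: "PI \<psi>' (\<lambda>x. ((W x)\<^sup>2 + t n) powr ((p + 1) / 2) / (p + 1)) +
      PI \<psi> (\<lambda>x. W x * ((W x)\<^sup>2 + t n) powr ((p - 1) / 2) * S x) = 0" for n
    by (rule PI_polar_H1_chain[OF W \<psi> regularized_power_deriv(1)[OF p t(1)] _ regularized_power_deriv(2)[OF p t(1)]]) simp
  note Wm = L2_measurable[OF L2s(1)] and Sm = L2_measurable[OF L2s(2)]
  have 1: "(\<lambda>n. PI \<psi>' (\<lambda>x. ((W x)\<^sup>2 + t n) powr ((p + 1) / 2) / (p + 1))) \<longlonglongrightarrow> PI \<psi>' (\<lambda>x. W x powr (p + 1) / (p + 1))"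
  proof (rule PI_dominated_convergence[OF \<psi>(3), where w="\<lambda>x. (W x)\<^sup>2 + 1"])
    show "(\<lambda>x. ((W x)\<^sup>2 + t n) powr ((p + 1) / 2) / (p + 1)) \<in> borel_measurable MA"
      "(\<lambda>x. W x powr (p + 1) / (p + 1)) \<in> borel_measurable MA" for n
      using Wm by simp_all
    show "integrable MA (\<lambda>x. (W x)\<^sup>2 + 1)" using L2_integrable_square[OF L2s(1)] by simp
    show "AE x in MA. \<bar>((W x)\<^sup>2 + t n) powr ((p + 1) / 2) / (p + 1)\<bar> \<le> (W x)\<^sup>2 + 1" for n
    proof (rule AE_I2)
      fix x
      have "((W x)\<^sup>2 + t n) powr ((p + 1) / 2) / (p + 1) \<le> ((W x)\<^sup>2 + t n) powr ((p + 1) / 2)"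
        using p by (simp add: divide_le_eq mult_le_cancel_left1)
      then show "\<bar>((W x)\<^sup>2 + t n) powr ((p + 1) / 2) / (p + 1)\<bar> \<le> (W x)\<^sup>2 + 1"
        using regularized_power_bounds(2)[OF p t, of "W x" n] p by simp
    qed
    show "AE x in MA. (\<lambda>n. ((W x)\<^sup>2 + t n) powr ((p + 1) / 2) / (p + 1)) \<longlonglongrightarrow> W x powr (p + 1) / (p + 1)"
      using W_nonneg
    proof eventually_elim
      case (elim x)
      have "(\<lambda>n. ((W x)\<^sup>2 + t n) powr ((p + 1) / 2)) \<longlonglongrightarrow> ((W x)\<^sup>2 + 0) powr ((p + 1) / 2)"
        using p t(1) by (intro tendsto_powr' tendsto_add tendsto_const t0) (auto intro: always_eventually less_imp_le)
      moreover have "((W x)\<^sup>2 + 0) powr ((p + 1) / 2) = W x powr (p + 1)"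
        using elim square_powr_half[of "W x" "p + 1"] by simp
      ultimately show ?case using p by (intro tendsto_divide) auto
    qed
  qed
  have 2: "(\<lambda>n. PI \<psi> (\<lambda>x. W x * ((W x)\<^sup>2 + t n) powr ((p - 1) / 2) * S x)) \<longlonglongrightarrow> PI \<psi> (\<lambda>x. S x * W x powr p)"
  proof (rule PI_dominated_convergence[OF \<psi>(2), where w="\<lambda>x. (1 + \<bar>W x\<bar>) * \<bar>S x\<bar>"])
    show "(\<lambda>x. W x * ((W x)\<^sup>2 + t n) powr ((p - 1) / 2) * S x) \<in> borel_measurable MA"
      "(\<lambda>x. S x * W x powr p) \<in> borel_measurable MA" for n
      using Wm Sm by (intro borel_measurable_times; simp)+
    have "L2 MA (\<lambda>x. \<bar>W x\<bar>)" "L2 MA (\<lambda>x. \<bar>S x\<bar>)" "L2 MA (\<lambda>_. 1)"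
      using L2s(1,2) by (auto simp: L2_def intro!: borel_measurable_abs)
    then show "integrable MA (\<lambda>x. (1 + \<bar>W x\<bar>) * \<bar>S x\<bar>)"
      by (intro L2_integrable_mult L2_add)
    show "AE x in MA. \<bar>W x * ((W x)\<^sup>2 + t n) powr ((p - 1) / 2) * S x\<bar> \<le> (1 + \<bar>W x\<bar>) * \<bar>S x\<bar>" for n
    proof (rule AE_I2)
      fix x
      show "\<bar>W x * ((W x)\<^sup>2 + t n) powr ((p - 1) / 2) * S x\<bar> \<le> (1 + \<bar>W x\<bar>) * \<bar>S x\<bar>"
        unfolding abs_mult[of _ "S x"]
        using regularized_power_bounds(1)[OF p t, of "W x" n] by (intro mult_right_mono) auto
    qed
    show "AE x in MA. (\<lambda>n. W x * ((W x)\<^sup>2 + t n) powr ((p - 1) / 2) * S x) \<longlonglongrightarrow> S x * W x powr p"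
      using W_nonneg
    proof eventually_elim
      case (elim x)
      show ?case
      \<comment> \<open>Where \<open>W\<close> vanishes the approximants and the limit are all 0.
        This relies on \<open>0 powr p = 0\<close> and covers \<open>p = 0\<close>, where the
        nonlinearity jumps.\<close>
      proof (cases "W x = 0")
        case False
        have "(\<lambda>n. W x * ((W x)\<^sup>2 + t n) powr ((p - 1) / 2) * S x) \<longlonglongrightarrow> W x * ((W x)\<^sup>2 + 0) powr ((p - 1) / 2) * S x"
          using False by (intro tendsto_mult tendsto_powr tendsto_add tendsto_const t0) auto
        moreover have "((W x)\<^sup>2 + 0) powr ((p - 1) / 2) = W x powr (p - 1)"
          using elim square_powr_half[of "W x" "p - 1"] by simp
        moreover have "W x * W x powr (p - 1) = W x powr p" using elim False by (simp add: powr_mult_base)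
        ultimately show ?thesis by (simp add: mult.commute)
      qed simp
    qed
  qed
  have "PI \<psi>' (\<lambda>x. W x powr (p + 1) / (p + 1)) = PI \<psi>' (\<lambda>x. W x powr (p + 1)) / (p + 1)"
    using PI_cmult[of \<psi>' "1 / (p + 1)" "\<lambda>x. W x powr (p + 1)"] by simp
  then show ?thesis using tendsto_add[OF 1 2] unfolding e LIMSEQ_const_iff by simp
qed

text \<open>Trades the indefinite term \<open>W W\<^sub>s\<close> for \<open>W\<^sup>2\<close>,
  which pointwise bounds control, at the price of one more derivative on the cutoff.\<close>

lemma energy_W:
  assumes \<psi>: "\<And>s. (\<psi> has_real_derivative \<psi>' s) (at s)" "cutoff \<psi>" "cutoff \<psi>'"
  shows "PI \<psi>' (\<lambda>x. W x * W x) + 2 * PI \<psi> (\<lambda>x. W x * S x) = 0"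
  using PI_polar_H1_product(1)[OF W W \<psi>] by (simp add: mult.commute)

text \<open>The equation tested with \<open>\<eta> W\<close>. For nonnegative \<eta> the left side
  is a sum of nonnegative terms, so it bounds W_s by \<open>W\<close>; for \<eta> = \<phi>' it
  eliminates the angular term from the other identity.\<close>

lemma energy_upper:
  assumes \<eta>: "\<And>s. (\<eta> has_real_derivative \<eta>' s) (at s)" "cutoff \<eta>" "cutoff \<eta>'"
  shows "PI \<eta> (\<lambda>x. S x * S x) + (1 + \<epsilon>) * PI \<eta> (\<lambda>x. T x * T x) + PI \<eta> (\<lambda>x. W x powr (p + 1)) =
    - PI \<eta>' (\<lambda>x. W x * S x) + (2 * \<beta> + \<epsilon>) * PI \<eta> (\<lambda>x. W x * S x) + \<beta> * (\<beta> + \<epsilon>) * PI \<eta> (\<lambda>x. W x * W x)"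
proof -
  have 1: "PI \<eta>' (\<lambda>x. W x * S x) + PI \<eta> (\<lambda>x. S x * S x) + PI \<eta> (\<lambda>x. W x * S\<^sub>s x) = 0"
    by (rule PI_polar_H1_product(1)[OF W S \<eta>])
  have 2: "(1 + \<epsilon>) * (PI \<eta> (\<lambda>x. T x * T x) + PI \<eta> (\<lambda>x. W x * T\<^sub>t x)) = 0"
    using PI_polar_H1_product(2)[OF W T \<eta>] by simp
  have 3: "PI \<eta> (\<lambda>x. W x * W x powr p) = PI \<eta> (\<lambda>x. W x powr (p + 1))"
    using W_nonneg L2_measurable[OF L2s(1)] powr_measurable
    by (intro PI_cong_AE \<eta> borel_measurable_times) (auto simp: powr_mult_base add.commute elim!: eventually_mono)
  show ?thesis using 1 2 PI_equation[OF \<eta>(2) L2s(1)] unfolding 3 distrib_left by linarith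
qed

text \<open>Testing the equation with \<open>W\<^sub>s\<close>, combined with \<open>energy_upper\<close> for the weight \<open>\<phi>'\<close>: the
  coefficient of the potential term is then negative wherever \<open>\<phi>\<close> increases.\<close>

lemma energy_identity:
  assumes \<phi>: "\<And>s. (\<phi> has_real_derivative \<phi>' s) (at s)" "cutoff \<phi>" "cutoff \<phi>'"
    and \<phi>': "\<And>s. (\<phi>' has_real_derivative \<phi>'' s) (at s)" "cutoff \<phi>''"
  shows "(2 * \<beta> + \<epsilon>) * PI \<phi> (\<lambda>x. S x * S x) = PI \<phi>' (\<lambda>x. S x * S x)
    - (1 / (p + 1) - 1 / 2) * PI \<phi>' (\<lambda>x. W x powr (p + 1))
    + PI \<phi>'' (\<lambda>x. W x * S x) / 2 - (2 * \<beta> + \<epsilon>) / 2 * PI \<phi>' (\<lambda>x. W x * S x)"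
proof -
  have 1: "PI \<phi>' (\<lambda>x. S x * S x) + 2 * PI \<phi> (\<lambda>x. S x * S\<^sub>s x) = 0"
    using PI_polar_H1_product(1)[OF S S \<phi>] by (simp add: mult.commute)
  have 2: "PI \<phi> (\<lambda>x. S x * W x) = - PI \<phi>' (\<lambda>x. W x * W x) / 2"
    using energy_W[OF \<phi>] by (simp add: mult.commute)
  \<comment> \<open>One integration by parts in the angle and one in ln r, linked by the common
    mixed derivative \<open>S\<^sub>t\<close>.\<close>
  have "PI \<phi> (\<lambda>x. S\<^sub>t x * T x) + PI \<phi> (\<lambda>x. S x * T\<^sub>t x) = 0"
    by (rule PI_polar_H1_product(2)[OF S T \<phi>])
  moreover have "PI \<phi>' (\<lambda>x. T x * T x) + 2 * PI \<phi> (\<lambda>x. S\<^sub>t x * T x) = 0"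
    using PI_polar_H1_product(1)[OF T T \<phi>] by (simp add: mult.commute)
  ultimately have 3: "PI \<phi> (\<lambda>x. S x * T\<^sub>t x) = PI \<phi>' (\<lambda>x. T x * T x) / 2" by simp
  \<comment> \<open>Half of \<open>energy_upper\<close> for \<phi>' cancels both the
    \<open>W\<^sup>2\<close> and the \<open>T\<^sup>2\<close> terms; its potential term leaves
    \<open>1 / 2 - 1 / (p + 1)\<close>.\<close>
  note 4 = PI_powr_identity[OF \<phi>] and 5 = PI_equation[OF \<phi>(2) L2s(2)] and 6 = energy_upper[OF \<phi>' (1) \<phi>(3) \<phi>'(2)]
  have "(1 / (p + 1) - 1 / 2) * PI \<phi>' (\<lambda>x. W x powr (p + 1)) = PI \<phi>' (\<lambda>x. W x powr (p + 1)) / (p + 1) - PI \<phi>' (\<lambda>x. W x powr (p + 1)) / 2"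
    by (simp add: left_diff_distrib)
  then show ?thesis using 1 4 5 6 unfolding 2 3 by (simp add: field_simps)
qed

end

section \<open>Cutoff functions\<close>

lemma DERIV_left_right:
  fixes f :: "real \<Rightarrow> real"
  assumes "(f has_real_derivative d) (at_left x)" "(f has_real_derivative d) (at_right x)"
  shows "(f has_real_derivative d) (at x)"
  using assms unfolding has_field_derivative_iff by (rule filterlim_split_at)

text \<open>At 0 and 1 the constant piece and the piece given by \<open>G\<close> have the same
  one-sided derivative, because \<open>G'\<close> vanishes there.\<close>

lemma DERIV_clamp:
  assumes G: "\<And>x. (G has_real_derivative G' x) (at x)" and 0: "G' 0 = 0" and 1: "G' 1 = 0"
  shows "((\<lambda>s. G (max 0 (min 1 s))) has_real_derivative G' (max 0 (min 1 s))) (at s)"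
proof -
  let ?f = "\<lambda>s. G (max 0 (min 1 s))"
  have const: "(?f has_real_derivative 0) (at s within A)"
    if "open B" "s \<in> B" "\<And>y. y \<in> B \<inter> A \<or> y = s \<Longrightarrow> ?f y = c" for s c A B
    unfolding has_field_derivative_iff
  proof (rule tendsto_eventually)
    have "\<forall>\<^sub>F y in nhds s. y \<in> B" using that(1,2) by (rule eventually_nhds_in_open)
    then show "\<forall>\<^sub>F y in at s within A. (?f y - ?f s) / (y - s) = 0"
      unfolding eventually_at_filter by eventually_elim (use that(3) in simp)
  qed
  have id: "(?f has_real_derivative G' s) (at s within A)"
    if "open B" "s \<in> B" "\<And>y. y \<in> B \<inter> A \<or> y = s \<Longrightarrow> ?f y = G y" for s A B
    unfolding has_field_derivative_iff
  proof (rule Lim_transform_eventually)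
    show "((\<lambda>y. (G y - G s) / (y - s)) \<longlongrightarrow> G' s) (at s within A)"
      using has_field_derivative_at_within[OF G] unfolding has_field_derivative_iff .
    have "\<forall>\<^sub>F y in nhds s. y \<in> B" using that(1,2) by (rule eventually_nhds_in_open)
    then show "\<forall>\<^sub>F y in at s within A. (G y - G s) / (y - s) = (?f y - ?f s) / (y - s)"
      unfolding eventually_at_filter by eventually_elim (use that(3) in simp)
  qed
  consider "s < 0" | "s = 0" | "0 < s" "s < 1" | "s = 1" | "1 < s" by linarith
  then show ?thesis
  proof cases
    case 1
    have "(?f has_real_derivative 0) (at s)"
      by (rule const[of "{..<0}" s UNIV "G 0"]) (use 1 in \<open>auto simp: max_def min_def\<close>)
    then show ?thesis using 1 assms(2) by (simp add: max_def min_def)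
  next
    case 2
    have "(?f has_real_derivative 0) (at_left 0)" by (rule const[of UNIV _ _ "G 0"]) (auto simp: max_def min_def)
    moreover have "(?f has_real_derivative G' 0) (at_right 0)" by (rule id[of "{..<1}"]) (auto simp: max_def min_def)
    ultimately show ?thesis using DERIV_left_right[of ?f 0 0] assms(2) 2 by simp
  next
    case 3
    have "(?f has_real_derivative G' s) (at s)"
      by (rule id[of "{0<..<1}" s UNIV]) (use 3 in \<open>auto simp: max_def min_def\<close>)
    then show ?thesis using 3 by (simp add: max_def min_def)
  next
    case 4
    have "(?f has_real_derivative G' 1) (at_left 1)" by (rule id[of "{0<..}"]) (auto simp: max_def min_def)
    moreover have "(?f has_real_derivative 0) (at_right 1)" by (rule const[of UNIV _ _ "G 1"]) (auto simp: max_def min_def)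
    ultimately show ?thesis using DERIV_left_right[of ?f 0 1] assms(3) 4 by simp
  next
    case 5
    have "(?f has_real_derivative 0) (at s)"
      by (rule const[of "{1<..}" s UNIV "G 1"]) (use 5 in \<open>auto simp: max_def min_def\<close>)
    then show ?thesis using 5 assms(3) by (simp add: max_def min_def)
  qed
qed

text \<open>Three derivatives are required: \<phi>' and \<phi>'' enter the energy identity, and
  exchanging \<open>W W\<^sub>s\<close> for \<open>W\<^sup>2\<close> costs one more.\<close>

lemma smooth_step_exists:
  obtains st st1 st2 st3 :: "real \<Rightarrow> real" and B :: real where
    "\<And>s. (st has_real_derivative st1 s) (at s)" "\<And>s. (st1 has_real_derivative st2 s) (at s)"
    "\<And>s. (st2 has_real_derivative st3 s) (at s)" "continuous_on UNIV st3"
    "\<And>s. s \<le> 0 \<Longrightarrow> st s = 0" "\<And>s. 1 \<le> s \<Longrightarrow> st s = 1" "\<And>s. 0 \<le> st s" "\<And>s. st s \<le> 1" "\<And>s. 0 \<le> st1 s"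
    "\<And>s. s < 0 \<or> 1 < s \<Longrightarrow> st1 s = 0 \<and> st2 s = 0 \<and> st3 s = 0"
    "0 \<le> B" "\<And>s. \<bar>st1 s\<bar> \<le> B \<and> \<bar>st2 s\<bar> \<le> B \<and> \<bar>st3 s\<bar> \<le> B"
proof -
  \<comment> \<open>The step of degree 7: \<open>P1\<close> has triple zeros at both ends, so
    \<open>P1\<close>, \<open>P2\<close>, \<open>P3\<close> vanish there, and 140 is the reciprocal
    of the integral of \<open>x ^ 3 (1 - x) ^ 3\<close> over [0, 1].\<close>
  define P0 P1 P2 P3 :: "real \<Rightarrow> real" where "P0 x = 35 * x ^ 4 - 84 * x ^ 5 + 70 * x ^ 6 - 20 * x ^ 7"
    and "P1 x = 140 * x ^ 3 * (1 - x) ^ 3" and "P2 x = 420 * x\<^sup>2 * (1 - x)\<^sup>2 * (1 - 2 * x)"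
    and "P3 x = 840 * x * (1 - x) * (1 - 5 * x + 5 * x\<^sup>2)" for x
  have D0: "(P0 has_real_derivative P1 x) (at x)" for x
    unfolding P0_def[abs_def] P1_def
    by (rule DERIV_cong, (rule derivative_intros)+) (simp add: algebra_simps power2_eq_square power3_eq_cube power4_eq_xxxx eval_nat_numeral)
  have D1: "(P1 has_real_derivative P2 x) (at x)" for x
    unfolding P1_def[abs_def] P2_def
    by (auto intro!: derivative_eq_intros simp: algebra_simps power2_eq_square power3_eq_cube eval_nat_numeral)
  have D2: "(P2 has_real_derivative P3 x) (at x)" for x
    unfolding P2_def[abs_def] P3_def
    by (auto intro!: derivative_eq_intros simp: algebra_simps power2_eq_square power3_eq_cube eval_nat_numeral)
  define cl where "cl s = max 0 (min 1 s)" for s :: real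
  define st st1 st2 st3 where "st s = P0 (cl s)" and "st1 s = P1 (cl s)" and "st2 s = P2 (cl s)" and "st3 s = P3 (cl s)" for s
  have clc: "continuous_on UNIV cl" unfolding cl_def[abs_def] by (intro continuous_intros)
  have cl01: "0 \<le> cl s" "cl s \<le> 1" for s by (auto simp: cl_def)
  have d0: "(st has_real_derivative st1 s) (at s)" for s
    unfolding st_def[abs_def] st1_def cl_def by (rule DERIV_clamp[OF D0]) (auto simp: P1_def)
  have d1: "(st1 has_real_derivative st2 s) (at s)" for s
    unfolding st1_def[abs_def] st2_def cl_def by (rule DERIV_clamp[OF D1]) (auto simp: P2_def)
  have d2: "(st2 has_real_derivative st3 s) (at s)" for s
    unfolding st2_def[abs_def] st3_def cl_def by (rule DERIV_clamp[OF D2]) (auto simp: P3_def)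
  have Pc: "continuous_on UNIV P3" unfolding P3_def[abs_def] by (intro continuous_intros)
  then have c3: "continuous_on UNIV st3"
    unfolding st3_def[abs_def] using continuous_on_compose2[OF _ clc] by auto
  have out: "st s = 0" if "s \<le> 0" for s using that by (simp add: st_def cl_def P0_def)
  have in1: "st s = 1" if "1 \<le> s" for s using that by (simp add: st_def cl_def P0_def)
  have pos: "0 \<le> st1 s" for s using cl01[of s] by (simp add: st1_def P1_def)
  have mono: "st x \<le> st y" if "x \<le> y" for x y
    using that d0 pos by (meson DERIV_nonneg_imp_nondecreasing)
  have ge: "0 \<le> st s" for s using mono[of "min s 0" s] out[of "min s 0"] by simp
  have le: "st s \<le> 1" for s using mono[of s "max s 1"] in1[of "max s 1"] by simp
  have supp: "st1 s = 0 \<and> st2 s = 0 \<and> st3 s = 0" if "s < 0 \<or> 1 < s" for s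
    using that by (auto simp: st1_def st2_def st3_def cl_def P1_def P2_def P3_def)
  have c1: "continuous_on UNIV st1" "continuous_on UNIV st2"
    using d1 d2 by (meson DERIV_isCont continuous_at_imp_continuous_on)+
  obtain B1 where B1: "0 \<le> B1" "\<And>x. \<bar>st1 x\<bar> \<le> B1"
    using bounded_continuous_compact_support[OF c1(1), of "{0..1}"] supp by (metis atLeastAtMost_iff compact_Icc not_le)
  obtain B2 where B2: "0 \<le> B2" "\<And>x. \<bar>st2 x\<bar> \<le> B2"
    using bounded_continuous_compact_support[OF c1(2), of "{0..1}"] supp by (metis atLeastAtMost_iff compact_Icc not_le)
  obtain B3 where B3: "0 \<le> B3" "\<And>x. \<bar>st3 x\<bar> \<le> B3"
    using bounded_continuous_compact_support[OF c3, of "{0..1}"] supp by (metis atLeastAtMost_iff compact_Icc not_le)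
  have "\<bar>st1 s\<bar> \<le> B1 + B2 + B3 \<and> \<bar>st2 s\<bar> \<le> B1 + B2 + B3 \<and> \<bar>st3 s\<bar> \<le> B1 + B2 + B3" for s
    using B1(1) B2(1) B3(1) B1(2)[of s] B2(2)[of s] B3(2)[of s] by linarith
  then show thesis
    using that[of st st1 st2 st3 "B1 + B2 + B3"] d0 d1 d2 c3 out in1 ge le pos supp B1(1) B2(1) B3(1) by auto
qed

section \<open>The energy estimate\<close>

text \<open>The measure \<open>dx / |x|\<^sup>2\<close> of a shell \<open>\<sigma> \<le> ln |x| \<le> \<sigma> + 1\<close> is at most \<open>shell_mass\<close>, whatever \<open>\<sigma>\<close> is.\<close>

definition shell_mass :: real where
  "shell_mass = unit_ball_vol 2 * exp 2"

lemma shell_mass_nonneg: "0 \<le> shell_mass"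
  by (simp add: shell_mass_def unit_ball_vol_nonneg)

context annulus
begin

lemma weight_integrable:
  assumes "\<psi> \<in> borel_measurable borel" "\<And>s. \<bar>\<psi> s\<bar> \<le> B" "integrable MA F"
  shows "integrable MA (\<lambda>x. \<psi> (ln (norm x)) / (norm x)\<^sup>2 * F x)"
proof (rule Bochner_Integration.integrable_bound)
  show "integrable MA (\<lambda>x. (B / a\<^sup>2) * \<bar>F x\<bar>)" using assms(3) by simp
  have "(\<lambda>x. ln (norm x)) \<in> borel_measurable MA" "(\<lambda>x. inverse ((norm x)\<^sup>2)) \<in> borel_measurable MA"
    using An_nz by (auto intro!: measurable_MA continuous_intros)
  then have "(\<lambda>x. \<psi> (ln (norm x)) * inverse ((norm x)\<^sup>2)) \<in> borel_measurable MA"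
    by (intro borel_measurable_times measurable_compose[OF _ assms(1)])
  then show "(\<lambda>x. \<psi> (ln (norm x)) / (norm x)\<^sup>2 * F x) \<in> borel_measurable MA"
    unfolding divide_inverse by (rule borel_measurable_times) (rule borel_measurable_integrable[OF assms(3)])
  show "AE x in MA. norm (\<psi> (ln (norm x)) / (norm x)\<^sup>2 * F x) \<le> norm ((B / a\<^sup>2) * \<bar>F x\<bar>)"
  proof (rule AE_I2)
    fix x assume x: "x \<in> space MA"
    have B: "0 \<le> B" using assms(2)[of 0] by simp
    have "a\<^sup>2 \<le> (norm x)\<^sup>2" using x a_pos by (intro power_mono) (auto simp: space_MA An_def)
    then have "\<bar>\<psi> (ln (norm x)) / (norm x)\<^sup>2\<bar> \<le> B / a\<^sup>2"
      unfolding abs_divide using assms(2) B a_pos by (intro frac_le) auto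
    then have "\<bar>\<psi> (ln (norm x)) / (norm x)\<^sup>2\<bar> * \<bar>F x\<bar> \<le> (B / a\<^sup>2) * \<bar>F x\<bar>"
      by (intro mult_right_mono) auto
    then show "norm (\<psi> (ln (norm x)) / (norm x)\<^sup>2 * F x) \<le> norm ((B / a\<^sup>2) * \<bar>F x\<bar>)"
      using B by (simp add: abs_mult)
  qed
qed

lemma PI_le:
  assumes "\<eta> \<in> borel_measurable borel" "\<And>s. \<bar>\<eta> s\<bar> \<le> B" "integrable MA G"
    and le: "AE x in MA. \<bar>\<psi> (ln (norm x)) * F x\<bar> \<le> \<eta> (ln (norm x)) * G x"
  shows "\<bar>PI \<psi> F\<bar> \<le> PI \<eta> G"
proof -
  have "\<bar>PI \<psi> F\<bar> \<le> (\<integral>x. \<bar>\<psi> (ln (norm x)) / (norm x)\<^sup>2 * F x\<bar> \<partial>MA)"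
    unfolding PI_def by (rule integral_abs_bound)
  also have "\<dots> \<le> PI \<eta> G"
    unfolding PI_def
  proof (rule integral_mono_AE')
    show "integrable MA (\<lambda>x. \<eta> (ln (norm x)) / (norm x)\<^sup>2 * G x)"
      by (rule weight_integrable[OF assms(1-3)])
    show "AE x in MA. \<bar>\<psi> (ln (norm x)) / (norm x)\<^sup>2 * F x\<bar> \<le> \<eta> (ln (norm x)) / (norm x)\<^sup>2 * G x"
      using le by eventually_elim (simp add: abs_mult divide_right_mono)
    show "AE x in MA. 0 \<le> \<eta> (ln (norm x)) / (norm x)\<^sup>2 * G x"
      using le
    proof eventually_elim
      case (elim x)
      then show ?case using order_trans[OF abs_ge_zero elim] by simp
    qed
  qed
  finally show ?thesis .
qed

lemma PI_nonneg:
  assumes "\<And>s. 0 \<le> \<psi> s" "AE x in MA. 0 \<le> F x"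
  shows "0 \<le> PI \<psi> F"
  unfolding PI_def using assms by (intro integral_nonneg_AE) (auto elim!: eventually_mono)

lemma PI_shell_const:
  assumes "0 \<le> N"
  shows "PI (indicator {\<sigma>..\<sigma> + 1}) (\<lambda>_. N) \<le> N * shell_mass"
proof -
  let ?C = "cball (0::real^2) (exp (\<sigma> + 1))"
  have iC: "integrable lborel (indicator ?C :: real^2 \<Rightarrow> real)"
    using emeasure_bounded_finite[OF bounded_cball, of 0 "exp (\<sigma> + 1)"]
    by (intro integrable_real_indicator) auto
  have iC': "integrable lborel (\<lambda>x. indicator An x *\<^sub>R (indicator ?C x :: real))"
    using open_An by (intro integrable_mult_indicator iC) auto
  \<comment> \<open>On the shell \<open>1 / |x|\<^sup>2\<close> is at most
    \<open>exp (- 2 \<sigma>)\<close>, and the shell lies in the disc of radius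
    \<open>exp (\<sigma> + 1)\<close>; the factors depending on \<sigma> cancel.\<close>
  have "PI (indicator {\<sigma>..\<sigma> + 1}) (\<lambda>_. N) \<le> (\<integral>x. (N * exp (- 2 * \<sigma>)) * indicator ?C x \<partial>MA)"
    unfolding PI_def
  proof (rule integral_mono_AE')
    show "integrable MA (\<lambda>x. (N * exp (- 2 * \<sigma>)) * indicator ?C x)"
      unfolding MA_def using iC' open_An
      by (intro integrable_mult_right) (simp add: integrable_restrict_space set_integrable_def)
    show "AE x in MA. indicator {\<sigma>..\<sigma> + 1} (ln (norm x)) / (norm x)\<^sup>2 * N \<le> (N * exp (- 2 * \<sigma>)) * indicator ?C x"
    proof (rule AE_I2)
      fix x assume "x \<in> space MA"
      then have x: "0 < norm x" using An_nz by (auto simp: space_MA)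
      show "indicator {\<sigma>..\<sigma> + 1} (ln (norm x)) / (norm x)\<^sup>2 * N \<le> (N * exp (- 2 * \<sigma>)) * indicator ?C x"
      proof (cases "ln (norm x) \<in> {\<sigma>..\<sigma> + 1}")
        case True
        have 1: "exp \<sigma> \<le> norm x" "norm x \<le> exp (\<sigma> + 1)"
        proof -
          have "exp \<sigma> \<le> exp (ln (norm x))" "exp (ln (norm x)) \<le> exp (\<sigma> + 1)" using True by simp_all
          then show "exp \<sigma> \<le> norm x" "norm x \<le> exp (\<sigma> + 1)" unfolding exp_ln[OF x] by auto
        qed
        have "exp (2 * \<sigma>) \<le> (norm x)\<^sup>2"
          using power_mono[OF 1(1), of 2] by (simp add: exp_double)
        then have "1 / (norm x)\<^sup>2 \<le> 1 / exp (2 * \<sigma>)" using x by (intro divide_left_mono) auto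
        then have "1 / (norm x)\<^sup>2 * N \<le> 1 / exp (2 * \<sigma>) * N" using assms by (rule mult_right_mono)
        then show ?thesis using True 1 by (simp add: exp_minus divide_inverse mult.commute)
      next
        case False
        then have "indicator {\<sigma>..\<sigma> + 1} (ln (norm x)) = (0::real)" unfolding indicator_def by (simp only: if_False of_bool_eq)
        then show ?thesis using assms by simp
      qed
    qed
    show "AE x in MA. 0 \<le> (N * exp (- 2 * \<sigma>)) * indicator ?C x"
      using assms by simp
  qed
  also have "\<dots> = (N * exp (- 2 * \<sigma>)) * (\<integral>x. indicator An x *\<^sub>R (indicator ?C x :: real) \<partial>lborel)"
    unfolding MA_def using open_An
    by (subst integral_mult_right_zero, subst integral_restrict_space) (auto simp: set_lebesgue_integral_def)
  also have "\<dots> \<le> (N * exp (- 2 * \<sigma>)) * (\<integral>x. indicator ?C x \<partial>lborel)"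
    using assms by (intro mult_left_mono integral_mono iC iC') (auto simp: indicator_def)
  also have "(\<integral>x. indicator ?C x \<partial>lborel) = unit_ball_vol 2 * (exp (\<sigma> + 1))\<^sup>2"
    by (simp add: content_cball)
  also have "(N * exp (- 2 * \<sigma>)) * (unit_ball_vol 2 * (exp (\<sigma> + 1))\<^sup>2) = N * (unit_ball_vol 2 * (exp (- 2 * \<sigma>) * exp (2 * (\<sigma> + 1))))"
    unfolding exp_double[of "\<sigma> + 1"] by (simp only: mult_ac)
  also have "exp (- 2 * \<sigma>) * exp (2 * (\<sigma> + 1)) = exp 2"
    by (simp add: algebra_simps flip: exp_add)
  finally show ?thesis by (simp add: shell_mass_def)
qed

lemma PI_shell_bound:
  assumes "\<And>s. \<bar>\<psi> s\<bar> \<le> B" "\<And>s. s < \<sigma> \<or> \<sigma> + 1 < s \<Longrightarrow> \<psi> s = 0" "0 \<le> N"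
    and F: "AE x in MA. \<sigma> \<le> ln (norm x) \<and> ln (norm x) \<le> \<sigma> + 1 \<longrightarrow> \<bar>F x\<bar> \<le> N"
  shows "\<bar>PI \<psi> F\<bar> \<le> B * (N * shell_mass)"
proof -
  have B: "0 \<le> B" using assms(1)[of 0] by simp
  have "\<bar>PI \<psi> F\<bar> \<le> PI (indicator {\<sigma>..\<sigma> + 1}) (\<lambda>_. B * N)"
  proof (rule PI_le[where B=1])
    show "AE x in MA. \<bar>\<psi> (ln (norm x)) * F x\<bar> \<le> indicator {\<sigma>..\<sigma> + 1} (ln (norm x)) * (B * N)"
      using F
    proof eventually_elim
      case (elim x)
      show ?case
      proof (cases "ln (norm x) \<in> {\<sigma>..\<sigma> + 1}")
        case True
        have "\<bar>\<psi> (ln (norm x))\<bar> * \<bar>F x\<bar> \<le> B * N"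
          using assms(1) B elim True by (intro mult_mono) auto
        then show ?thesis using True by (simp add: abs_mult)
      next
        case False
        then have "\<psi> (ln (norm x)) = 0" by (intro assms(2)) auto
        then show ?thesis using False by simp
      qed
    qed
  qed (auto simp: indicator_def)
  also have "\<dots> \<le> (B * N) * shell_mass" using B assms(3) by (intro PI_shell_const) simp
  finally show ?thesis by (simp add: mult.assoc)
qed

end

section \<open>Estimates for a single cutoff\<close>

lemma mult_mono_upper_nonneg:
  fixes c d x y :: real
  assumes "0 \<le> c" "c \<le> d" "x \<le> y" "0 \<le> y"
  shows "c * x \<le> d * y"
  using mult_left_mono[OF assms(3,1)] mult_right_mono[OF assms(2,4)] by linarith

text \<open>In \<open>s = ln |x|\<close> the inner shell is [\<tau>, \<tau> + 1] and the outer one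
  [-2/5, -1/5]. \<open>K\<close> and \<open>N\<close> bound \<open>W\<close> on them:
  \<open>K\<close> comes from the blow-ups and \<open>N\<close> from the supremum of the
  solution.\<close>

locale energy_estimate = polar_solution +
  fixes st st1 st2 st3 :: "real \<Rightarrow> real" and B \<tau> K N :: real
  assumes st: "\<And>s. (st has_real_derivative st1 s) (at s)" "\<And>s. (st1 has_real_derivative st2 s) (at s)"
    "\<And>s. (st2 has_real_derivative st3 s) (at s)" "continuous_on UNIV st3"
    and st_values: "\<And>s. s \<le> 0 \<Longrightarrow> st s = 0" "\<And>s. 1 \<le> s \<Longrightarrow> st s = 1" "\<And>s. 0 \<le> st s" "\<And>s. st s \<le> 1" "\<And>s. 0 \<le> st1 s"
    and st_supp: "\<And>s. s < 0 \<or> 1 < s \<Longrightarrow> st1 s = 0 \<and> st2 s = 0 \<and> st3 s = 0"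
    and B: "0 \<le> B" "\<And>s. \<bar>st1 s\<bar> \<le> B \<and> \<bar>st2 s\<bar> \<le> B \<and> \<bar>st3 s\<bar> \<le> B"
    and \<tau>: "ln a < \<tau>" "\<tau> + 1 \<le> - 2 / 5" and lnb: "- 1 / 5 < ln b"
    and K: "0 \<le> K" "AE x in MA. \<tau> \<le> ln (norm x) \<and> ln (norm x) \<le> \<tau> + 1 \<longrightarrow> W x \<le> K"
    and N: "0 \<le> N" "AE x in MA. - 2 / 5 \<le> ln (norm x) \<and> ln (norm x) \<le> - 1 / 5 \<longrightarrow> W x \<le> N"
begin

text \<open>The map \<open>5 s + 2\<close> sends the outer shell onto [0, 1]. Each derivative of the
  outer step therefore costs a factor 5, whence the powers of 5 in the constants.\<close>

definition \<phi> :: "real \<Rightarrow> real" where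
  "\<phi> s = st (s - \<tau>) - st (5 * s + 2)"

definition J :: real where
  "J = PI (indicator {\<tau>..\<tau> + 1}) (\<lambda>x. S x * S x)"

text \<open>The coefficients are \<open>5 \<cdot> 1/2\<close> from the potential term,
  \<open>25/2 \<cdot> 5/2\<close> from the term in \<phi>'', and
  \<open>1/2 \<cdot> 5 \<cdot> 5/2\<close> times the damping from the term in \<phi>'; each factor
  5/2 stems from \<open>energy_W\<close>.\<close>

definition outer_bound :: real where
  "outer_bound = shell_mass * B * (5 / 2 * N powr (p + 1) + (125 / 4 + 25 / 4 * (2 * \<beta> + 1)) * N\<^sup>2)"

lemma st_continuous: "continuous_on UNIV st" "continuous_on UNIV st1" "continuous_on UNIV st2"
  using st by (meson DERIV_isCont continuous_at_imp_continuous_on)+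

lemma cutoff_inner:
  assumes "continuous_on UNIV g" "\<And>s. s < 0 \<or> 1 < s \<Longrightarrow> g s = 0"
  shows "cutoff (\<lambda>s. g (s - \<tau>))"
  unfolding cutoff_def
proof (intro conjI exI allI impI)
  show "continuous_on UNIV (\<lambda>s. g (s - \<tau>))"
    by (rule continuous_on_compose2[OF assms(1)]) (auto intro!: continuous_intros)
  show "ln a < \<tau>" "\<tau> + 1 < ln b" using \<tau> lnb by auto
  show "g (s - \<tau>) = 0" if "s < \<tau> \<or> \<tau> + 1 < s" for s using that by (intro assms(2)) auto
qed

lemma cutoff_outer:
  assumes "continuous_on UNIV g" "\<And>s. s < 0 \<or> 1 < s \<Longrightarrow> g s = 0"
  shows "cutoff (\<lambda>s. g (5 * s + 2))" "cutoff (\<lambda>s. c * g (5 * s + 2))"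
proof -
  have "continuous_on UNIV (\<lambda>s. g (5 * s + 2))"
    by (rule continuous_on_compose2[OF assms(1)]) (auto intro!: continuous_intros)
  moreover have "ln a < - 2 / 5" "- 1 / 5 < ln b" using \<tau> lnb by auto
  moreover have "g (5 * s + 2) = 0" if "s < - 2 / 5 \<or> - 1 / 5 < s" for s
    using that by (intro assms(2)) auto
  ultimately have *: "cutoff (\<lambda>s. c * g (5 * s + 2))" for c
    unfolding cutoff_def
    by (intro conjI continuous_intros, simp, rule_tac exI[of _ "- 2 / 5"], rule_tac exI[of _ "- 1 / 5"]) auto
  from *[of c] *[of 1] show "cutoff (\<lambda>s. g (5 * s + 2))" "cutoff (\<lambda>s. c * g (5 * s + 2))"
    by simp_all
qed

lemma cutoffs:
  "cutoff (\<lambda>s. st1 (s - \<tau>))" "cutoff (\<lambda>s. st2 (s - \<tau>))" "cutoff (\<lambda>s. st3 (s - \<tau>))"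
  "cutoff (\<lambda>s. st1 (5 * s + 2))" "cutoff (\<lambda>s. st2 (5 * s + 2))" "cutoff (\<lambda>s. st3 (5 * s + 2))"
  using st_continuous st(4) st_supp by (auto intro!: cutoff_inner cutoff_outer)

lemma cutoff_sum: "cutoff (\<lambda>s. g s + h s)" if cg: "cutoff g" and ch: "cutoff h" for g h
proof -
  obtain l u where 1: "ln a < l" "u < ln b" "\<And>s. s < l \<or> u < s \<Longrightarrow> g s = 0"
    using cg by (auto simp: cutoff_def)
  obtain l' u' where 2: "ln a < l'" "u' < ln b" "\<And>s. s < l' \<or> u' < s \<Longrightarrow> h s = 0"
    using ch by (auto simp: cutoff_def)
  show ?thesis unfolding cutoff_def
  proof (intro conjI exI allI impI)
    show "continuous_on UNIV (\<lambda>s. g s + h s)"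
      using cg ch by (auto simp: cutoff_def intro!: continuous_intros)
    show "ln a < min l l'" "max u u' < ln b" using 1 2 by auto
    show "g s + h s = 0" if "s < min l l' \<or> max u u' < s" for s
      using that 1(3)[of s] 2(3)[of s] by auto
  qed
qed

lemma DERIV_inner:
  assumes "\<And>s. (g has_real_derivative g' s) (at s)"
  shows "((\<lambda>s. g (s - \<tau>)) has_real_derivative g' (s - \<tau>)) (at s)"
proof -
  have "((\<lambda>s. s - \<tau>) has_real_derivative 1) (at s)" by (auto intro!: derivative_eq_intros)
  from DERIV_chain2[OF assms this] show ?thesis by simp
qed

lemma DERIV_outer:
  assumes "\<And>s. (g has_real_derivative g' s) (at s)"
  shows "((\<lambda>s. g (5 * s + 2)) has_real_derivative 5 * g' (5 * s + 2)) (at s)"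
proof -
  have "((\<lambda>s. 5 * s + 2) has_real_derivative 5) (at s)" by (auto intro!: derivative_eq_intros)
  from DERIV_chain2[OF assms this] show ?thesis by (simp add: mult.commute)
qed

lemma cutoff_\<phi>: "cutoff \<phi>"
  unfolding cutoff_def
proof (intro conjI exI allI impI)
  have "continuous_on UNIV (\<lambda>s. st (s - \<tau>))" "continuous_on UNIV (\<lambda>s. st (5 * s + 2))"
    by (rule continuous_on_compose2[OF st_continuous(1)], auto intro!: continuous_intros)+
  then show "continuous_on UNIV \<phi>"
    unfolding \<phi>_def[abs_def] by (intro continuous_intros)
  show "ln a < \<tau>" "- 1 / 5 < ln b" using \<tau> lnb by auto
  show "\<phi> s = 0" if "s < \<tau> \<or> - 1 / 5 < s" for s
    using that
  proof
    assume "s < \<tau>"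
    then show ?thesis using \<tau> by (simp add: \<phi>_def st_values(1))
  next
    assume "- 1 / 5 < s"
    then show ?thesis using \<tau> by (simp add: \<phi>_def st_values(2))
  qed
qed

text \<open>Because \<open>\<tau> + 1 \<le> - 2 / 5\<close> the two steps do not overlap: at each
  point the outer one is still 0 or the inner one already 1.\<close>

lemma \<phi>_bounds: "0 \<le> \<phi> s" "\<tau> + 1 \<le> s \<Longrightarrow> s \<le> - 2 / 5 \<Longrightarrow> \<phi> s = 1" "\<bar>\<phi> s\<bar> \<le> 1"
proof -
  show 0: "0 \<le> \<phi> s"
  proof (cases "s \<le> - 2 / 5")
    case True
    then show ?thesis using st_values(1)[of "5 * s + 2"] st_values(3) by (simp add: \<phi>_def)
  next
    case False
    then show ?thesis using st_values(2)[of "s - \<tau>"] st_values(4) \<tau> by (simp add: \<phi>_def)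
  qed
  show "\<tau> + 1 \<le> s \<Longrightarrow> s \<le> - 2 / 5 \<Longrightarrow> \<phi> s = 1"
    using st_values(1)[of "5 * s + 2"] st_values(2)[of "s - \<tau>"] by (simp add: \<phi>_def)
  show "\<bar>\<phi> s\<bar> \<le> 1"
    using 0 st_values(3)[of "5 * s + 2"] st_values(4)[of "s - \<tau>"] by (simp add: \<phi>_def)
qed

lemma integrable_powr: "integrable MA (\<lambda>x. W x powr (p + 1))"
proof (rule Bochner_Integration.integrable_bound)
  show "integrable MA (\<lambda>x. 1 + (W x)\<^sup>2)" using L2_integrable_square[OF L2s(1)] by simp
  show "AE x in MA. norm (W x powr (p + 1)) \<le> norm (1 + (W x)\<^sup>2)"
    using W_nonneg
  proof eventually_elim
    case (elim x)
    show ?case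
    proof (cases "W x \<le> 1")
      case True
      then have "W x powr (p + 1) \<le> 1" using powr_mono2[of "p + 1" "W x" 1] elim p by simp
      then show ?thesis by (simp add: add_increasing2)
    next
      case False
      then have "W x powr (p + 1) \<le> W x powr 2" using p by (intro powr_mono) auto
      then show ?thesis using False by simp
    qed
  qed
qed (rule powr_measurable)

lemmas ints = L2_integrable_mult[OF L2s(1,1)] L2_integrable_mult[OF L2s(1,2)] L2_integrable_mult[OF L2s(2,2)]
  integrable_powr

lemma c_bounds: "1 \<le> 2 * \<beta> + \<epsilon>" "2 * \<beta> + \<epsilon> \<le> 2 * \<beta> + 1" "0 \<le> \<beta> * (\<beta> + \<epsilon>)" "\<beta> * (\<beta> + \<epsilon>) \<le> \<beta> * (\<beta> + 1)"
proof -
  have "2 \<le> \<beta>" unfolding \<beta> using p by (simp add: le_divide_eq)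
  moreover have "- 1 < \<epsilon>" "\<epsilon> < 1" using \<epsilon> by auto
  ultimately show "1 \<le> 2 * \<beta> + \<epsilon>" "2 * \<beta> + \<epsilon> \<le> 2 * \<beta> + 1" "0 \<le> \<beta> * (\<beta> + \<epsilon>)" "\<beta> * (\<beta> + \<epsilon>) \<le> \<beta> * (\<beta> + 1)"
    by (auto intro!: mult_left_mono)
qed

lemma inner_WW:
  assumes "\<And>s. \<bar>\<psi> s\<bar> \<le> C" "\<And>s. s < \<tau> \<or> \<tau> + 1 < s \<Longrightarrow> \<psi> s = 0"
  shows "\<bar>PI \<psi> (\<lambda>x. W x * W x)\<bar> \<le> C * (K\<^sup>2 * shell_mass)"
proof (rule PI_shell_bound[OF assms])
  show "AE x in MA. \<tau> \<le> ln (norm x) \<and> ln (norm x) \<le> \<tau> + 1 \<longrightarrow> \<bar>W x * W x\<bar> \<le> K\<^sup>2"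
    using K(2) W_nonneg by eventually_elim (auto simp: power2_eq_square intro!: mult_mono)
qed auto

lemma outer_facts:
  assumes "\<And>s. \<bar>g s\<bar> \<le> B" "\<And>s. s < 0 \<or> 1 < s \<Longrightarrow> g s = 0"
  shows "\<bar>PI (\<lambda>s. g (5 * s + 2)) (\<lambda>x. W x * W x)\<bar> \<le> B * (N\<^sup>2 * shell_mass)"
    and "\<bar>PI (\<lambda>s. g (5 * s + 2)) (\<lambda>x. W x powr (p + 1))\<bar> \<le> B * (N powr (p + 1) * shell_mass)"
proof -
  have *: "\<bar>PI (\<lambda>s. g (5 * s + 2)) F\<bar> \<le> B * (M * shell_mass)"
    if "0 \<le> M" "AE x in MA. - 2 / 5 \<le> ln (norm x) \<and> ln (norm x) \<le> - 1 / 5 \<longrightarrow> \<bar>F x\<bar> \<le> M" for F M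
  proof -
    \<comment> \<open>\<open>PI_shell_bound\<close> speaks of shells of logarithmic width 1, whereas
      the outer one has width 1/5; beyond it the weight vanishes, so \<open>F\<close> may be
      replaced by 0 there.\<close>
    have "PI (\<lambda>s. g (5 * s + 2)) F = PI (\<lambda>s. g (5 * s + 2)) (\<lambda>x. if ln (norm x) \<le> - 1 / 5 then F x else 0)"
      unfolding PI_def using assms(2) by (intro Bochner_Integration.integral_cong) auto
    also have "\<bar>\<dots>\<bar> \<le> B * (M * shell_mass)"
    proof (rule PI_shell_bound[where \<sigma>="- 2 / 5"])
      show "AE x in MA. - 2 / 5 \<le> ln (norm x) \<and> ln (norm x) \<le> - 2 / 5 + 1 \<longrightarrow>
          \<bar>if ln (norm x) \<le> - 1 / 5 then F x else 0\<bar> \<le> M"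
        using that(2) by eventually_elim (use that(1) in auto)
    qed (use assms that in auto)
    finally show ?thesis .
  qed
  show "\<bar>PI (\<lambda>s. g (5 * s + 2)) (\<lambda>x. W x * W x)\<bar> \<le> B * (N\<^sup>2 * shell_mass)"
  proof (rule *)
    show "AE x in MA. - 2 / 5 \<le> ln (norm x) \<and> ln (norm x) \<le> - 1 / 5 \<longrightarrow> \<bar>W x * W x\<bar> \<le> N\<^sup>2"
      using N(2) W_nonneg by eventually_elim (auto simp: power2_eq_square intro!: mult_mono)
  qed simp
  show "\<bar>PI (\<lambda>s. g (5 * s + 2)) (\<lambda>x. W x powr (p + 1))\<bar> \<le> B * (N powr (p + 1) * shell_mass)"
  proof (rule *)
    show "AE x in MA. - 2 / 5 \<le> ln (norm x) \<and> ln (norm x) \<le> - 1 / 5 \<longrightarrow> \<bar>W x powr (p + 1)\<bar> \<le> N powr (p + 1)"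
      using N(2) W_nonneg by eventually_elim (use p in \<open>auto intro!: powr_mono2\<close>)
  qed simp
qed

text \<open>Where \<phi> decreases, the term in \<open>S\<^sup>2\<close> is nonpositive and is
  dropped, and the terms in \<open>W S\<close> become \<open>W\<^sup>2\<close> by
  \<open>energy_W\<close>. Where it increases, the potential term is dropped instead. The inner
  terms are kept, to be bounded in two different ways.\<close>

lemma PI_\<phi>_le:
  "PI \<phi> (\<lambda>x. S x * S x) \<le> outer_bound + PI (\<lambda>s. st1 (s - \<tau>)) (\<lambda>x. S x * S x)
    + \<bar>PI (\<lambda>s. st2 (s - \<tau>)) (\<lambda>x. W x * S x)\<bar> + (2 * \<beta> + 1) * \<bar>PI (\<lambda>s. st1 (s - \<tau>)) (\<lambda>x. W x * S x)\<bar>"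
proof -
  define c where "c = 2 * \<beta> + \<epsilon>"
  define \<kappa> where "\<kappa> = 1 / (p + 1) - 1 / 2"
  have c: "1 \<le> c" "c \<le> 2 * \<beta> + 1" using c_bounds by (auto simp: c_def)
  have \<kappa>: "0 \<le> \<kappa>" "\<kappa> \<le> 1 / 2" using p by (auto simp: \<kappa>_def divide_simps)
  define r1 r2 f1 f2 f3 where "r1 s = st1 (s - \<tau>)" and "r2 s = st2 (s - \<tau>)" and "f1 s = st1 (5 * s + 2)"
    and "f2 s = st2 (5 * s + 2)" and "f3 s = st3 (5 * s + 2)" for s
  have cut: "cutoff r1" "cutoff r2" "cutoff f1" "cutoff f2" "cutoff f3"
    using cutoffs unfolding r1_def r2_def f1_def f2_def f3_def by blast+
  have cutm: "cutoff (\<lambda>s. k * f1 s)" "cutoff (\<lambda>s. k * f2 s)" "cutoff (\<lambda>s. k * f3 s)" for k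
    unfolding f1_def f2_def f3_def using st_continuous st(4) st_supp by (auto intro!: cutoff_outer(2))
  have d\<phi>: "(\<phi> has_real_derivative r1 s + (- 5) * f1 s) (at s)" for s
    using DERIV_diff[OF DERIV_inner[OF st(1), of s] DERIV_outer[OF st(1), of s]]
    unfolding \<phi>_def[abs_def] r1_def f1_def by simp
  have df: "(f1 has_real_derivative 5 * f2 s) (at s)" "(f2 has_real_derivative 5 * f3 s) (at s)" for s
    unfolding f1_def[abs_def] f2_def[abs_def] f3_def
    by (rule DERIV_outer[OF st(2)], rule DERIV_outer[OF st(3)])
  have d\<phi>': "((\<lambda>s. r1 s + (- 5) * f1 s) has_real_derivative r2 s + (- 25) * f2 s) (at s)" for s
  proof -
    have "(r1 has_real_derivative r2 s) (at s)"
      unfolding r1_def[abs_def] r2_def by (rule DERIV_inner[OF st(2)])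
    from DERIV_add[OF this DERIV_cmult[OF df(1), of "- 5"]] show ?thesis by simp
  qed
  have lin: "PI (\<lambda>s. r1 s + (- 5) * f1 s) F = PI r1 F - 5 * PI f1 F"
    "PI (\<lambda>s. r2 s + (- 25) * f2 s) F = PI r2 F - 25 * PI f2 F" if "integrable MA F" for F
    unfolding PI_add_weight[OF cut(1) cutm(1)[of "- 5"] that] PI_add_weight[OF cut(2) cutm(2)[of "- 25"] that]
      PI_mult_weight by simp_all
  note id = energy_identity[OF d\<phi> cutoff_\<phi> cutoff_sum[OF cut(1) cutm(1)] d\<phi>' cutoff_sum[OF cut(2) cutm(2)],
      unfolded lin[OF ints(2)] lin[OF ints(3)] lin[OF ints(4)], folded c_def \<kappa>_def]
  have SS: "0 \<le> PI f1 (\<lambda>x. S x * S x)" unfolding f1_def by (intro PI_nonneg) (auto simp: st_values)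
  have \<Phi>: "0 \<le> PI \<phi> (\<lambda>x. S x * S x)" by (intro PI_nonneg) (auto simp: \<phi>_bounds)
  have rW: "0 \<le> PI r1 (\<lambda>x. W x powr (p + 1))" unfolding r1_def by (intro PI_nonneg) (auto simp: st_values)
  have fW: "PI f1 (\<lambda>x. W x powr (p + 1)) \<le> B * (N powr (p + 1) * shell_mass)"
    unfolding f1_def using outer_facts(2)[of st1] B(2) st_supp by fastforce
  have WW: "\<bar>PI f2 (\<lambda>x. W x * W x)\<bar> \<le> B * (N\<^sup>2 * shell_mass)" "\<bar>PI f3 (\<lambda>x. W x * W x)\<bar> \<le> B * (N\<^sup>2 * shell_mass)"
    unfolding f2_def f3_def using outer_facts(1) B(2) st_supp by blast+
  have e1: "PI f1 (\<lambda>x. W x * S x) = - (5 / 2) * PI f2 (\<lambda>x. W x * W x)"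
    using energy_W[OF df(1) cut(3) cutm(2)] by (simp add: PI_mult_weight)
  have e2: "PI f2 (\<lambda>x. W x * S x) = - (5 / 2) * PI f3 (\<lambda>x. W x * W x)"
    using energy_W[OF df(2) cut(4) cutm(3)] by (simp add: PI_mult_weight)
  have X: "0 \<le> B * (N powr (p + 1) * shell_mass)" "0 \<le> B * (N\<^sup>2 * shell_mass)"
    using B(1) shell_mass_nonneg by simp_all
  have t1: "- (\<kappa> * (PI r1 (\<lambda>x. W x powr (p + 1)) - 5 * PI f1 (\<lambda>x. W x powr (p + 1)))) \<le> 5 / 2 * (B * (N powr (p + 1) * shell_mass))"
  proof -
    have "\<kappa> * PI f1 (\<lambda>x. W x powr (p + 1)) \<le> 1 / 2 * (B * (N powr (p + 1) * shell_mass))"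
      using \<kappa> X(1) fW by (meson mult_left_mono mult_right_mono order_trans)
    moreover have "0 \<le> \<kappa> * PI r1 (\<lambda>x. W x powr (p + 1))" using \<kappa>(1) rW by simp
    ultimately show ?thesis by (simp add: algebra_simps)
  qed
  have t2: "c / 2 * (5 * PI f1 (\<lambda>x. W x * S x)) \<le> 25 / 4 * ((2 * \<beta> + 1) * (B * (N\<^sup>2 * shell_mass)))"
  proof -
    have "c * (- PI f2 (\<lambda>x. W x * W x)) \<le> (2 * \<beta> + 1) * (B * (N\<^sup>2 * shell_mass))"
      using c WW(1) X(2) by (intro mult_mono_upper_nonneg) auto
    moreover have "c / 2 * (5 * x) = 25 / 4 * (c * - y)" if "x = - (5 / 2) * y" for x y :: real
      unfolding that by simp
    note this[OF e1]
    ultimately show ?thesis by linarith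
  qed
  have t3: "- (c / 2 * PI r1 (\<lambda>x. W x * S x)) \<le> (2 * \<beta> + 1) * \<bar>PI r1 (\<lambda>x. W x * S x)\<bar>"
  proof -
    have "(c / 2) * (- PI r1 (\<lambda>x. W x * S x)) \<le> (c / 2) * \<bar>PI r1 (\<lambda>x. W x * S x)\<bar>"
      using c by (intro mult_left_mono) auto
    also have "\<dots> \<le> (2 * \<beta> + 1) * \<bar>PI r1 (\<lambda>x. W x * S x)\<bar>"
      using c by (intro mult_right_mono) auto
    finally show ?thesis by simp
  qed
  have t4: "- (25 / 2 * PI f2 (\<lambda>x. W x * S x)) \<le> 125 / 4 * (B * (N\<^sup>2 * shell_mass))"
    using e2 WW(2) by linarith
  have "PI \<phi> (\<lambda>x. S x * S x) \<le> c * PI \<phi> (\<lambda>x. S x * S x)" using c(1) \<Phi> by (simp add: mult_le_cancel_right1)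
  also have "\<dots> \<le> 5 / 2 * (B * (N powr (p + 1) * shell_mass)) + 25 / 4 * ((2 * \<beta> + 1) * (B * (N\<^sup>2 * shell_mass)))
    + 125 / 4 * (B * (N\<^sup>2 * shell_mass)) + PI r1 (\<lambda>x. S x * S x) + \<bar>PI r2 (\<lambda>x. W x * S x)\<bar>
    + (2 * \<beta> + 1) * \<bar>PI r1 (\<lambda>x. W x * S x)\<bar>"
  proof -
    have "A1 - 5 * A2 - P + (R2 - 25 * F2) / 2 - (Q1 - Q2) \<le> 5 / 2 * Y1 + 25 / 4 * Y2 + 125 / 4 * Y3 + A1 + \<bar>R2\<bar> + Z"
      if "- P \<le> 5 / 2 * Y1" "Q2 \<le> 25 / 4 * Y2" "- Q1 \<le> Z" "- (25 / 2 * F2) \<le> 125 / 4 * Y3" "0 \<le> A2"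
      for A1 A2 P R2 F2 Q1 Q2 Y1 Y2 Y3 Z :: real
      using that abs_ge_self[of R2] abs_ge_zero[of R2] by (simp add: field_simps)
    from this[OF t1 t2 t3 t4 SS] show ?thesis unfolding id right_diff_distrib[of "c / 2"] .
  qed
  also have "\<dots> = outer_bound + PI r1 (\<lambda>x. S x * S x) + \<bar>PI r2 (\<lambda>x. W x * S x)\<bar>
    + (2 * \<beta> + 1) * \<bar>PI r1 (\<lambda>x. W x * S x)\<bar>"
    by (simp add: outer_bound_def field_simps)
  finally show ?thesis unfolding r1_def r2_def .
qed

text \<open>\<open>energy_upper\<close> with the nonnegative weight \<phi>' on the inner shell
  controls \<open>S\<^sup>2\<close> there by \<open>W\<^sup>2\<close>, hence by
  \<open>K\<^sup>2\<close>. The bound does not depend on \<tau>, which gives finiteness as the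
  shells shrink.\<close>

lemma PI_\<phi>_bounded:
  "PI \<phi> (\<lambda>x. S x * S x) \<le> outer_bound + (2 * (2 * \<beta> + 1) + 1 + \<beta> * (\<beta> + 1)) * (B * (K\<^sup>2 * shell_mass))"
proof -
  define r1 r2 r3 where "r1 s = st1 (s - \<tau>)" and "r2 s = st2 (s - \<tau>)" and "r3 s = st3 (s - \<tau>)" for s
  have cut: "cutoff r1" "cutoff r2" "cutoff r3" using cutoffs unfolding r1_def r2_def r3_def by blast+
  have dr: "(r1 has_real_derivative r2 s) (at s)" "(r2 has_real_derivative r3 s) (at s)" for s
    unfolding r1_def[abs_def] r2_def[abs_def] r3_def by (rule DERIV_inner[OF st(2)], rule DERIV_inner[OF st(3)])
  define X where "X = B * (K\<^sup>2 * shell_mass)"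
  have X: "0 \<le> X" using B(1) shell_mass_nonneg by (simp add: X_def)
  have WW: "\<bar>PI r1 (\<lambda>x. W x * W x)\<bar> \<le> X" "\<bar>PI r2 (\<lambda>x. W x * W x)\<bar> \<le> X" "\<bar>PI r3 (\<lambda>x. W x * W x)\<bar> \<le> X"
  proof -
    have "\<bar>PI (\<lambda>s. g (s - \<tau>)) (\<lambda>x. W x * W x)\<bar> \<le> X"
      if "\<And>s. \<bar>g s\<bar> \<le> B" "\<And>s. s < 0 \<or> 1 < s \<Longrightarrow> g s = 0" for g
      unfolding X_def by (rule inner_WW) (auto intro: that)
    from this[of st1] this[of st2] this[of st3] B(2) st_supp
    show "\<bar>PI r1 (\<lambda>x. W x * W x)\<bar> \<le> X" "\<bar>PI r2 (\<lambda>x. W x * W x)\<bar> \<le> X" "\<bar>PI r3 (\<lambda>x. W x * W x)\<bar> \<le> X"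
      unfolding r1_def r2_def r3_def by blast+
  qed
  have e1: "\<bar>PI r1 (\<lambda>x. W x * S x)\<bar> \<le> X / 2" and e2: "\<bar>PI r2 (\<lambda>x. W x * S x)\<bar> \<le> X / 2"
    using energy_W[OF dr(1) cut(1,2)] energy_W[OF dr(2) cut(2,3)] WW by linarith+
  have "0 \<le> (1 + \<epsilon>) * PI r1 (\<lambda>x. T x * T x)"
    using \<epsilon> unfolding r1_def by (intro mult_nonneg_nonneg PI_nonneg) (auto simp: st_values)
  moreover have "0 \<le> PI r1 (\<lambda>x. W x powr (p + 1))" unfolding r1_def by (intro PI_nonneg) (auto simp: st_values)
  moreover have "(2 * \<beta> + \<epsilon>) * PI r1 (\<lambda>x. W x * S x) \<le> (2 * \<beta> + 1) * (X / 2)"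
    using c_bounds e1 X by (intro mult_mono_upper_nonneg) auto
  moreover have "\<beta> * (\<beta> + \<epsilon>) * PI r1 (\<lambda>x. W x * W x) \<le> \<beta> * (\<beta> + 1) * X"
    using c_bounds WW(1) X by (intro mult_mono_upper_nonneg) auto
  ultimately have SS: "PI r1 (\<lambda>x. S x * S x) \<le> X / 2 + (2 * \<beta> + 1) * (X / 2) + \<beta> * (\<beta> + 1) * X"
    using energy_upper[OF dr(1) cut(1,2)] e2 by linarith
  have "(2 * \<beta> + 1) * \<bar>PI r1 (\<lambda>x. W x * S x)\<bar> \<le> (2 * \<beta> + 1) * (X / 2)"
    using e1 c_bounds by (intro mult_left_mono) auto
  then have "PI \<phi> (\<lambda>x. S x * S x) \<le> outer_bound + (X / 2 + (2 * \<beta> + 1) * (X / 2) + \<beta> * (\<beta> + 1) * X) + X / 2 + (2 * \<beta> + 1) * (X / 2)"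
    using PI_\<phi>_le SS e2 unfolding r1_def r2_def by linarith
  also have "\<dots> \<le> outer_bound + (2 * (2 * \<beta> + 1) + 1 + \<beta> * (\<beta> + 1)) * X"
    using X c_bounds by (simp add: algebra_simps)
  finally show ?thesis by (simp add: X_def)
qed

text \<open>Here the inner terms are expressed through the mass \<open>J\<close> of the shell
  itself. Young's inequality with parameter \<delta> puts a small factor on \<open>K\<close>, so
  that only \<open>outer_bound\<close> is left once \<open>J\<close>, and then \<delta>, become
  small.\<close>

lemma PI_\<phi>_small:
  assumes \<delta>: "0 < \<delta>"
  shows "PI \<phi> (\<lambda>x. S x * S x) \<le> outer_bound + B * J + (2 * \<beta> + 2) * (B * (\<delta> * (K\<^sup>2 * shell_mass) + J / \<delta>))"
proof -
  let ?I = "indicator {\<tau>..\<tau> + 1} :: real \<Rightarrow> real"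
  have I: "?I \<in> borel_measurable borel" "\<And>s. \<bar>?I s\<bar> \<le> 1" by (auto simp: indicator_def)
  have g: "\<bar>g (ln (norm x) - \<tau>) * F\<bar> \<le> ?I (ln (norm x)) * (B * G)"
    if "\<And>s. \<bar>g s\<bar> \<le> B" "\<And>s. s < 0 \<or> 1 < s \<Longrightarrow> g s = 0" "\<bar>F\<bar> \<le> G" for g F G and x :: "real^2"
  proof (cases "ln (norm x) \<in> {\<tau>..\<tau> + 1}")
    case True
    have "\<bar>g (ln (norm x) - \<tau>)\<bar> * \<bar>F\<bar> \<le> B * G" using that B(1) by (intro mult_mono) auto
    then show ?thesis using True by (simp add: abs_mult)
  next
    case False
    then have "g (ln (norm x) - \<tau>) = 0" by (intro that(2)) auto
    then show ?thesis using False by simp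
  qed
  have SS: "PI (\<lambda>s. st1 (s - \<tau>)) (\<lambda>x. S x * S x) \<le> B * J"
  proof -
    have "\<bar>PI (\<lambda>s. st1 (s - \<tau>)) (\<lambda>x. S x * S x)\<bar> \<le> PI ?I (\<lambda>x. B * (S x * S x))"
    proof (rule PI_le[OF I])
      show "integrable MA (\<lambda>x. B * (S x * S x))" using ints(3) by simp
      show "AE x in MA. \<bar>st1 (ln (norm x) - \<tau>) * (S x * S x)\<bar> \<le> ?I (ln (norm x)) * (B * (S x * S x))"
        using B(2) st_supp by (intro AE_I2 g) auto
    qed
    then show ?thesis unfolding PI_cmult J_def by linarith
  qed
  have J0: "0 \<le> J" unfolding J_def by (intro PI_nonneg) auto
  have WW: "PI ?I (\<lambda>x. W x * W x) \<le> K\<^sup>2 * shell_mass"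
  proof -
    have "\<bar>PI ?I (\<lambda>x. W x * W x)\<bar> \<le> 1 * (K\<^sup>2 * shell_mass)"
      by (rule inner_WW) (auto simp: indicator_def)
    then show ?thesis by linarith
  qed
  have WS: "\<bar>PI (\<lambda>s. g (s - \<tau>)) (\<lambda>x. W x * S x)\<bar> \<le> B * (\<delta> * (K\<^sup>2 * shell_mass) + J / \<delta>)"
    if g': "\<And>s. \<bar>g s\<bar> \<le> B" "\<And>s. s < 0 \<or> 1 < s \<Longrightarrow> g s = 0" for g
  proof -
    let ?G = "\<lambda>x. \<delta> * (W x * W x) + (1 / \<delta>) * (S x * S x)"
    have i: "integrable MA (\<lambda>x. \<delta> * (W x * W x))" "integrable MA (\<lambda>x. (1 / \<delta>) * (S x * S x))"
      using ints(1,3) by (auto intro!: integrable_mult_right)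
    have y: "\<bar>W x * S x\<bar> \<le> ?G x" for x
    proof -
      have "0 \<le> (\<delta> * \<bar>W x\<bar> - \<bar>S x\<bar>)\<^sup>2 / \<delta>" using \<delta> by simp
      also have "\<dots> = ?G x - 2 * \<bar>W x * S x\<bar>"
        using \<delta> by (simp add: power2_diff abs_mult power2_eq_square field_simps)
      finally show ?thesis by linarith
    qed
    have "\<bar>PI (\<lambda>s. g (s - \<tau>)) (\<lambda>x. W x * S x)\<bar> \<le> PI ?I (\<lambda>x. B * ?G x)"
    proof (rule PI_le[OF I])
      show "integrable MA (\<lambda>x. B * ?G x)" by (rule integrable_mult_right, rule Bochner_Integration.integrable_add[OF i])
      show "AE x in MA. \<bar>g (ln (norm x) - \<tau>) * (W x * S x)\<bar> \<le> ?I (ln (norm x)) * (B * ?G x)"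
        by (intro AE_I2 g g' y)
    qed
    also have "PI ?I (\<lambda>x. B * ?G x) = B * (\<delta> * PI ?I (\<lambda>x. W x * W x) + (1 / \<delta>) * J)"
    proof -
      have "PI ?I ?G = PI ?I (\<lambda>x. \<delta> * (W x * W x)) + PI ?I (\<lambda>x. (1 / \<delta>) * (S x * S x))"
        using weight_integrable[OF I i(1)] weight_integrable[OF I i(2)] by (simp add: PI_def distrib_left)
      then show ?thesis unfolding PI_cmult J_def by simp
    qed
    also have "\<dots> \<le> B * (\<delta> * (K\<^sup>2 * shell_mass) + J / \<delta>)"
      using B(1) \<delta> WW by (intro mult_left_mono add_mono) auto
    finally show ?thesis .
  qed
  have a1: "\<bar>PI (\<lambda>s. st1 (s - \<tau>)) (\<lambda>x. W x * S x)\<bar> \<le> B * (\<delta> * (K\<^sup>2 * shell_mass) + J / \<delta>)"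
    and a2: "\<bar>PI (\<lambda>s. st2 (s - \<tau>)) (\<lambda>x. W x * S x)\<bar> \<le> B * (\<delta> * (K\<^sup>2 * shell_mass) + J / \<delta>)"
    using WS[of st1] WS[of st2] B(2) st_supp by blast+
  have "(2 * \<beta> + 1) * \<bar>PI (\<lambda>s. st1 (s - \<tau>)) (\<lambda>x. W x * S x)\<bar> \<le> (2 * \<beta> + 1) * (B * (\<delta> * (K\<^sup>2 * shell_mass) + J / \<delta>))"
    using a1 c_bounds by (intro mult_left_mono) auto
  then have "PI \<phi> (\<lambda>x. S x * S x) \<le> outer_bound + B * J + (B * (\<delta> * (K\<^sup>2 * shell_mass) + J / \<delta>))
     + (2 * \<beta> + 1) * (B * (\<delta> * (K\<^sup>2 * shell_mass) + J / \<delta>))"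
    using PI_\<phi>_le SS a2 by linarith
  also have "\<dots> = outer_bound + B * J + (2 * \<beta> + 2) * (B * (\<delta> * (K\<^sup>2 * shell_mass) + J / \<delta>))"
  proof -
    have "e + y + (2 * \<beta> + 1) * y = e + (2 * \<beta> + 2) * y" for e y by (simp add: algebra_simps)
    then show ?thesis by blast
  qed
  finally show ?thesis .
qed

end

section \<open>Passage to the origin\<close>

text \<open>Once the integral is known to be finite, the mass of the shells tends to \<open>0\<close>, and the second
  estimate then no longer depends on the size of the function on these shells.\<close>

lemma nn_integral_punctured_le:
  fixes h :: "real^2 \<Rightarrow> real"
  assumes h: "h \<in> borel_measurable lebesgue" "\<And>x. 0 \<le> h x" and \<rho>: "\<And>k. 0 < \<rho> k" "\<rho> \<longlonglongrightarrow> 0"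
    and E: "\<forall>\<^sub>F k in sequentially. (\<integral>\<^sup>+x. ennreal (indicator {exp 1 * \<rho> k..R} (norm x) * h x) \<partial>lebesgue) \<le> ennreal E"
    and small: "\<And>\<delta>. 0 < \<delta> \<Longrightarrow> \<forall>\<^sub>F k in sequentially. \<forall>J\<ge>0.
      (\<integral>\<^sup>+x. ennreal (indicator {\<rho> k..exp 1 * \<rho> k} (norm x) * h x) \<partial>lebesgue) = ennreal J \<longrightarrow>
      (\<integral>\<^sup>+x. ennreal (indicator {exp 1 * \<rho> k..R} (norm x) * h x) \<partial>lebesgue) \<le> ennreal (c + b * J + d * (\<delta> * e + J / \<delta>))"
    and R: "0 < R" and nn: "0 \<le> d" "0 \<le> e"
  shows "(\<integral>\<^sup>+x. ennreal (indicator {0<..R} (norm x) * h x) \<partial>lebesgue) \<le> ennreal (c + 1)"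
proof -
  define u where "u k x = indicator {exp 1 * \<rho> k..R} (norm x) * h x" for k x
  define w where "w k x = indicator {\<rho> k..exp 1 * \<rho> k} (norm x) * h x" for k x
  have nm: "(\<lambda>x::real^2. indicator I (norm x) :: real) \<in> borel_measurable lebesgue" if "I \<in> sets borel" for I
  proof -
    have "(\<lambda>x::real^2. indicator I (norm x) :: real) \<in> borel_measurable lborel"
      by (rule measurable_compose[OF _ borel_measurable_indicator[OF that]]) simp
    then show ?thesis by (rule measurable_completion)
  qed
  have um: "(\<lambda>x. ennreal (u k x)) \<in> borel_measurable lebesgue" and wm: "(\<lambda>x. ennreal (w k x)) \<in> borel_measurable lebesgue" for k
    unfolding u_def w_def using h(1) nm by (intro measurable_compose[OF _ measurable_ennreal] borel_measurable_times; simp)+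
  have gm: "(\<lambda>x. ennreal (indicator {0<..R} (norm x) * h x)) \<in> borel_measurable lebesgue"
    using h(1) nm by (intro measurable_compose[OF _ measurable_ennreal] borel_measurable_times; simp)
  have ev: "\<forall>\<^sub>F k in sequentially. exp 1 * \<rho> k < norm x" if "0 < norm x" for x :: "real^2"
  proof -
    have "(\<lambda>k. exp 1 * \<rho> k) \<longlonglongrightarrow> exp 1 * 0" by (intro tendsto_intros \<rho>)
    then show ?thesis by (rule order_tendstoD(2)) (use that in simp)
  qed
  \<comment> \<open>The shells \<open>{exp 1 * \<rho> k..R}\<close> exhaust the punctured disc. The
    bounds may vary with \<open>k\<close>, so the same argument serves for the crude estimate and
    for the sharp one.\<close>
  have fatou: "(\<integral>\<^sup>+x. ennreal (indicator {0<..R} (norm x) * h x) \<partial>lebesgue) \<le> ennreal C"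
    if le: "\<forall>\<^sub>F k in sequentially. (\<integral>\<^sup>+x. ennreal (u k x) \<partial>lebesgue) \<le> ennreal (C' k)" and C': "C' \<longlonglongrightarrow> C" for C' C
  proof -
    have "(\<integral>\<^sup>+x. ennreal (indicator {0<..R} (norm x) * h x) \<partial>lebesgue) \<le> (\<integral>\<^sup>+x. liminf (\<lambda>k. ennreal (u k x)) \<partial>lebesgue)"
    proof (rule nn_integral_mono)
      fix x :: "real^2"
      show "ennreal (indicator {0<..R} (norm x) * h x) \<le> liminf (\<lambda>k. ennreal (u k x))"
      proof (cases "0 < norm x \<and> norm x \<le> R")
        case True
        have "\<forall>\<^sub>F k in sequentially. ennreal (indicator {0<..R} (norm x) * h x) \<le> ennreal (u k x)"
          using ev[of x] True by (auto simp: u_def elim!: eventually_mono)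
        then show ?thesis by (rule Liminf_bounded)
      next
        case False
        then have "norm x \<notin> {0<..R}" by auto
        then show ?thesis by simp
      qed
    qed
    also have "\<dots> \<le> liminf (\<lambda>k. \<integral>\<^sup>+x. ennreal (u k x) \<partial>lebesgue)"
      by (rule nn_integral_liminf) (rule um)
    also have "\<dots> \<le> liminf (\<lambda>k. ennreal (C' k))" using le by (rule Liminf_mono)
    also have "\<dots> = ennreal C"
      using C' by (intro lim_imp_Liminf tendsto_ennrealI) auto
    finally show ?thesis .
  qed
  \<comment> \<open>\<open>E\<close> is used for finiteness alone and leaves no trace in the final
    bound.\<close>
  have fin: "(\<integral>\<^sup>+x. ennreal (indicator {0<..R} (norm x) * h x) \<partial>lebesgue) < \<infinity>"
    using fatou[of "\<lambda>_. E" E] E unfolding u_def by (auto simp: less_top[symmetric] top_unique)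
  have evR: "\<forall>\<^sub>F k in sequentially. exp 1 * \<rho> k < R"
  proof -
    have "(\<lambda>k. exp 1 * \<rho> k) \<longlonglongrightarrow> exp 1 * 0" by (intro tendsto_intros \<rho>)
    then show ?thesis by (rule order_tendstoD(2)) (use R in simp)
  qed
  have wle: "w k x \<le> indicator {0<..R} (norm x) * h x" if "exp 1 * \<rho> k < R" for k x
    using that \<rho>(1)[of k] h(2)[of x] by (auto simp: w_def indicator_def)
  \<comment> \<open>The domination holds once the shell lies within radius \<open>R\<close>, so the
    sequence is shifted. Each point off the origin eventually leaves the shells, hence their masses
    tend to 0.\<close>
  obtain k0 where k0: "\<And>k. k0 \<le> k \<Longrightarrow> exp 1 * \<rho> k < R" using evR by (auto simp: eventually_sequentially)
  have "(\<lambda>k. \<integral>\<^sup>+x. ennreal (w (k + k0) x) \<partial>lebesgue) \<longlonglongrightarrow> (\<integral>\<^sup>+x. 0 \<partial>(lebesgue :: (real^2) measure))"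
  proof (rule nn_integral_dominated_convergence[where w="\<lambda>x. ennreal (indicator {0<..R} (norm x) * h x)"])
    show "AE x in lebesgue. ennreal (w (k + k0) x) \<le> ennreal (indicator {0<..R} (norm x) * h x)" for k
      using wle[OF k0[of "k + k0"]] by (intro AE_I2 ennreal_leI) auto
    show "AE x in lebesgue. (\<lambda>k. ennreal (w (k + k0) x)) \<longlonglongrightarrow> 0"
    proof (rule AE_I2)
      fix x :: "real^2"
      have "\<forall>\<^sub>F k in sequentially. w k x = 0"
      proof (cases "0 < norm x")
        case True
        then show ?thesis using ev[OF True] by (auto simp: w_def indicator_def elim!: eventually_mono)
      next
        case False
        then have "x = 0" by simp
        have "w k x = 0" for k using \<rho>(1)[of k] unfolding \<open>x = 0\<close> by (simp add: w_def indicator_def)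
        then show ?thesis by simp
      qed
      then have "\<forall>\<^sub>F k in sequentially. ennreal (w k x) = 0" by eventually_elim simp
      then have "(\<lambda>k. ennreal (w k x)) \<longlonglongrightarrow> 0" by (rule tendsto_eventually)
      then show "(\<lambda>k. ennreal (w (k + k0) x)) \<longlonglongrightarrow> 0" by (rule LIMSEQ_ignore_initial_segment)
    qed
  qed (use wm gm fin in auto)
  then have wlim: "(\<lambda>k. \<integral>\<^sup>+x. ennreal (w k x) \<partial>lebesgue) \<longlonglongrightarrow> 0"
    by (simp add: LIMSEQ_offset)
  define J where "J k = enn2real (\<integral>\<^sup>+x. ennreal (w k x) \<partial>lebesgue)" for k
  have J0: "J \<longlonglongrightarrow> 0"
    unfolding J_def[abs_def] by (rule tendsto_enn2real) (use wlim in simp_all)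
  have Jeq: "\<forall>\<^sub>F k in sequentially. (\<integral>\<^sup>+x. ennreal (w k x) \<partial>lebesgue) = ennreal (J k)"
  proof -
    have "\<forall>\<^sub>F k in sequentially. (\<integral>\<^sup>+x. ennreal (w k x) \<partial>lebesgue) < 1"
      using wlim by (rule order_tendstoD(2)) simp
    then show ?thesis
    proof eventually_elim
      case (elim k)
      then show ?case using less_trans[OF elim ennreal_one_less_top] by (simp add: J_def)
    qed
  qed
  \<comment> \<open>Makes the term with \<open>e\<close> at most 1; this is the 1 added to
    \<open>c\<close> in the conclusion.\<close>
  define \<delta> where "\<delta> = 1 / (d * e + 1)"
  have de: "0 \<le> d * e" using nn by simp
  have \<delta>: "0 < \<delta>" "d * (\<delta> * e) \<le> 1" using de by (auto simp: \<delta>_def field_simps)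
  have "\<forall>\<^sub>F k in sequentially. (\<integral>\<^sup>+x. ennreal (u k x) \<partial>lebesgue) \<le> ennreal (c + b * J k + d * (\<delta> * e + J k / \<delta>))"
    using small[OF \<delta>(1)] Jeq
  proof eventually_elim
    case (elim k)
    then show ?case unfolding u_def w_def by (auto simp: J_def)
  qed
  moreover have "(\<lambda>k. c + b * J k + d * (\<delta> * e + J k / \<delta>)) \<longlonglongrightarrow> c + b * 0 + d * (\<delta> * e + 0 / \<delta>)"
    using \<delta>(1) by (intro tendsto_intros J0) auto
  ultimately have "(\<integral>\<^sup>+x. ennreal (indicator {0<..R} (norm x) * h x) \<partial>lebesgue) \<le> ennreal (c + b * 0 + d * (\<delta> * e + 0 / \<delta>))"
    by (rule fatou)
  also have "\<dots> \<le> ennreal (c + 1)" using \<delta> by (intro ennreal_leI) simp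
  finally show ?thesis .
qed

section \<open>Strong solutions in polar form\<close>

lemma polar_H1_eq:
  assumes "polar_H1 A U S T" "\<And>x. U x = U' x" "\<And>x. S x = S' x" "\<And>x. T x = T' x"
  shows "polar_H1 A U' S' T'"
  using assms by (metis ext)

lemma polar_C1_const: "polar_C1 A (\<lambda>_. c) (\<lambda>_. 0) (\<lambda>_. 0)"
  using polar_C1_chain[OF polar_C1_components(1), of "\<lambda>_. c" "\<lambda>_. 0" A] by simp

lemma polar_C1_neg_component2: "polar_C1 A (\<lambda>x. - x$2) (\<lambda>x. - x$2) (\<lambda>x. - x$1)"
proof -
  have "((\<lambda>y::real. - y) has_real_derivative - 1) (at y)" for y
    by (auto intro!: derivative_eq_intros)
  from polar_C1_chain[OF polar_C1_components(2) this continuous_on_const] show ?thesis by simp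
qed

text \<open>Passage from Cartesian to polar second derivatives by the product rule in
  \<open>polar_H1\<close>, which also shows that W_s and W_\<theta> have derivatives of the required
  kind.\<close>

lemma (in annulus) polar_solution_of_W2:
  fixes V V1 V2 V11 V12 V22 :: "real^2 \<Rightarrow> real"
  assumes V: "polar_H1 An V (\<lambda>x. x$1 * V1 x + x$2 * V2 x) (\<lambda>x. x$1 * V2 x + - x$2 * V1 x)"
    and V1: "polar_H1 An V1 (\<lambda>x. x$1 * V11 x + x$2 * V12 x) (\<lambda>x. x$1 * V12 x + - x$2 * V11 x)"
    and V2: "polar_H1 An V2 (\<lambda>x. x$1 * V12 x + x$2 * V22 x) (\<lambda>x. x$1 * V22 x + - x$2 * V12 x)"
    and p: "0 \<le> p" "p < 1" and \<beta>: "\<beta> = 2 / (1 - p)" and \<epsilon>: "\<bar>\<epsilon>\<bar> < 1"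
    and nn: "AE x in MA. 0 \<le> V x"
    and eq: "AE x in MA. (1 + \<epsilon> * (x$2)\<^sup>2 / (norm x)\<^sup>2) * V11 x - 2 * (\<epsilon> * x$1 * x$2 / (norm x)\<^sup>2) * V12 x
       + (1 + \<epsilon> * (x$1)\<^sup>2 / (norm x)\<^sup>2) * V22 x = V x powr p"
  shows "\<exists>T S\<^sub>s S\<^sub>t T\<^sub>t. polar_solution a b p \<beta> \<epsilon> (\<lambda>x. norm x powr (- \<beta>) * V x)
    (\<lambda>x. norm x powr (- \<beta>) * (x$1 * V1 x + x$2 * V2 x - \<beta> * V x)) T S\<^sub>s S\<^sub>t T\<^sub>t"
proof -
  define m where "m x = exp (- \<beta> * ln (norm x))" for x :: "real^2"
  have mp: "norm x powr (- \<beta>) = m x" if "x \<noteq> 0" for x using that by (simp add: m_def powr_def)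
  have mC: "polar_C1 An m (\<lambda>x. - \<beta> * m x) (\<lambda>_. 0)"
    unfolding m_def using An_nz(2)
    by (intro polar_C1_radial[where f="\<lambda>y. exp (- \<beta> * y)" and f'="\<lambda>y. - \<beta> * exp (- \<beta> * y)"])
      (auto intro!: derivative_eq_intros continuous_intros)
  have \<beta>0: "0 < \<beta>" using p by (simp add: \<beta>)
  have mb: "\<bar>m x\<bar> \<le> exp (- \<beta> * ln a)" if "x \<in> An" for x
    using that \<beta>0 a_pos by (auto simp: m_def An_def intro!: ln_mono)
  \<comment> \<open>A common bound for all multipliers below: the coordinates, the constant \<beta>,
    \<open>m\<close> and its derivative.\<close>
  define M where "M = max 1 (max \<beta> ((1 + \<beta>) * exp (- \<beta> * ln a)))"
  have mM: "\<bar>m x\<bar> \<le> M" "\<bar>- \<beta> * m x\<bar> \<le> M" if "x \<in> An" for x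
  proof -
    have "\<beta> * \<bar>m x\<bar> \<le> \<beta> * exp (- \<beta> * ln a)" using mb[OF that] \<beta>0 by (intro mult_left_mono) auto
    then have "(1 + \<beta>) * exp (- \<beta> * ln a) \<ge> \<bar>m x\<bar> + \<beta> * \<bar>m x\<bar>" using mb[OF that] by (simp add: algebra_simps)
    moreover have "0 \<le> \<beta> * \<bar>m x\<bar>" using \<beta>0 by simp
    moreover have "(1 + \<beta>) * exp (- \<beta> * ln a) \<le> M" by (simp add: M_def)
    moreover have "\<bar>- \<beta> * m x\<bar> = \<beta> * \<bar>m x\<bar>" using \<beta>0 by (simp add: abs_mult)
    ultimately show "\<bar>m x\<bar> \<le> M" "\<bar>- \<beta> * m x\<bar> \<le> M" by linarith+
  qed
  have mM': "\<bar>\<beta> * m x\<bar> \<le> M" if "x \<in> An" for x using mM(2)[OF that] by simp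
  have M: "1 \<le> M" "0 \<le> M" "\<beta> \<le> M" by (auto simp: M_def)
  have xM: "\<bar>x$i\<bar> \<le> M" "\<bar>- x$i\<bar> \<le> M" if "x \<in> An" for x i
    using An_bounds[OF that, of i] M by auto
  note hm = polar_H1_mult[where B=M]
  define E F where "E x = x$1 * V1 x + x$2 * V2 x" and "F x = x$1 * V2 x + - x$2 * V1 x" for x
  \<comment> \<open>\<open>Q\<close> and \<open>R\<close> are the Hessian evaluated on
    \<open>x\<close> and on its rotation by a right angle, and \<open>P\<close>, defined next, is
    the mixed value; they are \<open>|x|\<^sup>2\<close> times the radial, tangential and mixed
    second derivatives.\<close>
  define Q R where "Q x = (x$1)\<^sup>2 * V11 x + 2 * x$1 * x$2 * V12 x + (x$2)\<^sup>2 * V22 x"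
    and "R x = (x$1)\<^sup>2 * V22 x - 2 * x$1 * x$2 * V12 x + (x$2)\<^sup>2 * V11 x" for x
  define P where "P x = x$1 * (x$1 * V12 x + - x$2 * V11 x) + x$2 * (x$1 * V22 x + - x$2 * V12 x)" for x
  have c1: "polar_H1 An (\<lambda>x. x$1 * V1 x) (\<lambda>x. x$1 * V1 x + x$1 * (x$1 * V11 x + x$2 * V12 x))
      (\<lambda>x. - x$2 * V1 x + x$1 * (x$1 * V12 x + - x$2 * V11 x))"
    by (rule hm[OF polar_C1_components(1) V1]) (auto simp: xM simp del: abs_minus_cancel)
  have c2: "polar_H1 An (\<lambda>x. x$2 * V2 x) (\<lambda>x. x$2 * V2 x + x$2 * (x$1 * V12 x + x$2 * V22 x))
      (\<lambda>x. x$1 * V2 x + x$2 * (x$1 * V22 x + - x$2 * V12 x))"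
    by (rule hm[OF polar_C1_components(2) V2]) (auto simp: xM)
  have c3: "polar_H1 An (\<lambda>x. x$1 * V2 x) (\<lambda>x. x$1 * V2 x + x$1 * (x$1 * V12 x + x$2 * V22 x))
      (\<lambda>x. - x$2 * V2 x + x$1 * (x$1 * V22 x + - x$2 * V12 x))"
    by (rule hm[OF polar_C1_components(1) V2]) (auto simp: xM simp del: abs_minus_cancel)
  have c4: "polar_H1 An (\<lambda>x. - x$2 * V1 x) (\<lambda>x. - x$2 * V1 x + - x$2 * (x$1 * V11 x + x$2 * V12 x))
      (\<lambda>x. - x$1 * V1 x + - x$2 * (x$1 * V12 x + - x$2 * V11 x))"
    by (rule hm[OF polar_C1_neg_component2 V1]) (auto simp: xM simp del: abs_minus_cancel)
  have c5: "polar_H1 An (\<lambda>x. - \<beta> * V x) (\<lambda>x. 0 * V x + - \<beta> * E x) (\<lambda>x. 0 * V x + - \<beta> * F x)"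
    unfolding E_def F_def by (rule hm[OF polar_C1_const V]) (use M \<beta>0 in auto)
  have HE: "polar_H1 An (\<lambda>x. E x - \<beta> * V x) (\<lambda>x. E x + Q x - \<beta> * E x) (\<lambda>x. F x + P x - \<beta> * F x)"
    by (rule polar_H1_eq[OF polar_H1_add[OF polar_H1_add[OF c1 c2] c5]])
      (auto simp: E_def F_def Q_def P_def power2_eq_square algebra_simps)
  have HF: "polar_H1 An F (\<lambda>x. F x + P x) (\<lambda>x. R x - E x)"
    by (rule polar_H1_eq[OF polar_H1_add[OF c3 c4]])
      (auto simp: E_def F_def R_def P_def power2_eq_square algebra_simps)
  define W S T S\<^sub>s S\<^sub>t T\<^sub>t where "W x = m x * V x" and "S x = m x * (E x - \<beta> * V x)" and "T x = m x * F x"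
    and "S\<^sub>s x = - \<beta> * m x * (E x - \<beta> * V x) + m x * (E x + Q x - \<beta> * E x)"
    and "S\<^sub>t x = m x * (F x + P x - \<beta> * F x)" and "T\<^sub>t x = m x * (R x - E x)" for x
  have HW: "polar_H1 An W S T"
    by (rule polar_H1_eq[OF hm[OF mC V]]) (auto simp: mM mM' M W_def S_def T_def E_def F_def algebra_simps simp del: mult_minus_left)
  have HS: "polar_H1 An S S\<^sub>s S\<^sub>t"
    by (rule polar_H1_eq[OF hm[OF mC HE]]) (auto simp: mM mM' M S_def S\<^sub>s_def S\<^sub>t_def simp del: mult_minus_left)
  have HT: "polar_H1 An T S\<^sub>t T\<^sub>t"
    by (rule polar_H1_eq[OF hm[OF mC HF]]) (auto simp: mM mM' M T_def S\<^sub>t_def T\<^sub>t_def algebra_simps simp del: mult_minus_left)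
  have "AE x in MA. S\<^sub>s x + (2 * \<beta> + \<epsilon>) * S x + \<beta> * (\<beta> + \<epsilon>) * W x + (1 + \<epsilon>) * T\<^sub>t x = W x powr p"
    using eq nn AE_space
  proof eventually_elim
    case (elim x)
    then have x: "x \<noteq> 0" using An_nz by (auto simp: space_MA)
    define n where "n = (norm x)\<^sup>2"
    have n: "n \<noteq> 0" "n = (x$1)\<^sup>2 + (x$2)\<^sup>2" using x norm2_power2[of x] by (auto simp: n_def)
    have "n * V x powr p = n * ((1 + \<epsilon> * (x$2)\<^sup>2 / n) * V11 x - 2 * (\<epsilon> * x$1 * x$2 / n) * V12 x
       + (1 + \<epsilon> * (x$1)\<^sup>2 / n) * V22 x)"
      using elim by (simp add: n_def)
    also have "\<dots> = (n + \<epsilon> * (x$2)\<^sup>2) * V11 x - 2 * (\<epsilon> * x$1 * x$2) * V12 x + (n + \<epsilon> * (x$1)\<^sup>2) * V22 x"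
      using n(1) by (simp add: field_simps)
    also have "\<dots> = Q x + (1 + \<epsilon>) * R x"
      unfolding n(2) Q_def R_def by (simp add: algebra_simps)
    finally have 1: "Q x + (1 + \<epsilon>) * R x = n * V x powr p" by simp
    \<comment> \<open>All terms in \<open>E\<close> and \<open>V\<close> cancel: the coefficients
      \<open>2 \<beta> + \<epsilon>\<close> and \<open>\<beta> (\<beta> + \<epsilon>)\<close> are
      exactly those that achieve this.\<close>
    have "S\<^sub>s x + (2 * \<beta> + \<epsilon>) * S x + \<beta> * (\<beta> + \<epsilon>) * W x + (1 + \<epsilon>) * T\<^sub>t x = m x * (Q x + (1 + \<epsilon>) * R x)"
      unfolding S\<^sub>s_def S_def W_def T\<^sub>t_def by (simp add: algebra_simps)
    also have "\<dots> = (m x * n) * V x powr p" unfolding 1 by simp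
    \<comment> \<open>The homogeneity that fixes \<beta>: \<open>2 - \<beta> = - \<beta> p\<close>,
      so the equation becomes autonomous.\<close>
    also have "m x * n = m x powr p"
    proof -
      have "n = exp (2 * ln (norm x))" using x by (simp add: n_def exp_double)
      then have "m x * n = exp ((2 - \<beta>) * ln (norm x))" by (simp add: m_def left_diff_distrib flip: exp_add)
      also have "2 - \<beta> = - \<beta> * p" unfolding \<beta> using p by (simp add: field_simps)
      also have "exp (- \<beta> * p * ln (norm x)) = m x powr p" by (simp add: m_def powr_def mult_ac)
      finally show ?thesis .
    qed
    also have "m x powr p * V x powr p = W x powr p"
      unfolding W_def by (rule powr_mult[symmetric])
    finally show ?case .
  qed
  moreover have "AE x in MA. 0 \<le> W x"
    using nn by eventually_elim (simp add: W_def m_def)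
  ultimately have sol: "polar_solution a b p \<beta> \<epsilon> W S T S\<^sub>s S\<^sub>t T\<^sub>t"
    using HW HS HT p \<beta> \<epsilon> by unfold_locales auto
  note meas = polar_H1_L2[OF HW] polar_H1_L2[OF HS] polar_H1_L2[OF HT]
  have ae0: "AE x in MA. norm x powr (- \<beta>) = m x"
    using AE_space by eventually_elim (use An_nz mp in \<open>auto simp: space_MA\<close>)
  \<comment> \<open>The two forms of the factor agree on the annulus and differ at the origin, where
    \<open>norm x powr (- \<beta>)\<close> is 0 and \<open>m\<close> is 1; hence the transfer almost
    everywhere.\<close>
  define W' S' where "W' x = norm x powr (- \<beta>) * V x" and "S' x = norm x powr (- \<beta>) * (x$1 * V1 x + x$2 * V2 x - \<beta> * V x)" for x
  have on: "W x = W' x" "S x = S' x" if "x \<in> An" for x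
    using mp[of x] An_nz that by (auto simp: W_def W'_def S_def S'_def E_def)
  have ms: "W' \<in> borel_measurable MA" "S' \<in> borel_measurable MA"
  proof -
    have "W \<in> borel_measurable MA \<longleftrightarrow> W' \<in> borel_measurable MA" "S \<in> borel_measurable MA \<longleftrightarrow> S' \<in> borel_measurable MA"
      by (rule measurable_cong, simp add: space_MA on)+
    then show "W' \<in> borel_measurable MA" "S' \<in> borel_measurable MA"
      using meas(1,2)[THEN L2_measurable] by (simp_all add: MA_def)
  qed
  have aeW: "AE x in MA. W x = W' x" and aeS: "AE x in MA. S x = S' x"
    using on by (auto simp: space_MA intro!: AE_I2)
  have "polar_solution a b p \<beta> \<epsilon> W' S' T S\<^sub>s S\<^sub>t T\<^sub>t"
  proof -
    have W': "polar_H1 An W' S' T" and S': "polar_H1 An S' S\<^sub>s S\<^sub>t"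
      using polar_H1_cong_AE[OF HW, folded MA_def, OF aeW ms(1) aeS ms(2)]
        polar_H1_cong_AE[OF HS, folded MA_def, OF aeS ms(2)] meas by (auto simp: L2_def MA_def)
    have "AE x in MA. S\<^sub>s x + (2 * \<beta> + \<epsilon>) * S' x + \<beta> * (\<beta> + \<epsilon>) * W' x + (1 + \<epsilon>) * T\<^sub>t x = W' x powr p"
      using polar_solution.eq[OF sol] aeW aeS by eventually_elim simp
    moreover have "AE x in MA. 0 \<le> W' x" using nn by eventually_elim (simp add: W'_def)
    ultimately show ?thesis using W' S' HT p \<beta> \<epsilon> by unfold_locales auto
  qed
  then show ?thesis unfolding W'_def[abs_def] S'_def[abs_def] by blast
qed

section \<open>The defect as a function on the disc, independent of the annulus\<close>

lemma (in annulus) AE_MA_iff: "(AE x in MA. P x) \<longleftrightarrow> (AE x in lebesgue. x \<in> An \<longrightarrow> P x)"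
  unfolding MA_def using open_An by (simp add: AE_restrict_space_iff AE_completion_iff)

text \<open>The solution triple changes with the annulus, but \<open>g\<close> does not; nonnegative
  integrals of \<open>g\<close> over the whole plane make the estimates on different annuli
  comparable.\<close>

lemma (in polar_solution) nn_integral_PI:
  assumes \<psi>: "\<psi> \<in> borel_measurable borel" "\<And>s. 0 \<le> \<psi> s" "\<And>s. \<psi> s \<le> 1"
    and g: "AE x in lebesgue. x \<in> An \<longrightarrow> S x * S x / (norm x)\<^sup>2 = g x"
  shows "(\<integral>\<^sup>+x. ennreal (\<psi> (ln (norm x)) * (indicator An x * g x)) \<partial>lebesgue) = ennreal (PI \<psi> (\<lambda>x. S x * S x))"
proof -
  have b: "\<bar>\<psi> s\<bar> \<le> 1" for s using \<psi>(2,3)[of s] by simp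
  have "ennreal (PI \<psi> (\<lambda>x. S x * S x)) = (\<integral>\<^sup>+x. ennreal (\<psi> (ln (norm x)) / (norm x)\<^sup>2 * (S x * S x)) \<partial>MA)"
    unfolding PI_def
    using weight_integrable[OF \<psi>(1) b L2_integrable_mult[OF L2s(2,2)]] \<psi>(2)
    by (intro nn_integral_eq_integral[symmetric]) auto
  also have "\<dots> = (\<integral>\<^sup>+x. ennreal (\<psi> (ln (norm x)) / (norm x)\<^sup>2 * (S x * S x)) * indicator An x \<partial>lborel)"
    unfolding MA_def using open_An by (intro nn_integral_restrict_space) auto
  also have "\<dots> = (\<integral>\<^sup>+x. ennreal (\<psi> (ln (norm x)) / (norm x)\<^sup>2 * (S x * S x)) * indicator An x \<partial>lebesgue)"
    by (rule nn_integral_completion[symmetric])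
  also have "\<dots> = (\<integral>\<^sup>+x. ennreal (\<psi> (ln (norm x)) * (indicator An x * g x)) \<partial>lebesgue)"
  proof (rule nn_integral_cong_AE)
    show "AE x in lebesgue. ennreal (\<psi> (ln (norm x)) / (norm x)\<^sup>2 * (S x * S x)) * indicator An x =
        ennreal (\<psi> (ln (norm x)) * (indicator An x * g x))"
      using g
    proof eventually_elim
      case (elim x)
      show ?case
      proof (cases "x \<in> An")
        case True
        then have "g x = S x * S x / (norm x)\<^sup>2" using elim by simp
        then show ?thesis using True by simp
      qed simp
    qed
  qed
  finally show ?thesis by simp
qed

text \<open>The defect contains an arbitrarily chosen weak derivative; its measurability is
  inherited almost everywhere from the representatives.\<close>

lemma (in polar_solution) measurable_on_annulus:
  assumes g: "AE x in lebesgue. x \<in> An \<longrightarrow> S x * S x / (norm x)\<^sup>2 = g x"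
  shows "(\<lambda>x. indicator An x * g x) \<in> borel_measurable lebesgue"
proof (rule borel_measurable_AE)
  have "continuous_on An (\<lambda>x. inverse ((norm x)\<^sup>2))"
    using An_nz by (auto intro!: continuous_intros)
  from borel_measurable_times[OF borel_measurable_times[OF L2_measurable[OF L2s(2)] L2_measurable[OF L2s(2)]]
      measurable_MA[OF this]]
  have "(\<lambda>x. S x * S x / (norm x)\<^sup>2) \<in> borel_measurable MA"
    by (simp add: divide_inverse)
  then have "(\<lambda>x. S x * S x / (norm x)\<^sup>2 * indicator An x) \<in> borel_measurable lborel"
    unfolding MA_def using open_An
    by (subst (asm) borel_measurable_restrict_space_iff) (auto simp: mult.commute[of "indicator _ _"])
  then show "(\<lambda>x. S x * S x / (norm x)\<^sup>2 * indicator An x) \<in> borel_measurable lebesgue"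
    by (rule measurable_completion)
  show "AE x in lebesgue. S x * S x / (norm x)\<^sup>2 * indicator An x = indicator An x * g x"
    using g
  proof eventually_elim
    case (elim x)
    then show ?case by (cases "x \<in> An") auto
  qed
qed

definition radial_defect :: "real \<Rightarrow> (real^2 \<Rightarrow> real) \<Rightarrow> real^2 \<Rightarrow> real" where
  "radial_defect \<beta> v x = (\<beta> * (v x / norm x powr \<beta>) - radial_deriv (ball 0 1) v x / norm x powr (\<beta> - 1))\<^sup>2 / (norm x)\<^sup>2"

text \<open>Up to its sign, the difference inside the square of the defect is W_s: differentiating
  \<open>r powr (- \<beta>) v\<close> in ln r gives
  \<open>r powr (- \<beta>) (r v_r - \<beta> v)\<close>.\<close>

lemma (in annulus) polar_solution_of_strong_solution:
  assumes p: "0 \<le> p" "p < 1" and \<beta>: "\<beta> = 2 / (1 - p)" and \<epsilon>: "\<bar>\<epsilon>\<bar> < 1" and b: "b < 1"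
    and v: "\<forall>x\<in>ball 0 1. 0 \<le> v x" "strong_solution (coeff_matrix \<epsilon>) p (ball 0 1) v"
  shows "\<exists>W S T S\<^sub>s S\<^sub>t T\<^sub>t. polar_solution a b p \<beta> \<epsilon> W S T S\<^sub>s S\<^sub>t T\<^sub>t \<and>
    (AE x in lebesgue. x \<in> An \<longrightarrow> W x = norm x powr (- \<beta>) * v x) \<and>
    (AE x in lebesgue. x \<in> An \<longrightarrow> S x * S x / (norm x)\<^sup>2 = radial_defect \<beta> v x)"
proof -
  let ?B = "ball (0::real^2) 1"
  have W2: "W2_loc 2 ?B v" using v(2) by (simp add: strong_solution_def)
  have AnB: "x \<in> ?B" if "x \<in> An" for x using that b by (simp add: An_def)
  obtain V V1 V2 V11 V12 V22 where
    H: "polar_H1 An V (\<lambda>x. x$1 * V1 x + x$2 * V2 x) (\<lambda>x. x$1 * V2 x + - x$2 * V1 x)"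
      "polar_H1 An V1 (\<lambda>x. x$1 * V11 x + x$2 * V12 x) (\<lambda>x. x$1 * V12 x + - x$2 * V11 x)"
      "polar_H1 An V2 (\<lambda>x. x$1 * V12 x + x$2 * V22 x) (\<lambda>x. x$1 * V22 x + - x$2 * V12 x)"
    and ae: "AE x in lebesgue. x \<in> An \<longrightarrow> V x = v x \<and> V1 x = weak_partial ?B 1 v x \<and> V2 x = weak_partial ?B 2 v x \<and>
      V11 x = weak_partial ?B 1 (weak_partial ?B 1 v) x \<and>
      V12 x = weak_partial ?B 2 (weak_partial ?B 1 v) x \<and>
      V12 x = weak_partial ?B 1 (weak_partial ?B 2 v) x \<and>
      V22 x = weak_partial ?B 2 (weak_partial ?B 2 v) x"
    using polar_H1_of_W2_loc[OF W2 b] by blast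
  have "AE x in lebesgue_on ?B.
        (\<Sum>i\<in>UNIV. \<Sum>j\<in>UNIV. coeff_matrix \<epsilon> x $ i $ j * weak_partial ?B j (weak_partial ?B i v) x) = v x powr p"
    using v(2) by (simp add: strong_solution_def)
  then have eq0: "AE x in lebesgue. x \<in> ?B \<longrightarrow>
        (\<Sum>i\<in>UNIV. \<Sum>j\<in>UNIV. coeff_matrix \<epsilon> x $ i $ j * weak_partial ?B j (weak_partial ?B i v) x) = v x powr p"
    by (subst (asm) AE_restrict_space_iff) auto
  have nn: "AE x in MA. 0 \<le> V x"
    unfolding AE_MA_iff using ae by eventually_elim (use v(1) AnB in auto)
  have eq: "AE x in MA. (1 + \<epsilon> * (x$2)\<^sup>2 / (norm x)\<^sup>2) * V11 x - 2 * (\<epsilon> * x$1 * x$2 / (norm x)\<^sup>2) * V12 x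
       + (1 + \<epsilon> * (x$1)\<^sup>2 / (norm x)\<^sup>2) * V22 x = V x powr p"
    unfolding AE_MA_iff using ae eq0
  proof eventually_elim
    case (elim x)
    show ?case
    proof
      assume x: "x \<in> An"
      note e = mp[OF elim(1) x]
      have "V x powr p = v x powr p" using e by simp
      also have "\<dots> = (\<Sum>i\<in>UNIV. \<Sum>j\<in>UNIV. coeff_matrix \<epsilon> x $ i $ j * weak_partial ?B j (weak_partial ?B i v) x)"
        using elim(2) AnB[OF x] by simp
      also have "\<dots> = (1 + \<epsilon> * (x$2)\<^sup>2 / (norm x)\<^sup>2) * V11 x - 2 * (\<epsilon> * x$1 * x$2 / (norm x)\<^sup>2) * V12 x
       + (1 + \<epsilon> * (x$1)\<^sup>2 / (norm x)\<^sup>2) * V22 x"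
        using e by (simp add: sum_2 coeff_matrix_def algebra_simps)
      finally show "(1 + \<epsilon> * (x$2)\<^sup>2 / (norm x)\<^sup>2) * V11 x - 2 * (\<epsilon> * x$1 * x$2 / (norm x)\<^sup>2) * V12 x
       + (1 + \<epsilon> * (x$1)\<^sup>2 / (norm x)\<^sup>2) * V22 x = V x powr p" by simp
    qed
  qed
  define W S where "W x = norm x powr (- \<beta>) * V x" and
    "S x = norm x powr (- \<beta>) * (x$1 * V1 x + x$2 * V2 x - \<beta> * V x)" for x
  obtain T S\<^sub>s S\<^sub>t T\<^sub>t where sol: "polar_solution a b p \<beta> \<epsilon> W S T S\<^sub>s S\<^sub>t T\<^sub>t"
    using polar_solution_of_W2[OF H p \<beta> \<epsilon> nn eq] unfolding W_def[abs_def] S_def[abs_def] by blast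
  have 1: "AE x in lebesgue. x \<in> An \<longrightarrow> W x = norm x powr (- \<beta>) * v x"
    using ae by eventually_elim (simp add: W_def)
  have 2: "AE x in lebesgue. x \<in> An \<longrightarrow> S x * S x / (norm x)\<^sup>2 = radial_defect \<beta> v x"
    using ae
  proof eventually_elim
    case (elim x)
    show ?case
    proof
      assume x: "x \<in> An"
      note e = mp[OF elim x]
      have n: "0 < norm x" using An_nz x by auto
      have g: "weak_gradient ?B v x \<bullet> (x /\<^sub>R norm x) = (x$1 * V1 x + x$2 * V2 x) / norm x"
        using e by (simp add: weak_gradient_def inner_vec_def sum_2 divide_inverse algebra_simps)
      have "norm x powr (\<beta> - 1) = norm x powr \<beta> / norm x" using n by (simp add: powr_diff)
      then have "radial_deriv ?B v x / norm x powr (\<beta> - 1) = norm x powr (- \<beta>) * (x$1 * V1 x + x$2 * V2 x)"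
        unfolding radial_deriv_def g using n by (simp add: powr_minus divide_inverse)
      moreover have "\<beta> * (v x / norm x powr \<beta>) = norm x powr (- \<beta>) * (\<beta> * V x)"
        using e by (simp add: powr_minus divide_inverse)
      ultimately have "\<beta> * (v x / norm x powr \<beta>) - radial_deriv ?B v x / norm x powr (\<beta> - 1) = - S x"
        by (simp add: S_def algebra_simps)
      then show "S x * S x / (norm x)\<^sup>2 = radial_defect \<beta> v x"
        by (simp add: radial_defect_def power2_eq_square)
    qed
  qed
  show ?thesis using sol 1 2 by blast
qed

text \<open>The blow-ups converge uniformly on the ball of radius 3, which contains the closed disc
  of radius e, so along a subsequence \<open>v / \<rho>\<^sup>\<beta>\<close> is bounded on shells
  of logarithmic width 1. The constant is a bound for the blow-up limit plus the uniform distance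
  1.\<close>

lemma nondegenerate_growth:
  fixes v :: "real^2 \<Rightarrow> real"
  assumes nd: "nondegenerate_at_0 \<beta> v" and \<beta>: "0 < \<beta>"
  shows "\<exists>\<rho> K. 0 \<le> K \<and> (\<forall>k::nat. 0 < \<rho> k) \<and> \<rho> \<longlonglongrightarrow> 0 \<and>
    (\<forall>\<^sub>F k in sequentially. \<forall>x. \<rho> k \<le> norm x \<and> norm x \<le> exp 1 * \<rho> k \<longrightarrow> norm x powr (- \<beta>) * v x \<le> K)"
proof -
  obtain r v0 s where r: "\<And>k. 0 < r k" "r \<longlonglongrightarrow> 0" and s: "strict_mono s"
    and lim: "C1_loc_limit (\<lambda>k. blowup \<beta> v (r (s k))) v0"
    using nd by (auto simp: nondegenerate_at_0_def blowup_limit_def)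
  have "C_class (Suc 0) UNIV v0" using lim by (simp add: C1_loc_limit_def)
  then have "continuous_on UNIV v0" using C_class_Suc_imp[of 0 v0] by simp
  then have "continuous_on (cball 0 3) v0" by (rule continuous_on_subset) simp
  then have "bounded (v0 ` cball 0 3)"
    by (intro compact_imp_bounded compact_continuous_image compact_cball)
  then obtain M where "\<forall>y\<in>v0 ` cball 0 3. norm y \<le> M" unfolding bounded_iff by blast
  then have M: "\<And>x. x \<in> cball 0 3 \<Longrightarrow> \<bar>v0 x\<bar> \<le> M" by auto
  have M0: "0 \<le> M" using order_trans[OF abs_ge_zero M[of 0]] by simp
  define \<rho> where "\<rho> k = r (s k)" for k
  have \<rho>: "\<rho> \<longlonglongrightarrow> 0" "\<And>k. 0 < \<rho> k"
    using LIMSEQ_subseq_LIMSEQ[OF r(2) s] r(1) by (auto simp: \<rho>_def[abs_def] comp_def)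
  have "uniform_limit (ball 0 3) (\<lambda>k. blowup \<beta> v (r (s k))) v0 sequentially"
    using lim by (simp add: C1_loc_limit_def)
  then have "\<forall>\<^sub>F k in sequentially. \<forall>x\<in>ball 0 3. dist (blowup \<beta> v (r (s k)) x) (v0 x) < 1"
    by (rule uniform_limitD) simp
  then have "\<forall>\<^sub>F k in sequentially. \<forall>x. \<rho> k \<le> norm x \<and> norm x \<le> exp 1 * \<rho> k \<longrightarrow> norm x powr (- \<beta>) * v x \<le> M + 1"
  proof eventually_elim
    case (elim k)
    show ?case
    proof (intro allI impI, elim conjE)
      fix x :: "real^2" assume x: "\<rho> k \<le> norm x" "norm x \<le> exp 1 * \<rho> k"
      let ?y = "x /\<^sub>R \<rho> k"
      have "norm ?y \<le> exp 1" using x(2) \<rho>(2)[of k] by (simp add: divide_simps)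
      then have y: "?y \<in> ball 0 3" using e_less_272 by simp
      have "\<bar>blowup \<beta> v (\<rho> k) ?y - v0 ?y\<bar> < 1" using elim y by (auto simp: dist_real_def \<rho>_def)
      then have "blowup \<beta> v (\<rho> k) ?y \<le> M + 1" using M[of ?y] y by auto
      moreover have "blowup \<beta> v (\<rho> k) ?y = v x / \<rho> k powr \<beta>"
        using \<rho>(2)[of k] by (simp add: blowup_def)
      ultimately have "v x \<le> (M + 1) * \<rho> k powr \<beta>"
        using \<rho>(2)[of k] by (simp add: divide_le_eq)
      also have "\<dots> \<le> (M + 1) * norm x powr \<beta>"
        using x(1) \<rho>(2)[of k] \<beta> M0 by (intro mult_left_mono powr_mono2) auto
      finally have "norm x powr (- \<beta>) * v x \<le> norm x powr (- \<beta>) * ((M + 1) * norm x powr \<beta>)"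
        by (intro mult_left_mono) auto
      also have "\<dots> = M + 1"
      proof -
        have "norm x \<noteq> 0" using x(1) \<rho>(2)[of k] by linarith
        then show ?thesis by (simp add: powr_minus)
      qed
      finally show "norm x powr (- \<beta>) * v x \<le> M + 1" .
    qed
  qed
  then show ?thesis using \<rho> M0 by (intro exI[of _ \<rho>] exI[of _ "M + 1"]) auto
qed

section \<open>Dependence on the supremum, explicit radii, and the integral bound\<close>

lemma AE_le_Linfty_norm:
  assumes "Linfty_norm (ball 0 1) v < \<infinity>"
  shows "AE x in lebesgue. x \<in> ball 0 1 \<longrightarrow> \<bar>v x\<bar> \<le> enn2real (Linfty_norm (ball 0 1) v)"
proof -
  have "AE x in lebesgue_on (ball 0 1). ennreal \<bar>v x\<bar> \<le> Linfty_norm (ball 0 1) v"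
    unfolding Linfty_norm_def by (rule esssup_AE)
  then have "AE x in lebesgue. x \<in> ball 0 1 \<longrightarrow> ennreal \<bar>v x\<bar> \<le> Linfty_norm (ball 0 1) v"
    by (subst (asm) AE_restrict_space_iff) auto
  then show ?thesis
  proof eventually_elim
    case (elim x)
    show ?case
    proof
      assume "x \<in> ball 0 1"
      then have "ennreal \<bar>v x\<bar> \<le> ennreal (enn2real (Linfty_norm (ball 0 1) v))"
        using elim assms by simp
      then show "\<bar>v x\<bar> \<le> enn2real (Linfty_norm (ball 0 1) v)"
        by (subst (asm) ennreal_le_iff) auto
    qed
  qed
qed

text \<open>The disc of radius 1/2 must lie below the outer shell, which starts at
  \<open>exp (- 2 / 5)\<close>, and the outer shell must end below 9/10, the outer radius of every
  annulus used.\<close>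

lemma exp_radii: "(1::real) / 2 \<le> exp (- 2 / 5)" "exp (- 2 / 5) < (9::real) / 10" "- 1 / 5 < ln (9 / 10 :: real)"
proof -
  have "exp (2 / 5 :: real) \<le> 1 + 2 / 5 + (2 / 5)\<^sup>2" by (rule exp_bound) auto
  then have "exp (2 / 5 :: real) \<le> 2" by (simp add: power2_eq_square)
  then have "1 / 2 \<le> inverse (exp (2 / 5 :: real))" by (simp add: field_simps)
  then show "(1::real) / 2 \<le> exp (- 2 / 5)" by (simp add: exp_minus)
  have "1 + 2 / 5 \<le> exp (2 / 5 :: real)" by (rule exp_ge_add_one_self)
  then have "inverse (exp (2 / 5 :: real)) < 9 / 10" by (simp add: field_simps)
  then show "exp (- 2 / 5) < (9::real) / 10" by (simp add: exp_minus)
  have "1 + 1 / 5 \<le> exp (1 / 5 :: real)" by (rule exp_ge_add_one_self)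
  then have "inverse (exp (1 / 5 :: real)) < 9 / 10" by (simp add: field_simps)
  then have "exp (- 1 / 5) < (9 / 10 :: real)" by (simp add: exp_minus)
  then have "ln (exp (- 1 / 5)) < ln (9 / 10 :: real)" by (subst ln_less_cancel_iff) auto
  then show "- 1 / 5 < ln (9 / 10 :: real)" by simp
qed

theorem theorem1p3:
  fixes p \<beta> :: real
  assumes "0 \<le> p" and "p < 1" and "\<beta> = 2 / (1 - p)"
  shows "\<exists>\<epsilon>\<^sub>0>0. \<exists>C :: ennreal \<Rightarrow> real. (\<forall>M. 0 < C M) \<and>
    (\<forall>\<epsilon>::real. \<bar>\<epsilon>\<bar> < \<epsilon>\<^sub>0 \<longrightarrow>
      (\<forall>v :: real^2 \<Rightarrow> real.
        (\<forall>x\<in>ball 0 1. 0 \<le> v x) \<longrightarrow>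
        strong_solution (coeff_matrix \<epsilon>) p (ball 0 1) v \<longrightarrow>
        Linfty_norm (ball 0 1) v < \<infinity> \<longrightarrow>
        0 \<in> frontier {x \<in> ball 0 1. 0 < v x} \<longrightarrow>
        nondegenerate_at_0 \<beta> v \<longrightarrow>
        (\<integral>\<^sup>+x\<in>ball 0 (1/2).
            ennreal ((\<beta> * (v x / norm x powr \<beta>)
                       - radial_deriv (ball 0 1) v x / norm x powr (\<beta> - 1))\<^sup>2 / (norm x)\<^sup>2)
          \<partial>lebesgue) \<le> ennreal (C (Linfty_norm (ball 0 1) v))))"
proof -
  have \<beta>_pos: "0 < \<beta>" using assms by simp
  obtain st st1 st2 st3 :: "real \<Rightarrow> real" and B :: real where
    st: "\<And>s. (st has_real_derivative st1 s) (at s)" "\<And>s. (st1 has_real_derivative st2 s) (at s)"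
    "\<And>s. (st2 has_real_derivative st3 s) (at s)" "continuous_on UNIV st3"
    "\<And>s. s \<le> 0 \<Longrightarrow> st s = 0" "\<And>s. 1 \<le> s \<Longrightarrow> st s = 1" "\<And>s. 0 \<le> st s" "\<And>s. st s \<le> 1" "\<And>s. 0 \<le> st1 s"
    "\<And>s. s < 0 \<or> 1 < s \<Longrightarrow> st1 s = 0 \<and> st2 s = 0 \<and> st3 s = 0"
    "0 \<le> B" "\<And>s. \<bar>st1 s\<bar> \<le> B \<and> \<bar>st2 s\<bar> \<le> B \<and> \<bar>st3 s\<bar> \<le> B"
    using smooth_step_exists by blast
  \<comment> \<open>On the outer shell \<open>norm x powr (- \<beta>)\<close> is at most
    \<open>exp (2 / 5 * \<beta>)\<close>, since \<open>ln (norm x) \<ge> - 2 / 5\<close>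
    there.\<close>
  define N where "N M = enn2real M * exp (2 / 5 * \<beta>)" for M
  define C0 where "C0 M = shell_mass * B * (5 / 2 * N M powr (p + 1) + (125 / 4 + 25 / 4 * (2 * \<beta> + 1)) * (N M)\<^sup>2)" for M
  have C0: "0 \<le> C0 M" for M
    unfolding C0_def using shell_mass_nonneg st(11) \<beta>_pos by (intro mult_nonneg_nonneg add_nonneg_nonneg) auto
  show ?thesis
  proof (intro exI[of _ "1::real"] conjI exI[of _ "\<lambda>M. C0 M + 1"] allI impI)
    show "0 < C0 M + 1" for M using C0[of M] by simp
    fix \<epsilon> :: real and v :: "real^2 \<Rightarrow> real"
    assume \<epsilon>: "\<bar>\<epsilon>\<bar> < 1" and v0: "\<forall>x\<in>ball 0 1. 0 \<le> v x" and sol: "strong_solution (coeff_matrix \<epsilon>) p (ball 0 1) v"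
      and fin: "Linfty_norm (ball 0 1) v < \<infinity>" and nd: "nondegenerate_at_0 \<beta> v"
    let ?L = "Linfty_norm (ball 0 1) v" and ?b = "9 / 10 :: real" and ?R = "exp (- 2 / 5) :: real"
    define g where "g = radial_defect \<beta> v"
    have g0: "0 \<le> g x" for x by (simp add: g_def radial_defect_def)
    obtain \<rho> K where K: "0 \<le> K" and \<rho>: "\<And>k::nat. 0 < \<rho> k" "\<rho> \<longlonglongrightarrow> 0"
      and growth: "\<forall>\<^sub>F k in sequentially. \<forall>x. \<rho> k \<le> norm x \<and> norm x \<le> exp 1 * \<rho> k \<longrightarrow> norm x powr (- \<beta>) * v x \<le> K"
      using nondegenerate_growth[OF nd \<beta>_pos] by blast
    define h where "h x = indicator {0<..<?b} (norm x) * g x" for x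
    have polar: "\<exists>W S T S\<^sub>s S\<^sub>t T\<^sub>t. polar_solution a ?b p \<beta> \<epsilon> W S T S\<^sub>s S\<^sub>t T\<^sub>t \<and>
      (AE x in lebesgue. x \<in> annulus.An a ?b \<longrightarrow> W x = norm x powr (- \<beta>) * v x) \<and>
      (AE x in lebesgue. x \<in> annulus.An a ?b \<longrightarrow> S x * S x / (norm x)\<^sup>2 = g x)" if "0 < a" "a < ?b" for a
    proof -
      interpret annulus a ?b using that by unfold_locales auto
      show ?thesis unfolding g_def
        by (rule polar_solution_of_strong_solution[OF assms \<epsilon> _ v0 sol]) simp
    qed
    have hm: "h \<in> borel_measurable lebesgue"
    proof (rule borel_measurable_LIMSEQ_real)
      \<comment> \<open>Starting at 1/2 keeps every inner radius below 9/10; the annuli then exhaust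
        the punctured disc.\<close>
      define a where "a n = inverse (real (Suc (Suc n)))" for n
      have a: "0 < a n" "a n < ?b" for n by (auto simp: a_def field_simps)
      have a0: "a \<longlonglongrightarrow> 0"
        unfolding a_def[abs_def] using LIMSEQ_Suc[OF LIMSEQ_inverse_real_of_nat] .
      show "(\<lambda>x. indicator (annulus.An (a n) ?b) x * g x) \<in> borel_measurable lebesgue" for n
      proof -
        obtain W S T S\<^sub>s S\<^sub>t T\<^sub>t where ps: "polar_solution (a n) ?b p \<beta> \<epsilon> W S T S\<^sub>s S\<^sub>t T\<^sub>t"
          and ae: "AE x in lebesgue. x \<in> annulus.An (a n) ?b \<longrightarrow> S x * S x / (norm x)\<^sup>2 = g x"
          using polar[OF a] by blast
        show ?thesis by (rule polar_solution.measurable_on_annulus[OF ps ae])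
      qed
      fix x :: "real^2"
      have An: "annulus.An (a n) ?b = {x. a n < norm x \<and> norm x < ?b}" for n
        using a[of n] by (intro annulus.An_def) (unfold_locales, auto)
      have "\<forall>\<^sub>F n in sequentially. indicator (annulus.An (a n) ?b) x * g x = h x"
      proof (cases "0 < norm x")
        case True
        have "\<forall>\<^sub>F n in sequentially. a n < norm x" using a0 True by (rule order_tendstoD(2))
        then show ?thesis by eventually_elim (use True in \<open>auto simp: h_def An indicator_def\<close>)
      next
        case False
        then have "indicator (annulus.An (a n) ?b) x * g x = h x" for n
          using a(1)[of n] by (simp add: h_def An)
        then show ?thesis by simp
      qed
      then show "(\<lambda>n. indicator (annulus.An (a n) ?b) x * g x) \<longlonglongrightarrow> h x" by (rule tendsto_eventually)
    qed
    have h0: "0 \<le> h x" for x using g0 by (simp add: h_def)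
    have small\<rho>: "\<forall>\<^sub>F k in sequentially. exp 1 * \<rho> k < ?R"
    proof -
      have "(\<lambda>k. exp 1 * \<rho> k) \<longlonglongrightarrow> exp 1 * 0" by (intro tendsto_intros \<rho>)
      then show ?thesis by (rule order_tendstoD(2)) simp
    qed
    define u where "u k = (\<integral>\<^sup>+x. ennreal (indicator {exp 1 * \<rho> k..?R} (norm x) * h x) \<partial>lebesgue)" for k
    define w where "w k = (\<integral>\<^sup>+x. ennreal (indicator {\<rho> k..exp 1 * \<rho> k} (norm x) * h x) \<partial>lebesgue)" for k
    have est: "\<forall>\<^sub>F k in sequentially.
       u k \<le> ennreal (C0 ?L + (2 * (2 * \<beta> + 1) + 1 + \<beta> * (\<beta> + 1)) * (B * (K\<^sup>2 * shell_mass))) \<and>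
       (\<forall>\<delta>>0. \<forall>J\<ge>0. w k = ennreal J \<longrightarrow>
         u k \<le> ennreal (C0 ?L + B * J + ((2 * \<beta> + 2) * B) * (\<delta> * (K\<^sup>2 * shell_mass) + J / \<delta>)))"
      using growth small\<rho>
    proof eventually_elim
      case (elim k)
      \<comment> \<open>The annulus starts below the inner shell because the cutoff must vanish near
        its inner circle.\<close>
      let ?a = "\<rho> k / 2" and ?\<tau> = "ln (\<rho> k)"
      have le_e: "1 * \<rho> k \<le> exp 1 * \<rho> k" using \<rho>(1)[of k] by (intro mult_right_mono) auto
      then have ab: "0 < ?a" "?a < ?b" "\<rho> k < ?R" using \<rho>(1)[of k] elim(2) exp_radii(2) by linarith+
      obtain W S T S\<^sub>s S\<^sub>t T\<^sub>t where ps: "polar_solution ?a ?b p \<beta> \<epsilon> W S T S\<^sub>s S\<^sub>t T\<^sub>t"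
        and aeW: "AE x in lebesgue. x \<in> annulus.An ?a ?b \<longrightarrow> W x = norm x powr (- \<beta>) * v x"
        and aeS: "AE x in lebesgue. x \<in> annulus.An ?a ?b \<longrightarrow> S x * S x / (norm x)\<^sup>2 = g x"
        using polar[OF ab(1,2)] by blast
      interpret polar_solution ?a ?b p \<beta> \<epsilon> W S T S\<^sub>s S\<^sub>t T\<^sub>t by (rule ps)
      have \<tau>1: "?\<tau> + 1 = ln (exp 1 * \<rho> k)" using \<rho>(1)[of k] by (simp add: ln_mult)
      have ln_le: "ln r \<le> s \<longleftrightarrow> r \<le> exp s" if "0 < r" for r s :: real
        using that by (metis exp_le_cancel_iff exp_ln)
      have le_ln: "s \<le> ln r \<longleftrightarrow> exp s \<le> r" if "0 < r" for r s :: real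
        using that by (rule ln_ge_iff)
      have shell: "?\<tau> \<le> ln (norm x) \<and> ln (norm x) \<le> ?\<tau> + 1 \<longleftrightarrow> \<rho> k \<le> norm x \<and> norm x \<le> exp 1 * \<rho> k"
        if "x \<in> An" for x
        using that An_nz(1)[OF that] \<rho>(1)[of k] unfolding \<tau>1 by (simp add: ln_le_cancel_iff)
      interpret energy_estimate ?a ?b p \<beta> \<epsilon> W S T S\<^sub>s S\<^sub>t T\<^sub>t st st1 st2 st3 B ?\<tau> K "N ?L"
      proof (unfold_locales; (rule st; assumption)?)
        show "ln ?a < ?\<tau>" using \<rho>(1)[of k] by simp
        show "?\<tau> + 1 \<le> - 2 / 5" unfolding \<tau>1 using elim(2) \<rho>(1)[of k] by (subst ln_le) auto
        show "- 1 / 5 < ln ?b" by (rule exp_radii(3))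
        show "0 \<le> K" by (rule K)
        show "AE x in MA. ?\<tau> \<le> ln (norm x) \<and> ln (norm x) \<le> ?\<tau> + 1 \<longrightarrow> W x \<le> K"
          unfolding AE_MA_iff using aeW by eventually_elim (use elim(1) shell in auto)
        show "0 \<le> N ?L" by (simp add: N_def)
        show "AE x in MA. - 2 / 5 \<le> ln (norm x) \<and> ln (norm x) \<le> - 1 / 5 \<longrightarrow> W x \<le> N ?L"
          unfolding AE_MA_iff using aeW AE_le_Linfty_norm[OF fin]
        proof eventually_elim
          case (elim x)
          show ?case
          proof (intro impI, elim conjE)
            assume x: "x \<in> An" "- 2 / 5 \<le> ln (norm x)"
            then have nx: "x \<noteq> 0" "x \<in> ball 0 1" using An_nz by (auto simp: An_def)
            have "- \<beta> * ln (norm x) \<le> 2 / 5 * \<beta>"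
              using mult_left_mono[OF x(2), of \<beta>] \<beta>_pos by simp
            then have "norm x powr (- \<beta>) \<le> exp (2 / 5 * \<beta>)" using nx by (simp add: powr_def)
            then have "norm x powr (- \<beta>) * \<bar>v x\<bar> \<le> exp (2 / 5 * \<beta>) * enn2real ?L"
              using elim(2) nx by (intro mult_mono) auto
            moreover have "W x \<le> norm x powr (- \<beta>) * \<bar>v x\<bar>"
              using elim(1) x(1) by (auto intro: mult_left_mono)
            ultimately show "W x \<le> N ?L" by (simp add: N_def mult.commute)
          qed
        qed
      qed
      have ob: "outer_bound = C0 ?L" by (simp add: outer_bound_def C0_def)
      have \<phi>m: "\<phi> \<in> borel_measurable borel"
        using cutoff_\<phi> by (auto simp: cutoff_def intro: borel_measurable_continuous_onI)
      have \<phi>1: "\<phi> s \<le> 1" for s using \<phi>_bounds(3)[of s] by simp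
      have "u k \<le> (\<integral>\<^sup>+x. ennreal (\<phi> (ln (norm x)) * (indicator An x * g x)) \<partial>lebesgue)"
        unfolding u_def
      proof (intro nn_integral_mono ennreal_leI)
        fix x :: "real^2"
        show "indicator {exp 1 * \<rho> k..?R} (norm x) * h x \<le> \<phi> (ln (norm x)) * (indicator An x * g x)"
        proof (cases "norm x \<in> {exp 1 * \<rho> k..?R}")
          case True
          then have "exp 1 * \<rho> k \<le> norm x" "norm x \<le> ?R" by simp_all
          then have nx: "\<rho> k \<le> norm x" "exp 1 * \<rho> k \<le> norm x" "norm x \<le> ?R" "0 < norm x"
            using le_e \<rho>(1)[of k] by linarith+
          then have "x \<in> An" using exp_radii(2) \<rho>(1)[of k] by (simp add: An_def)
          moreover have "\<phi> (ln (norm x)) = 1"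
          proof (rule \<phi>_bounds(2))
            show "?\<tau> + 1 \<le> ln (norm x)" unfolding \<tau>1 using nx \<rho>(1)[of k] by (subst ln_le_cancel_iff) auto
            show "ln (norm x) \<le> - 2 / 5" using nx by (subst ln_le) auto
          qed
          moreover have "h x \<le> g x" using g0[of x] by (simp add: h_def indicator_def)
          ultimately show ?thesis using True by simp
        next
          case False
          then have "indicator {exp 1 * \<rho> k..?R} (norm x) * h x = 0" by simp
          then show ?thesis using \<phi>_bounds(1)[of "ln (norm x)"] g0[of x] by (simp only: mult_nonneg_nonneg indicator_pos_le)
        qed
      qed
      also have "\<dots> = ennreal (PI \<phi> (\<lambda>x. S x * S x))"
        by (rule nn_integral_PI[OF \<phi>m \<phi>_bounds(1) \<phi>1 aeS])
      finally have uk: "u k \<le> ennreal (PI \<phi> (\<lambda>x. S x * S x))" .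
      have "ennreal J = (\<integral>\<^sup>+x. ennreal (indicator {?\<tau>..?\<tau> + 1} (ln (norm x)) * (indicator An x * g x)) \<partial>lebesgue)"
        unfolding J_def by (rule nn_integral_PI[OF _ _ _ aeS, symmetric]) (auto simp: indicator_def)
      also have "\<dots> = w k"
        unfolding w_def
      proof (intro nn_integral_cong arg_cong[where f=ennreal])
        fix x :: "real^2"
        show "indicator {?\<tau>..?\<tau> + 1} (ln (norm x)) * (indicator An x * g x) = indicator {\<rho> k..exp 1 * \<rho> k} (norm x) * h x"
        proof (cases "x \<in> An")
          case True
          then have "h x = g x" using An_nz(1)[OF True] by (simp add: h_def An_def)
          moreover have "(indicator {?\<tau>..?\<tau> + 1} (ln (norm x)) :: real) = indicator {\<rho> k..exp 1 * \<rho> k} (norm x)"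
            using shell[OF True] by (simp add: indicator_def)
          ultimately show ?thesis using True by simp
        next
          case False
          have "norm x \<notin> {\<rho> k..exp 1 * \<rho> k}"
            using False \<rho>(1)[of k] elim(2) exp_radii(2) by (auto simp: An_def)
          then show ?thesis using False by simp
        qed
      qed
      finally have wk: "w k = ennreal J" by simp
      have J0: "0 \<le> J" unfolding J_def by (intro PI_nonneg) auto
      show ?case
      proof (intro conjI allI impI)
        show "u k \<le> ennreal (C0 ?L + (2 * (2 * \<beta> + 1) + 1 + \<beta> * (\<beta> + 1)) * (B * (K\<^sup>2 * shell_mass)))"
          using order_trans[OF uk ennreal_leI[OF PI_\<phi>_bounded]] unfolding ob .
        fix \<delta> J' :: real assume \<delta>: "0 < \<delta>" and J': "0 \<le> J'" "w k = ennreal J'"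
        then have JJ: "J' = J" using wk J0 by simp
        show "u k \<le> ennreal (C0 ?L + B * J' + ((2 * \<beta> + 2) * B) * (\<delta> * (K\<^sup>2 * shell_mass) + J' / \<delta>))"
          using order_trans[OF uk ennreal_leI[OF PI_\<phi>_small[OF \<delta>]]] unfolding ob JJ mult.assoc .
      qed
    qed
    have "(\<integral>\<^sup>+x. ennreal (indicator {0<..?R} (norm x) * h x) \<partial>lebesgue) \<le> ennreal (C0 ?L + 1)"
    proof (rule nn_integral_punctured_le[OF hm h0 \<rho>])
      show "\<forall>\<^sub>F k in sequentially. (\<integral>\<^sup>+x. ennreal (indicator {exp 1 * \<rho> k..?R} (norm x) * h x) \<partial>lebesgue)
        \<le> ennreal (C0 ?L + (2 * (2 * \<beta> + 1) + 1 + \<beta> * (\<beta> + 1)) * (B * (K\<^sup>2 * shell_mass)))"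
        using est unfolding u_def by (rule eventually_mono) blast
      show "\<forall>\<^sub>F k in sequentially. \<forall>J\<ge>0.
        (\<integral>\<^sup>+x. ennreal (indicator {\<rho> k..exp 1 * \<rho> k} (norm x) * h x) \<partial>lebesgue) = ennreal J \<longrightarrow>
        (\<integral>\<^sup>+x. ennreal (indicator {exp 1 * \<rho> k..?R} (norm x) * h x) \<partial>lebesgue)
          \<le> ennreal (C0 ?L + B * J + ((2 * \<beta> + 2) * B) * (\<delta> * (K\<^sup>2 * shell_mass) + J / \<delta>))" if "0 < \<delta>" for \<delta>
        using est unfolding u_def w_def by (rule eventually_mono) (use that in blast)
      show "0 \<le> (2 * \<beta> + 2) * B" "0 \<le> K\<^sup>2 * shell_mass" using \<beta>_pos st(11) shell_mass_nonneg by simp_all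
    qed simp
    moreover have "(\<integral>\<^sup>+x\<in>ball 0 (1/2). ennreal (g x) \<partial>lebesgue) \<le> (\<integral>\<^sup>+x. ennreal (indicator {0<..?R} (norm x) * h x) \<partial>lebesgue)"
    proof (rule nn_integral_mono)
      fix x :: "real^2"
      show "ennreal (g x) * indicator (ball 0 (1/2)) x \<le> ennreal (indicator {0<..?R} (norm x) * h x)"
      proof (cases "x \<in> ball 0 (1/2) \<and> x \<noteq> 0")
        case True
        then have "norm x \<in> {0<..?R}" "norm x \<in> {0<..<?b}" using exp_radii(1) by auto
        then show ?thesis using True by (simp add: h_def)
      next
        case False
        \<comment> \<open>Division by zero gives 0, so the origin contributes nothing even
          pointwise.\<close>
        moreover have "g 0 = 0" by (simp add: g_def radial_defect_def)
        ultimately show ?thesis by auto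
      qed
    qed
    ultimately show "(\<integral>\<^sup>+x\<in>ball 0 (1/2).
            ennreal ((\<beta> * (v x / norm x powr \<beta>)
                       - radial_deriv (ball 0 1) v x / norm x powr (\<beta> - 1))\<^sup>2 / (norm x)\<^sup>2)
          \<partial>lebesgue) \<le> ennreal (C0 ?L + 1)"
      unfolding g_def radial_defect_def by (rule order_trans[rotated])
  qed simp
qed

end
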